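(* Let $N\ge 1$ and $1<r<q$. Let $\Omega\subset\mathbb{R}^N$ be a bounded domain such that $$W^{1,q}(\Omega)\cap W_0^{1,r}(\Omega)=W_0^{1,q}(\Omega).$$ Then $\lambda_k(q)=\lambda_k(q;r)$ for all $k\in\mathbb{N}$.
   Context: $\|\cdot\|_s$ is the norm of $L^s(\Omega)$; $W^{1,s}=W^{1,s}(\Omega)$, and $W_0^{1,s}=W_0^{1,s}(\Omega)$ is equipped with the norm $\|\nabla u\|_s$. Krasnoselskii genus: for a symmetric subset $A=-A$ of a topological vector space $X$, $\gamma(A;X)=\inf\{k\in\mathbb{N}:\exists\, h\in C(A,\mathbb{R}^k\setminus\{0\}),\ h\text{ odd}\}$, continuity of $h$ being with respect to the topology of $X$; $\gamma(A;X)=+\infty$ if no such $h$ exists, and $\gamma(\emptyset;X)=0$. For $s>1$, $\Sigma_k(s)$ is the set of all symmetric $A\subset W_0^{1,s}\setminus\{0\}$ which are compact in $W_0^{1,s}$ and satisfy $\gamma(A;W_0^{1,s})\ge k$. Define $$\lambda_k(q)=\inf\Big\{\max_{u\in A}\frac{\|\nabla u\|_q^q}{\|u\|_q^q}: A\in\Sigma_k(q)\Big\},\qquad \lambda_k(q;r)=\inf\Big\{\sup_{u\in A}\frac{\|\nabla u\|_q^q}{\|u\|_q^q}: A\in\Sigma_k(r),\ A\subset W^{1,q}\Big\}.$$ *)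

theory Defs
  imports "HOL-Analysis.Analysis"
begin

section \<open>Measurable functions modulo equality almost everywhere\<close>

text \<open>
  Elements of the spaces \<open>L\<^sup>s(\<Omega>)\<close>, \<open>W\<^sup>1\<^sup>,\<^sup>s(\<Omega>)\<close> and \<open>W\<^sub>0\<^sup>1\<^sup>,\<^sup>s(\<Omega>)\<close> are classes of functions modulo
  equality almost everywhere.  A class of functions on \<open>\<Omega>\<close> is represented by its extension by
  zero, i.e. by a class of functions on the whole space that vanish almost everywhere outside
  \<open>\<Omega>\<close> (see \<open>functions_on\<close>).  Thus the spaces for all exponents are sets of elements of one
  vector space and can be intersected and compared.
\<close>

definition ae_rel :: "('a::euclidean_space \<Rightarrow> 'b::euclidean_space) \<Rightarrow> ('a \<Rightarrow> 'b) \<Rightarrow> bool" where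
  "ae_rel f g \<longleftrightarrow> f \<in> borel_measurable lebesgue \<and> g \<in> borel_measurable lebesgue \<and>
     (AE x in lebesgue. f x = g x)"

quotient_type (overloaded) ('a, 'b) aefun =
  "'a::euclidean_space \<Rightarrow> 'b::euclidean_space" / partial: ae_rel
proof (rule part_equivpI)
  show "\<exists>f::'a \<Rightarrow> 'b. ae_rel f f"
    by (rule exI[of _ "\<lambda>_. 0"]) (simp add: ae_rel_def)
  show "symp (ae_rel :: ('a \<Rightarrow> 'b) \<Rightarrow> _)"
    by (auto simp: symp_def ae_rel_def elim: eventually_mono)
  show "transp (ae_rel :: ('a \<Rightarrow> 'b) \<Rightarrow> _)"
    unfolding transp_def ae_rel_def by (auto elim: eventually_elim2)
qed

instantiation aefun :: (euclidean_space, euclidean_space) real_vector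
begin

lift_definition zero_aefun :: "('a, 'b) aefun" is "\<lambda>_. 0"
  by (simp add: ae_rel_def)

lift_definition plus_aefun :: "('a, 'b) aefun \<Rightarrow> ('a, 'b) aefun \<Rightarrow> ('a, 'b) aefun"
  is "\<lambda>f g x. f x + g x"
  unfolding ae_rel_def by (auto elim: eventually_elim2)

lift_definition minus_aefun :: "('a, 'b) aefun \<Rightarrow> ('a, 'b) aefun \<Rightarrow> ('a, 'b) aefun"
  is "\<lambda>f g x. f x - g x"
  unfolding ae_rel_def by (auto elim: eventually_elim2)

lift_definition uminus_aefun :: "('a, 'b) aefun \<Rightarrow> ('a, 'b) aefun" is "\<lambda>f x. - f x"
  unfolding ae_rel_def by (auto elim: eventually_mono)

lift_definition scaleR_aefun :: "real \<Rightarrow> ('a, 'b) aefun \<Rightarrow> ('a, 'b) aefun"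
  is "\<lambda>c f x. c *\<^sub>R f x"
  unfolding ae_rel_def by (auto elim: eventually_mono)

instance
  by standard (transfer; auto simp: ae_rel_def algebra_simps)+

end

definition functions_on :: "'a::euclidean_space set \<Rightarrow> ('a, 'b::euclidean_space) aefun set" where
  "functions_on \<Omega> = {u. AE x in lebesgue. x \<notin> \<Omega> \<longrightarrow> rep_aefun u x = 0}"


section \<open>Lebesgue spaces\<close>

definition Lp :: "'a::euclidean_space set \<Rightarrow> real \<Rightarrow> ('a, 'b::euclidean_space) aefun set" where
  "Lp \<Omega> s = {u \<in> functions_on \<Omega>.
     integrable (lebesgue_on \<Omega>) (\<lambda>x. norm (rep_aefun u x) powr s)}"

definition Lp_norm :: "'a::euclidean_space set \<Rightarrow> real \<Rightarrow> ('a, 'b::euclidean_space) aefun \<Rightarrow> real" where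
  "Lp_norm \<Omega> s u = (\<integral>x. norm (rep_aefun u x) powr s \<partial>lebesgue_on \<Omega>) powr (1 / s)"

definition L1_loc :: "'a::euclidean_space set \<Rightarrow> ('a, 'b::euclidean_space) aefun set" where
  "L1_loc \<Omega> = {u \<in> functions_on \<Omega>.
     \<forall>K. compact K \<and> K \<subseteq> \<Omega> \<longrightarrow> integrable (lebesgue_on K) (rep_aefun u)}"


section \<open>Test functions and weak gradients\<close>

definition partial_deriv :: "'a::euclidean_space \<Rightarrow> ('a \<Rightarrow> real) \<Rightarrow> 'a \<Rightarrow> real" where
  "partial_deriv b f x = frechet_derivative f (at x) b"

primrec C_k :: "nat \<Rightarrow> ('a::euclidean_space \<Rightarrow> real) \<Rightarrow> bool" where
  "C_k 0 f \<longleftrightarrow> continuous_on UNIV f"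
| "C_k (Suc n) f \<longleftrightarrow> (\<forall>x. f differentiable (at x)) \<and> (\<forall>b\<in>Basis. C_k n (partial_deriv b f))"

definition test_functions :: "'a::euclidean_space set \<Rightarrow> ('a \<Rightarrow> real) set" where
  "test_functions \<Omega> =
     {\<phi>. (\<forall>n. C_k n \<phi>) \<and> compact (closure {x. \<phi> x \<noteq> 0}) \<and> closure {x. \<phi> x \<noteq> 0} \<subseteq> \<Omega>}"

definition is_weak_gradient ::
  "'a::euclidean_space set \<Rightarrow> ('a, real) aefun \<Rightarrow> ('a, 'a) aefun \<Rightarrow> bool" where
  "is_weak_gradient \<Omega> u g \<longleftrightarrow> u \<in> L1_loc \<Omega> \<and> g \<in> L1_loc \<Omega> \<and>
     (\<forall>\<phi>\<in>test_functions \<Omega>. \<forall>b\<in>Basis.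
        (\<integral>x. rep_aefun u x * partial_deriv b \<phi> x \<partial>lebesgue_on \<Omega>) =
        - (\<integral>x. (rep_aefun g x \<bullet> b) * \<phi> x \<partial>lebesgue_on \<Omega>))"

text \<open>For open \<open>\<Omega>\<close> the weak gradient, as an element of \<open>L1_loc \<Omega>\<close>, is unique if it exists.\<close>

definition weak_grad :: "'a::euclidean_space set \<Rightarrow> ('a, real) aefun \<Rightarrow> ('a, 'a) aefun" where
  "weak_grad \<Omega> u = (THE g. is_weak_gradient \<Omega> u g)"


section \<open>Sobolev spaces\<close>

definition W1 :: "'a::euclidean_space set \<Rightarrow> real \<Rightarrow> ('a, real) aefun set" where
  "W1 \<Omega> s = {u \<in> Lp \<Omega> s. \<exists>g \<in> Lp \<Omega> s. is_weak_gradient \<Omega> u g}"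

text \<open>\<open>W\<^sub>0\<^sup>1\<^sup>,\<^sup>s(\<Omega>)\<close> is the closure of the test functions in the norm of \<open>W\<^sup>1\<^sup>,\<^sup>s(\<Omega>)\<close>.\<close>

definition W01 :: "'a::euclidean_space set \<Rightarrow> real \<Rightarrow> ('a, real) aefun set" where
  "W01 \<Omega> s = {u \<in> W1 \<Omega> s. \<forall>e>0. \<exists>\<phi>\<in>test_functions \<Omega>.
     Lp_norm \<Omega> s (u - abs_aefun \<phi>) + Lp_norm \<Omega> s (weak_grad \<Omega> (u - abs_aefun \<phi>)) < e}"

definition W01_topology :: "'a::euclidean_space set \<Rightarrow> real \<Rightarrow> ('a, real) aefun topology" where
  "W01_topology \<Omega> s =
     Metric_space.mtopology (W01 \<Omega> s) (\<lambda>u v. Lp_norm \<Omega> s (weak_grad \<Omega> (u - v)))"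


section \<open>Krasnoselskii genus\<close>

text \<open>
  \<open>Euclidean_space k\<close> is the space of all \<open>y :: nat \<Rightarrow> real\<close> with \<open>y i = 0\<close> for \<open>i \<ge> k\<close>, so its
  origin is \<open>\<lambda>_. 0\<close>.  The infimum of the empty set in \<open>enat\<close> is \<open>\<infinity>\<close>.
\<close>

definition genus :: "'v::real_vector topology \<Rightarrow> 'v set \<Rightarrow> enat" where
  "genus X A = (if A = {} then 0 else
     Inf {enat k | k. \<exists>h.
       continuous_map (subtopology X A)
         (subtopology (Euclidean_space k) (topspace (Euclidean_space k) - {\<lambda>_. 0})) h \<and>
       (\<forall>u\<in>A. h (- u) = (\<lambda>i. - h u i))})"


section \<open>Variational eigenvalues\<close>

definition Sigma_k :: "'a::euclidean_space set \<Rightarrow> nat \<Rightarrow> real \<Rightarrow> ('a, real) aefun set set" where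
  "Sigma_k \<Omega> k s = {A. A \<subseteq> W01 \<Omega> s - {0} \<and> uminus ` A = A \<and>
     compactin (W01_topology \<Omega> s) A \<and> genus (W01_topology \<Omega> s) A \<ge> enat k}"

definition rayleigh :: "'a::euclidean_space set \<Rightarrow> real \<Rightarrow> ('a, real) aefun \<Rightarrow> real" where
  "rayleigh \<Omega> q u = Lp_norm \<Omega> q (weak_grad \<Omega> u) powr q / Lp_norm \<Omega> q u powr q"

text \<open>
  Suprema and infima are taken in \<open>ereal\<close>: in \<open>mixed_eigenvalue\<close> the sets \<open>A\<close> need not be compact
  in \<open>W\<^sub>0\<^sup>1\<^sup>,\<^sup>q(\<Omega>)\<close>, so the supremum may be \<open>\<infinity>\<close>.  In \<open>eigenvalue\<close> the supremum is the maximum of a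
  continuous function on a compact set.
\<close>

definition eigenvalue :: "'a::euclidean_space set \<Rightarrow> nat \<Rightarrow> real \<Rightarrow> ereal" where
  "eigenvalue \<Omega> k q = (INF A \<in> Sigma_k \<Omega> k q. SUP u\<in>A. ereal (rayleigh \<Omega> q u))"

definition mixed_eigenvalue :: "'a::euclidean_space set \<Rightarrow> nat \<Rightarrow> real \<Rightarrow> real \<Rightarrow> ereal" where
  "mixed_eigenvalue \<Omega> k q r =
     (INF A \<in> {A \<in> Sigma_k \<Omega> k r. A \<subseteq> W1 \<Omega> q}. SUP u\<in>A. ereal (rayleigh \<Omega> q u))"

end

theory Submission
  imports Defs
begin

text \<open>
  Write \<open>d\<^sub>s(u, v)\<close> for the norm of \<open>\<nabla>(u - v)\<close> in \<open>L\<^sup>s\<close>.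

  The inequality \<open>\<lambda>\<^sub>k(q; r) \<le> \<lambda>\<^sub>k(q)\<close> is soft.  Since \<open>\<Omega>\<close> is bounded, \<open>d\<^sub>r\<close> is at most a multiple of
  \<open>d\<^sub>q\<close>, so the hypothesis makes \<open>W\<^sub>0\<^sup>1\<^sup>,\<^sup>q\<close> a continuously included subspace of \<open>W\<^sub>0\<^sup>1\<^sup>,\<^sup>r\<close>.  A compact
  set stays compact under the inclusion, and its genus does not drop, because every odd map that is
  continuous for the coarser topology is continuous for the finer one.

  For the converse, let \<open>A\<close> be admissible for \<open>\<lambda>\<^sub>k(q; r)\<close> with \<open>\<parallel>\<nabla>u\<parallel>\<^sub>q \<le> \<mu> \<parallel>u\<parallel>\<^sub>q\<close> on \<open>A\<close>.  The hypothesis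
  puts \<open>A\<close> into \<open>W\<^sub>0\<^sup>1\<^sup>,\<^sup>q\<close>, but \<open>A\<close> is compact for \<open>d\<^sub>r\<close> only.  Ehrling's inequality
  \<open>\<parallel>u\<parallel>\<^sub>q \<le> \<epsilon> \<parallel>\<nabla>u\<parallel>\<^sub>q + C \<parallel>u\<parallel>\<^sub>r\<close> (lemma \<open>Ehrling\<close>) repairs this.  Applied to elements of \<open>A\<close> with
  \<open>\<epsilon> \<mu> \<le> 1/2\<close> it bounds \<open>A\<close> in \<open>W\<^sub>0\<^sup>1\<^sup>,\<^sup>q\<close>; applied to differences of elements of \<open>A\<close> it shows that
  closeness for \<open>d\<^sub>r\<close> implies closeness in \<open>L\<^sup>q\<close>.  Now take a finite symmetric net \<open>F\<close> of \<open>A\<close> for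
  \<open>d\<^sub>r\<close> and an odd partition of unity, and map \<open>u\<close> to the convex combination \<open>P u\<close> of the nearby
  points of \<open>F\<close>.  Then \<open>P\<close> is odd and continuous into a finite-dimensional subspace of \<open>W\<^sub>0\<^sup>1\<^sup>,\<^sup>q\<close>, so
  \<open>P A\<close> is compact for \<open>d\<^sub>q\<close> and its genus is at least that of \<open>A\<close>.  Moreover \<open>P u\<close> is close to \<open>u\<close>
  in \<open>L\<^sup>q\<close>, and by convexity of the norm \<open>\<parallel>\<nabla>P u\<parallel>\<^sub>q \<le> \<mu> max \<parallel>v\<parallel>\<^sub>q\<close> over the nearby \<open>v \<in> F\<close>, which is
  almost \<open>\<mu> \<parallel>u\<parallel>\<^sub>q\<close>.  Hence the Rayleigh quotient is at most \<open>\<mu>\<^sup>q ((1 + \<theta>) / (1 - \<theta>))\<^sup>q\<close> on \<open>P A\<close> with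
  \<open>\<theta>\<close> arbitrarily small.  This is lemma \<open>finite_dimensional_approximation\<close>.

  The analysis rests on one estimate for test functions,
  \<open>\<parallel>\<phi>(\<cdot> + y) - \<phi>\<parallel>\<^sub>s \<le> \<bar>y\<bar> \<parallel>\<nabla>\<phi>\<parallel>\<^sub>s\<close> (lemma \<open>pnorm_difference_le\<close>).  A translation \<open>y\<close> longer than the
  diameter of \<open>\<Omega>\<close> gives the Poincare inequality, which makes \<open>d\<^sub>s\<close> a metric; averaging over all
  \<open>\<bar>y\<bar> \<le> \<epsilon>\<close> gives Ehrling's inequality; both extend to \<open>W\<^sub>0\<^sup>1\<^sup>,\<^sup>s\<close> by density.  That the weak gradient is
  well defined and linear follows from the fundamental lemma of the calculus of variations, for
  which smooth bump functions are constructed.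
\<close>

section \<open>Smooth bump functions\<close>

text \<open>
  The functions \<open>p(1/t) exp(-1/t)\<close>, extended by \<open>0\<close> to \<open>t \<le> 0\<close>.  All of them are differentiable and the
  family is closed under derivatives, so each of its members is smooth; a polynomial factor is needed
  because differentiating \<open>exp(-1/t)\<close> produces powers of \<open>1/t\<close>.
\<close>

definition bump_family :: "(real \<Rightarrow> real) set" where
  "bump_family = {\<lambda>t. if t > 0 then poly p (1 / t) * exp (- (1 / t)) else 0 | p. True}"

lemma poly_times_exp_minus_tendsto_0:
  fixes p :: "real poly"
  shows "((\<lambda>s. poly p s * exp (- s)) \<longlongrightarrow> 0) at_top"
proof -
  have "((\<lambda>s. \<Sum>i\<le>degree p. coeff p i * (s ^ i / exp s)) \<longlongrightarrow> (\<Sum>i\<le>degree p. coeff p i * 0)) at_top"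
    by (intro tendsto_intros tendsto_power_div_exp_0)
  moreover have "(\<Sum>i\<le>degree p. coeff p i * (s ^ i / exp s)) = poly p s * exp (- s)" for s
    by (simp add: poly_altdef sum_distrib_right exp_minus divide_inverse mult.assoc)
  ultimately show ?thesis by simp
qed

lemma poly_inverse_times_exp_tendsto_0:
  fixes p :: "real poly"
  shows "((\<lambda>t. poly p (1 / t) * exp (- (1 / t))) \<longlongrightarrow> 0) (at_right 0)"
proof -
  have "filterlim (\<lambda>t::real. 1 / t) at_top (at_right 0)"
    using filterlim_inverse_at_top_right by (simp add: divide_inverse)
  from filterlim_compose[OF poly_times_exp_minus_tendsto_0 this] show ?thesis .
qed

text \<open>
  With \<open>s = 1/t\<close> the derivative of \<open>p(s) exp(-s)\<close> is \<open>s\<^sup>2 (p(s) - p'(s)) exp(-s)\<close>; at the origin the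
  difference quotient is \<open>s p(s) exp(-s)\<close>, which vanishes as \<open>s\<close> tends to infinity.
\<close>

lemma bump_family_deriv:
  assumes "g \<in> bump_family"
  shows "\<exists>g'\<in>bump_family. \<forall>t. (g has_real_derivative g' t) (at t)"
proof -
  obtain p where g: "g = (\<lambda>t. if t > 0 then poly p (1 / t) * exp (- (1 / t)) else 0)"
    using assms by (auto simp: bump_family_def)
  define q where "q = monom 1 2 * (p - pderiv p)"
  define g' where "g' = (\<lambda>t. if t > 0 then poly q (1 / t) * exp (- (1 / t)) else (0::real))"
  have "(g has_real_derivative g' t) (at t)" for t
  proof -
    consider "t > 0" | "t < 0" | "t = 0" by linarith
    then show ?thesis
    proof cases
      case 1
      have "((\<lambda>t. poly p (1 / t) * exp (- (1 / t))) has_real_derivative g' t) (at t)"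
        using 1 by (auto intro!: derivative_eq_intros poly_DERIV[THEN DERIV_chain2]
            simp: g'_def q_def poly_monom power2_eq_square field_simps)
      moreover have "\<forall>\<^sub>F x in nhds t. poly p (1 / x) * exp (- (1 / x)) = g x"
        using eventually_nhds_in_open[of "{0<..}" t] 1 by (auto elim!: eventually_mono simp: g)
      ultimately show ?thesis
        by (subst DERIV_cong_ev[OF refl _ refl]) (auto elim: eventually_mono)
    next
      case 2
      have "((\<lambda>t. 0) has_real_derivative g' t) (at t)"
        using 2 by (auto simp: g'_def)
      moreover have "\<forall>\<^sub>F x in nhds t. 0 = g x"
        using eventually_nhds_in_open[of "{..<0}" t] 2 by (auto elim!: eventually_mono simp: g)
      ultimately show ?thesis
        by (subst DERIV_cong_ev[OF refl _ refl]) (auto elim: eventually_mono)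
    next
      case 3
      have "((\<lambda>y. (g y - g 0) / (y - 0)) \<longlongrightarrow> 0) (at 0)"
      proof (subst filterlim_at_split, intro conjI)
        show "((\<lambda>y. (g y - g 0) / (y - 0)) \<longlongrightarrow> 0) (at_left 0)"
          by (rule tendsto_eventually)
            (auto simp: g eventually_at_filter)
        show "((\<lambda>y. (g y - g 0) / (y - 0)) \<longlongrightarrow> 0) (at_right 0)"
          using poly_inverse_times_exp_tendsto_0[of "[:0, 1:] * p"]
          by (rule tendsto_cong[THEN iffD1, rotated])
            (auto simp: g eventually_at_filter)
      qed
      then show ?thesis
        using 3 by (simp add: has_field_derivative_iff g'_def)
    qed
  qed
  moreover have "g' \<in> bump_family" by (auto simp: bump_family_def g'_def)
  ultimately show ?thesis by blast
qed

definition smooth_step :: "real \<Rightarrow> real" where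
  "smooth_step t = (if t > 0 then exp (- (1 / t)) else 0)"

lemma smooth_step_in_bump_family: "smooth_step \<in> bump_family"
  unfolding bump_family_def smooth_step_def[abs_def] by (auto intro!: exI[of _ "1"])

lemma C_k_const: "C_k n (\<lambda>_. c)"
  by (induction n arbitrary: c) (simp_all add: partial_deriv_def[abs_def])

text \<open>
  The constant factor \<open>c\<close> and the offset \<open>a\<close> make the induction work: a partial derivative of a
  function of this form has the form again, with another member of \<open>S\<close> and another constant.
\<close>

lemma C_k_ridge:
  assumes "\<And>g. g \<in> S \<Longrightarrow> \<exists>g'\<in>S. \<forall>t. (g has_real_derivative g' t) (at t)" and "g \<in> S"
  shows "C_k n (\<lambda>x. c * g (a + x \<bullet> v))"
  using assms(2)
proof (induction n arbitrary: g c)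
  case 0
  obtain g' where g': "\<And>t. (g has_real_derivative g' t) (at t)" using assms(1)[OF 0] by blast
  have "continuous_on UNIV g"
    by (rule continuous_at_imp_continuous_on) (rule ballI, rule DERIV_isCont[OF g'])
  then have "continuous_on UNIV (\<lambda>x. g (a + x \<bullet> v))"
    by (rule continuous_on_compose2[of UNIV g]) (auto intro!: continuous_intros)
  then show ?case by (simp add: continuous_on_mult_left)
next
  case (Suc n)
  obtain g' where g': "g' \<in> S" "\<And>t. (g has_real_derivative g' t) (at t)"
    using assms(1)[OF Suc.prems] by blast
  have D: "((\<lambda>x. c * g (a + x \<bullet> v)) has_derivative (\<lambda>h. c * (g' (a + x \<bullet> v) * (h \<bullet> v)))) (at x)" for x
  proof -
    have "((\<lambda>x. g (a + x \<bullet> v)) has_derivative (\<lambda>h. g' (a + x \<bullet> v) * (h \<bullet> v))) (at x)"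
      using g'(2)[of "a + x \<bullet> v", unfolded has_field_derivative_def]
      by (rule has_derivative_compose[rotated]) (auto intro!: derivative_eq_intros)
    then show ?thesis by (rule has_derivative_mult_right)
  qed
  have "partial_deriv b (\<lambda>x. c * g (a + x \<bullet> v)) = (\<lambda>x. (c * (b \<bullet> v)) * g' (a + x \<bullet> v))" for b
    by (rule ext) (simp add: partial_deriv_def frechet_derivative_at[OF D, symmetric])
  then show ?case using D Suc.IH[OF g'(1)] by (auto simp: differentiable_def)
qed

lemma C_k_Suc_D: "C_k (Suc n) f \<Longrightarrow> C_k n f"
proof (induction n arbitrary: f)
  case 0
  then show ?case
    by (auto intro!: continuous_at_imp_continuous_on differentiable_imp_continuous_within)
qed auto

lemma partial_deriv_add:
  assumes "f differentiable (at x)" "g differentiable (at x)"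
  shows "partial_deriv b (\<lambda>x. f x + g x) x = partial_deriv b f x + partial_deriv b g x"
proof -
  have "((\<lambda>x. f x + g x) has_derivative
      (\<lambda>h. frechet_derivative f (at x) h + frechet_derivative g (at x) h)) (at x)"
    using assms by (auto intro!: derivative_eq_intros simp: frechet_derivative_works[symmetric])
  from frechet_derivative_at[OF this] show ?thesis by (simp add: partial_deriv_def fun_eq_iff)
qed

lemma partial_deriv_mult:
  assumes "f differentiable (at x)" "g differentiable (at x)"
  shows "partial_deriv b (\<lambda>x. f x * g x) x = partial_deriv b f x * g x + f x * partial_deriv b g x"
proof -
  have "((\<lambda>x. f x * g x) has_derivative
      (\<lambda>h. f x * frechet_derivative g (at x) h + frechet_derivative f (at x) h * g x)) (at x)"
    using assms by (intro has_derivative_mult) (auto simp: frechet_derivative_works[symmetric])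
  from frechet_derivative_at[OF this] show ?thesis unfolding partial_deriv_def by (metis add.commute)
qed

lemma C_k_add: "C_k n f \<Longrightarrow> C_k n g \<Longrightarrow> C_k n (\<lambda>x. f x + g x)"
proof (induction n arbitrary: f g)
  case (Suc n)
  then have "partial_deriv b (\<lambda>x. f x + g x) = (\<lambda>x. partial_deriv b f x + partial_deriv b g x)" for b
    by (auto intro!: ext partial_deriv_add)
  then show ?case using Suc by auto
qed (auto intro: continuous_intros)

lemma C_k_mult: "C_k n f \<Longrightarrow> C_k n g \<Longrightarrow> C_k n (\<lambda>x. f x * g x)"
proof (induction n arbitrary: f g)
  case (Suc n)
  then have "partial_deriv b (\<lambda>x. f x * g x) =
      (\<lambda>x. partial_deriv b f x * g x + f x * partial_deriv b g x)" for b
    by (auto intro!: ext partial_deriv_mult)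
  then show ?case
    using Suc.IH Suc.prems C_k_Suc_D[OF Suc.prems(1)] C_k_Suc_D[OF Suc.prems(2)]
    by (auto intro!: C_k_add Suc.IH)
qed (auto intro: continuous_intros)

lemma C_k_prod: "finite I \<Longrightarrow> (\<And>i. i \<in> I \<Longrightarrow> C_k n (f i)) \<Longrightarrow> C_k n (\<lambda>x. \<Prod>i\<in>I. f i x)"
  by (induction I rule: finite_induct) (auto intro: C_k_const C_k_mult)

section \<open>Test functions\<close>

lemma test_function_supportE:
  assumes "\<phi> \<in> test_functions \<Omega>"
  obtains K where "compact K" "K \<subseteq> \<Omega>" "\<And>x. x \<notin> K \<Longrightarrow> \<phi> x = 0"
    "\<And>b x. x \<notin> K \<Longrightarrow> partial_deriv b \<phi> x = 0"
proof
  let ?K = "closure {x. \<phi> x \<noteq> 0}"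
  show "compact ?K" "?K \<subseteq> \<Omega>" using assms by (auto simp: test_functions_def)
  show z: "\<phi> x = 0" if "x \<notin> ?K" for x using that closure_subset[of "{x. \<phi> x \<noteq> 0}"] by auto
  show "partial_deriv b \<phi> x = 0" if "x \<notin> ?K" for x b
  proof -
    have "x \<in> - ?K" unfolding Compl_iff by (rule that)
    with open_Compl[OF closed_closure] have "(\<phi> has_derivative (\<lambda>_. 0)) (at x)"
      by (rule has_derivative_transform_within_open[OF has_derivative_const[of 0]]) (rule z[symmetric], erule ComplD)
    from frechet_derivative_at[OF this, symmetric] show ?thesis by (simp add: partial_deriv_def)
  qed
qed

lemma test_functionI:
  assumes "\<And>n. C_k n \<phi>" "compact K" "K \<subseteq> \<Omega>" "\<And>x. x \<notin> K \<Longrightarrow> \<phi> x = 0"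
  shows "\<phi> \<in> test_functions \<Omega>"
proof -
  have "closure {x. \<phi> x \<noteq> 0} \<subseteq> K"
    using assms by (intro closure_minimal) (auto intro: compact_imp_closed)
  moreover from this have "compact (closure {x. \<phi> x \<noteq> 0})"
    using compact_Int_closed[OF assms(2) closed_closure, of "{x. \<phi> x \<noteq> 0}"]
    by (simp add: inf.absorb2)
  ultimately show ?thesis using assms(1,3) by (auto simp: test_functions_def)
qed

lemma test_function_C_k: "\<phi> \<in> test_functions \<Omega> \<Longrightarrow> C_k n \<phi>"
  by (simp add: test_functions_def)

lemma test_function_differentiable: "\<phi> \<in> test_functions \<Omega> \<Longrightarrow> \<phi> differentiable (at x)"
  using test_function_C_k[of \<phi> \<Omega> "Suc 0"] by simp

lemma test_function_continuous: "\<phi> \<in> test_functions \<Omega> \<Longrightarrow> continuous_on UNIV \<phi>"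
  using test_function_C_k[of \<phi> \<Omega> 0] by simp

lemma test_function_partial_continuous:
  "\<phi> \<in> test_functions \<Omega> \<Longrightarrow> b \<in> Basis \<Longrightarrow> continuous_on UNIV (partial_deriv b \<phi>)"
  using test_function_C_k[of \<phi> \<Omega> "Suc 0"] by simp

lemma test_function_add:
  assumes "\<phi> \<in> test_functions \<Omega>" "\<psi> \<in> test_functions \<Omega>"
  shows "(\<lambda>x. \<phi> x + \<psi> x) \<in> test_functions \<Omega>"
proof -
  obtain K L where K: "compact K" "K \<subseteq> \<Omega>" "\<And>x. x \<notin> K \<Longrightarrow> \<phi> x = 0"
    and L: "compact L" "L \<subseteq> \<Omega>" "\<And>x. x \<notin> L \<Longrightarrow> \<psi> x = 0"
    by (meson test_function_supportE assms)
  show ?thesis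
    by (rule test_functionI[of _ "K \<union> L"]) (use K L assms in \<open>auto intro: C_k_add test_function_C_k\<close>)
qed

lemma test_function_mult:
  assumes "\<phi> \<in> test_functions \<Omega>" "\<And>n. C_k n \<psi>"
  shows "(\<lambda>x. \<phi> x * \<psi> x) \<in> test_functions \<Omega>"
proof -
  obtain K where K: "compact K" "K \<subseteq> \<Omega>" "\<And>x. x \<notin> K \<Longrightarrow> \<phi> x = 0"
    by (meson test_function_supportE assms)
  show ?thesis
    by (rule test_functionI[of _ K]) (use K assms in \<open>auto intro: C_k_mult test_function_C_k\<close>)
qed

lemma test_function_scale:
  assumes "\<phi> \<in> test_functions \<Omega>" shows "(\<lambda>x. c * \<phi> x) \<in> test_functions \<Omega>"
  using test_function_mult[OF assms C_k_const[of _ c]] by (simp add: mult.commute)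

lemma test_function_zero: "(\<lambda>x. 0) \<in> test_functions \<Omega>"
  by (rule test_functionI[of _ "{}"]) (auto intro: C_k_const)

text \<open>
  A product of one-dimensional steps that tends to the indicator function of the open box from below
  as \<open>m\<close> grows.
\<close>

definition box_bump :: "'a::euclidean_space \<Rightarrow> 'a \<Rightarrow> nat \<Rightarrow> 'a \<Rightarrow> real" where
  "box_bump a c m x =
     (\<Prod>b\<in>Basis. smooth_step (real m * (x \<bullet> b - a \<bullet> b)) * smooth_step (real m * (c \<bullet> b - x \<bullet> b)))"

lemma smooth_step_bounds: "0 \<le> smooth_step t" "smooth_step t \<le> 1"
  by (auto simp: smooth_step_def)

lemma smooth_step_nonpos: "t \<le> 0 \<Longrightarrow> smooth_step t = 0"
  by (simp add: smooth_step_def)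

lemma box_bump_bounds: "0 \<le> box_bump a c m x" "box_bump a c m x \<le> 1"
  unfolding box_bump_def
  by (auto intro!: prod_nonneg prod_le_1 mult_nonneg_nonneg mult_le_one smooth_step_bounds)

lemma box_bump_outside:
  assumes "x \<notin> box a c" shows "box_bump a c m x = 0"
proof -
  obtain b where b: "b \<in> Basis" "x \<bullet> b \<le> a \<bullet> b \<or> c \<bullet> b \<le> x \<bullet> b"
    using assms by (auto simp: mem_box not_less)
  then have "smooth_step (real m * (x \<bullet> b - a \<bullet> b)) * smooth_step (real m * (c \<bullet> b - x \<bullet> b)) = 0"
    by (auto simp: smooth_step_nonpos mult_nonneg_nonpos)
  then show ?thesis unfolding box_bump_def using b(1) by (auto intro!: prod_zero)
qed

lemma box_bump_test_function:
  assumes "cbox a c \<subseteq> \<Omega>" shows "box_bump a c m \<in> test_functions \<Omega>"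
proof (rule test_functionI[of _ "cbox a c"])
  have 1: "C_k n (\<lambda>x::'a. smooth_step (real m * (x \<bullet> b - a \<bullet> b)))" for n and b :: 'a
    using C_k_ridge[OF bump_family_deriv smooth_step_in_bump_family, of n 1 "- real m * (a \<bullet> b)" "real m *\<^sub>R b"]
    by (simp add: algebra_simps)
  have 2: "C_k n (\<lambda>x::'a. smooth_step (real m * (c \<bullet> b - x \<bullet> b)))" for n and b :: 'a
    using C_k_ridge[OF bump_family_deriv smooth_step_in_bump_family, of n 1 "real m * (c \<bullet> b)" "- real m *\<^sub>R b"]
    by (simp add: algebra_simps)
  show "C_k n (box_bump a c m)" for n
    unfolding box_bump_def[abs_def] by (intro C_k_prod C_k_mult 1 2 finite_Basis)
  show "box_bump a c m x = 0" if "x \<notin> cbox a c" for x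
    using that box_subset_cbox by (intro box_bump_outside) auto
qed (use assms in auto)

lemma smooth_step_tendsto_1:
  assumes "t > 0" shows "(\<lambda>m. smooth_step (real m * t)) \<longlonglongrightarrow> 1"
proof -
  have "(\<lambda>m. exp (- (1 / t * inverse (real m)))) \<longlonglongrightarrow> exp (- (1 / t * 0))"
    by (intro tendsto_intros lim_inverse_n)
  then have "(\<lambda>m. exp (- (1 / t * inverse (real m)))) \<longlonglongrightarrow> 1" by simp
  moreover have "\<forall>\<^sub>F m in sequentially. exp (- (1 / t * inverse (real m))) = smooth_step (real m * t)"
    using assms by (auto intro!: eventually_sequentiallyI[of 1] simp: smooth_step_def field_simps)
  ultimately show ?thesis by (rule Lim_transform_eventually)
qed

lemma box_bump_tendsto: "(\<lambda>m. box_bump a c m x) \<longlonglongrightarrow> indicator (box a c) x"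
proof (cases "x \<in> box a c")
  case True
  have "(\<lambda>m. \<Prod>b\<in>Basis. smooth_step (real m * (x \<bullet> b - a \<bullet> b)) * smooth_step (real m * (c \<bullet> b - x \<bullet> b)))
     \<longlonglongrightarrow> (\<Prod>b\<in>(Basis::'a set). 1 * 1)"
    using True by (intro tendsto_intros smooth_step_tendsto_1) (auto simp: mem_box)
  then show ?thesis using True by (simp add: box_bump_def)
next
  case False
  then show ?thesis by (simp add: box_bump_outside)
qed

section \<open>Gradients and difference quotients of test functions\<close>

definition grad :: "('a::euclidean_space \<Rightarrow> real) \<Rightarrow> 'a \<Rightarrow> 'a" where
  "grad \<phi> x = (\<Sum>b\<in>Basis. partial_deriv b \<phi> x *\<^sub>R b)"

lemma grad_inner_Basis: "b \<in> Basis \<Longrightarrow> grad \<phi> x \<bullet> b = partial_deriv b \<phi> x"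
  by (simp add: grad_def inner_sum_left inner_Basis if_distrib[of "(*) _"] cong: if_cong)

lemma has_derivative_grad:
  assumes "\<phi> differentiable (at x)"
  shows "(\<phi> has_derivative (\<lambda>h. grad \<phi> x \<bullet> h)) (at x)"
proof -
  have D: "(\<phi> has_derivative frechet_derivative \<phi> (at x)) (at x)"
    using assms by (simp add: frechet_derivative_works)
  interpret linear "frechet_derivative \<phi> (at x)" using has_derivative_linear[OF D] .
  have "frechet_derivative \<phi> (at x) h = grad \<phi> x \<bullet> h" for h
  proof -
    have "frechet_derivative \<phi> (at x) (\<Sum>b\<in>Basis. (h \<bullet> b) *\<^sub>R b) = grad \<phi> x \<bullet> h"
      by (simp add: sum scale grad_def partial_deriv_def inner_sum_right inner_commute mult.commute)
    then show ?thesis by (simp add: euclidean_representation)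
  qed
  then have "frechet_derivative \<phi> (at x) = (\<lambda>h. grad \<phi> x \<bullet> h)" by (rule ext)
  with D show ?thesis by simp
qed

lemma test_function_grad_continuous:
  assumes "\<phi> \<in> test_functions \<Omega>" shows "continuous_on UNIV (grad \<phi>)"
  unfolding grad_def[abs_def] using test_function_partial_continuous[OF assms]
  by (intro continuous_intros) auto

lemma continuous_zero_outside_compact_bounded:
  fixes f :: "'a::topological_space \<Rightarrow> 'b::real_normed_vector"
  assumes "continuous_on UNIV f" "compact K" "\<And>x. x \<notin> K \<Longrightarrow> f x = 0"
  obtains L where "L \<ge> 0" "\<And>x. norm (f x) \<le> L"
proof -
  have "compact (f ` K)"
    using assms by (intro compact_continuous_image) (auto intro: continuous_on_subset)
  then obtain L where L: "\<And>y. y \<in> f ` K \<Longrightarrow> norm y \<le> L"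
    by (meson bounded_iff compact_imp_bounded)
  show thesis
    by (rule that[of "max L 0"]) (use L assms(3) in \<open>fastforce simp: le_max_iff_disj\<close>)+
qed

lemma integral_lborel_translate:
  fixes f :: "'a::euclidean_space \<Rightarrow> 'b::{banach,second_countable_topology}"
  assumes [measurable]: "f \<in> borel_measurable borel"
  shows "(\<integral>x. f (x + h) \<partial>lborel) = (\<integral>x. f x \<partial>lborel)"
proof -
  have "(\<integral>x. f x \<partial>lborel) = (\<integral>x. f x \<partial>distr lborel borel ((+) h))"
    by (simp add: lborel_distr_plus)
  also have "\<dots> = (\<integral>x. f (h + x) \<partial>lborel)" by (rule integral_distr) auto
  finally show ?thesis by (simp add: add.commute)
qed

lemma integrable_lborel_translate:
  fixes f :: "'a::euclidean_space \<Rightarrow> 'b::{banach,second_countable_topology}"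
  assumes "integrable lborel f"
  shows "integrable lborel (\<lambda>x. f (x + h))"
proof -
  have [measurable]: "f \<in> borel_measurable borel" using borel_measurable_integrable[OF assms] by simp
  have "integrable (distr lborel borel ((+) h)) f" using assms by (simp add: lborel_distr_plus)
  then have "integrable lborel (\<lambda>x. f (h + x))" by (subst (asm) integrable_distr_eq) auto
  then show ?thesis by (simp add: add.commute)
qed

lemma integrable_continuous_compact_support:
  fixes f :: "'a::euclidean_space \<Rightarrow> 'b::{banach,second_countable_topology}"
  assumes "continuous_on UNIV f" "compact K" "\<And>x. x \<notin> K \<Longrightarrow> f x = 0"
  shows "integrable lborel f"
proof -
  obtain L where L: "\<And>x. norm (f x) \<le> L" by (metis continuous_zero_outside_compact_bounded assms)
  have [measurable]: "K \<in> sets borel" using assms(2) by (simp add: borel_compact)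
  show ?thesis
  proof (rule Bochner_Integration.integrable_bound)
    show "integrable lborel (\<lambda>x. L * indicator K x :: real)"
      using emeasure_compact_finite[OF assms(2)] by (intro integrable_mult_right integrable_real_indicator) auto
    show "f \<in> borel_measurable lborel"
      using borel_measurable_continuous_onI[OF assms(1)] by simp
    show "AE x in lborel. norm (f x) \<le> norm (L * indicator K x :: real)"
      using L assms(3) by (auto simp: indicator_def intro: order_trans[OF _ abs_ge_self])
  qed
qed

lemma test_function_Lipschitz:
  assumes "\<phi> \<in> test_functions \<Omega>"
  obtains L where "L \<ge> 0" "\<And>x h. \<bar>\<phi> (x + h) - \<phi> x\<bar> \<le> L * norm h" "\<And>x. norm (grad \<phi> x) \<le> L"
proof -
  obtain K where K: "compact K" "K \<subseteq> \<Omega>" "\<And>b x. x \<notin> K \<Longrightarrow> partial_deriv b \<phi> x = 0"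
    by (meson test_function_supportE assms)
  then have "\<And>x. x \<notin> K \<Longrightarrow> grad \<phi> x = 0" by (simp add: grad_def)
  then obtain L where L: "L \<ge> 0" "\<And>x. norm (grad \<phi> x) \<le> L"
    by (metis continuous_zero_outside_compact_bounded test_function_grad_continuous assms K(1))
  have "\<bar>\<phi> (x + h) - \<phi> x\<bar> \<le> L * norm h" for x h
  proof -
    have "norm (\<phi> (x + h) - \<phi> x) \<le> L * norm (x + h - x)"
    proof (rule differentiable_bound[of UNIV _ "\<lambda>x h. grad \<phi> x \<bullet> h"])
      show "(\<phi> has_derivative (\<lambda>h. grad \<phi> x \<bullet> h)) (at x within UNIV)" for x
        using has_derivative_grad test_function_differentiable assms by blast
      show "onorm (\<lambda>h. grad \<phi> x \<bullet> h) \<le> L" for x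
        using L by (intro onorm_bound)
          (auto intro!: order_trans[OF Cauchy_Schwarz_ineq2 mult_right_mono])
    qed auto
    then show ?thesis by simp
  qed
  with L show thesis using that by blast
qed

lemma directional_difference_quotient:
  assumes "(f has_derivative (\<lambda>h. g \<bullet> h)) (at x)"
  shows "(\<lambda>n. real (Suc n) * (f (x + y /\<^sub>R real (Suc n)) - f x)) \<longlonglongrightarrow> g \<bullet> y"
proof -
  have "((\<lambda>t. f (x + t *\<^sub>R y)) has_derivative (\<lambda>t. g \<bullet> (t *\<^sub>R y))) (at 0)"
    by (rule has_derivative_compose[where g=f]) (use assms in \<open>auto intro!: derivative_eq_intros\<close>)
  then have "((\<lambda>t. f (x + t *\<^sub>R y)) has_real_derivative (g \<bullet> y)) (at 0)"
    unfolding has_field_derivative_def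
    by (rule has_derivative_eq_rhs) (auto simp: mult.commute)
  then have *: "((\<lambda>t. (f (x + t *\<^sub>R y) - f x) / t) \<longlongrightarrow> g \<bullet> y) (at 0)"
    by (simp add: has_field_derivative_iff)
  have "filterlim (\<lambda>n. inverse (real (Suc n))) (at 0) sequentially"
    by (rule filterlim_atI) (use LIMSEQ_inverse_real_of_nat in auto)
  from filterlim_compose[OF * this] show ?thesis
    by (simp add: divide_inverse mult.commute)
qed

text \<open>
  Dominated convergence: the difference quotients are bounded by the Lipschitz constant times \<open>\<bar>y\<bar>\<close>
  and vanish outside a fixed ball.  The case \<open>\<Psi> t = t\<close> yields integration by parts, the case
  \<open>\<Psi> t = \<bar>t\<bar>\<^sup>s\<close> yields the translation estimate.
\<close>

lemma difference_quotient_integral_tendsto: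
  assumes \<phi>: "\<phi> \<in> test_functions \<Omega>" and \<Psi>: "continuous_on UNIV \<Psi>" and "\<Psi> 0 = (0::real)"
  shows "(\<lambda>n. \<integral>x. \<Psi> (real (Suc n) * (\<phi> (x + y /\<^sub>R real (Suc n)) - \<phi> x)) \<partial>lborel)
    \<longlonglongrightarrow> (\<integral>x. \<Psi> (grad \<phi> x \<bullet> y) \<partial>lborel)"
proof -
  obtain K where K: "compact K" "\<And>x. x \<notin> K \<Longrightarrow> \<phi> x = 0"
    by (meson test_function_supportE \<phi>)
  obtain R where R: "\<And>x. x \<in> K \<Longrightarrow> norm x \<le> R" using compact_imp_bounded[OF K(1)] unfolding bounded_iff by blast
  obtain L where L: "L \<ge> 0" "\<And>x h. \<bar>\<phi> (x + h) - \<phi> x\<bar> \<le> L * norm h"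
    using test_function_Lipschitz[OF \<phi>] by metis
  have "compact (\<Psi> ` cball 0 (L * norm y))"
    by (intro compact_continuous_image) (auto intro: continuous_on_subset[OF \<Psi>])
  from compact_imp_bounded[OF this]
  obtain B where B': "\<forall>u\<in>\<Psi> ` cball 0 (L * norm y). norm u \<le> B"
    unfolding bounded_iff by blast
  have B: "\<bar>\<Psi> t\<bar> \<le> B" if "\<bar>t\<bar> \<le> L * norm y" for t
    using bspec[OF B' imageI[of t]] that by simp
  have B0: "0 \<le> B" using B[of 0] L(1) by (simp add: assms(3))
  define S where "S = cball (0::'a) (R + norm y)"
  have q: "\<bar>real (Suc n) * (\<phi> (x + y /\<^sub>R real (Suc n)) - \<phi> x)\<bar> \<le> L * norm y" for n x
  proof -
    have "\<bar>real (Suc n) * (\<phi> (x + y /\<^sub>R real (Suc n)) - \<phi> x)\<bar>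
      \<le> real (Suc n) * (L * norm (y /\<^sub>R real (Suc n)))"
      unfolding abs_mult by (intro mult_mono L) auto
    also have "\<dots> = L * norm y" by (simp add: field_simps)
    finally show ?thesis .
  qed
  have z: "\<phi> (x + y /\<^sub>R real (Suc n)) - \<phi> x = 0" if "x \<notin> S" for n x
  proof -
    have y: "norm (y /\<^sub>R real (Suc n)) \<le> norm y" by (simp add: field_simps mult_left_le)
    have "R + norm y < norm x" using that by (simp add: S_def)
    moreover have "norm x \<le> norm (x + y /\<^sub>R real (Suc n)) + norm (y /\<^sub>R real (Suc n))"
      using norm_triangle_ineq4[of "x + y /\<^sub>R real (Suc n)" "y /\<^sub>R real (Suc n)"] by simp
    ultimately have "x + y /\<^sub>R real (Suc n) \<notin> K" "x \<notin> K"
      using R[of x] R[of "x + y /\<^sub>R real (Suc n)"] y norm_ge_zero[of y] by linarith+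
    then show ?thesis by (simp add: K(2))
  qed
  have [measurable]: "\<phi> \<in> borel_measurable borel" "\<Psi> \<in> borel_measurable borel" "grad \<phi> \<in> borel_measurable borel"
    using test_function_continuous[OF \<phi>] \<Psi> test_function_grad_continuous[OF \<phi>]
    by (auto intro: borel_measurable_continuous_onI)
  show ?thesis
  proof (rule integral_dominated_convergence)
    show "integrable lborel (\<lambda>x. B * indicator S x)"
      unfolding S_def
      by (intro integrable_mult_right integrable_real_indicator) (use emeasure_compact_finite[OF compact_cball[of 0 "R + norm y"]] in \<open>auto simp: top.not_eq_extremum\<close>)
    show "AE x in lborel. (\<lambda>n. \<Psi> (real (Suc n) * (\<phi> (x + y /\<^sub>R real (Suc n)) - \<phi> x)))
        \<longlonglongrightarrow> \<Psi> (grad \<phi> x \<bullet> y)"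
    proof (rule AE_I2)
      fix x
      have "isCont \<Psi> (grad \<phi> x \<bullet> y)" using \<Psi> by (simp add: continuous_on_eq_continuous_at)
      then show "(\<lambda>n. \<Psi> (real (Suc n) * (\<phi> (x + y /\<^sub>R real (Suc n)) - \<phi> x)))
        \<longlonglongrightarrow> \<Psi> (grad \<phi> x \<bullet> y)"
        by (rule isCont_tendsto_compose)
          (intro directional_difference_quotient has_derivative_grad test_function_differentiable[OF \<phi>])
    qed
    show "AE x in lborel. norm (\<Psi> (real (Suc n) * (\<phi> (x + y /\<^sub>R real (Suc n)) - \<phi> x)))
        \<le> B * indicator S x" for n
    proof (rule AE_I2)
      fix x
      show "norm (\<Psi> (real (Suc n) * (\<phi> (x + y /\<^sub>R real (Suc n)) - \<phi> x))) \<le> B * indicator S x"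
      proof (cases "x \<in> S")
        case True
        then show ?thesis using B[OF q[of n x]] by simp
      next
        case False
        then show ?thesis using z[OF False, of n] by (simp add: assms(3))
      qed
    qed
  qed auto
qed

text \<open>
  By translation invariance the integral of every difference quotient vanishes, hence so does its limit.
\<close>

lemma integral_grad_eq_0:
  assumes \<phi>: "\<phi> \<in> test_functions \<Omega>"
  shows "(\<integral>x. grad \<phi> x \<bullet> y \<partial>lborel) = 0"
proof -
  obtain K where K: "compact K" "\<And>x. x \<notin> K \<Longrightarrow> \<phi> x = 0"
    by (meson test_function_supportE \<phi>)
  have i: "integrable lborel \<phi>"
    by (rule integrable_continuous_compact_support[OF test_function_continuous[OF \<phi>] K])
  have [measurable]: "\<phi> \<in> borel_measurable borel"
    using test_function_continuous[OF \<phi>] by (rule borel_measurable_continuous_onI)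
  have "(\<integral>x. real (Suc n) * (\<phi> (x + y /\<^sub>R real (Suc n)) - \<phi> x) \<partial>lborel) = 0" for n
    using i integrable_lborel_translate[OF i] integral_lborel_translate[of \<phi>]
    by (simp add: Bochner_Integration.integral_diff)
  then have "(\<lambda>n::nat. 0) \<longlonglongrightarrow> (\<integral>x. grad \<phi> x \<bullet> y \<partial>lborel)"
    using difference_quotient_integral_tendsto[OF \<phi> continuous_on_id, of y] by simp
  then show ?thesis by (simp add: tendsto_const_iff)
qed

lemma integration_by_parts_test_functions:
  assumes \<phi>: "\<phi> \<in> test_functions \<Omega>" and \<psi>: "\<psi> \<in> test_functions \<Omega>" and b: "b \<in> Basis"
  shows "(\<integral>x. \<phi> x * partial_deriv b \<psi> x \<partial>lborel) = - (\<integral>x. partial_deriv b \<phi> x * \<psi> x \<partial>lborel)"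
proof -
  obtain K where K: "compact K" "\<And>x. x \<notin> K \<Longrightarrow> \<phi> x = 0" "\<And>x. x \<notin> K \<Longrightarrow> partial_deriv b \<phi> x = 0"
    by (meson test_function_supportE \<phi>)
  have c: "continuous_on UNIV \<phi>" "continuous_on UNIV \<psi>"
     "continuous_on UNIV (partial_deriv b \<phi>)" "continuous_on UNIV (partial_deriv b \<psi>)"
    using \<phi> \<psi> b by (auto intro: test_function_continuous test_function_partial_continuous)
  have "integrable lborel (\<lambda>x. \<phi> x * partial_deriv b \<psi> x)" "integrable lborel (\<lambda>x. partial_deriv b \<phi> x * \<psi> x)"
    using c K by (auto intro!: integrable_continuous_compact_support[OF _ K(1)] continuous_intros)
  moreover have "(\<integral>x. partial_deriv b \<phi> x * \<psi> x + \<phi> x * partial_deriv b \<psi> x \<partial>lborel) = 0"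
    using integral_grad_eq_0[OF test_function_mult[OF \<phi> test_function_C_k[OF \<psi>]], of b]
    by (simp add: grad_inner_Basis[OF b] partial_deriv_mult test_function_differentiable[OF \<phi>]
          test_function_differentiable[OF \<psi>])
  ultimately show ?thesis by simp
qed

section \<open>The fundamental lemma of the calculus of variations\<close>

text \<open>
  Boxes form an intersection-stable generator of the Borel sets, so the integral over every Borel set
  vanishes; a Lebesgue measurable set differs from a Borel set by a null set.
\<close>

lemma AE_zero_if_box_integrals_zero:
  fixes v :: "'a::euclidean_space \<Rightarrow> real"
  assumes v: "integrable lebesgue v" and tot: "(\<integral>x. v x \<partial>lebesgue) = 0"
    and box: "\<And>a b. (LINT x:box a b|lebesgue. v x) = 0"
  shows "AE x in lebesgue. v x = 0"
proof (rule density_unique_real[OF v, of "\<lambda>_. 0", simplified])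
  have si: "set_integrable lebesgue A v" if "A \<in> sets lebesgue" for A
    using integrable_mult_indicator[OF that v] by (simp add: set_integrable_def)
  have borel: "(LINT x:A|lebesgue. v x) = 0" if "A \<in> sets borel" for A
  proof -
    have "Int_stable (range (\<lambda>(a, b). box a b :: 'a set))"
      by (auto simp: Int_stable_def box_Int_box)
    moreover have "range (\<lambda>(a, b). box a b :: 'a set) \<subseteq> Pow UNIV" by simp
    moreover have "A \<in> sigma_sets UNIV (range (\<lambda>(a, b). box a b :: 'a set))"
      using that by (simp add: borel_eq_box)
    ultimately show ?thesis
    proof (induction rule: sigma_sets_induct_disjoint)
      case (basic A)
      then show ?case using box by auto
    next
      case empty
      show ?case by (simp add: set_lebesgue_integral_def)
    next
      case (compl A)
      then have "A \<in> sets borel" by (simp add: borel_eq_box)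
      then have A: "A \<in> sets lebesgue" "UNIV - A \<in> sets lebesgue" by auto
      have "(LINT x:A \<union> (UNIV - A)|lebesgue. v x) = (LINT x:A|lebesgue. v x) + (LINT x:UNIV - A|lebesgue. v x)"
        by (rule set_integral_Un) (use si[OF A(1)] si[OF A(2)] in auto)
      then show ?case using compl.IH tot by (simp add: set_lebesgue_integral_def)
    next
      case (union A)
      then have "range A \<subseteq> sets borel" by (simp add: borel_eq_box)
      then have A: "\<And>i. A i \<in> sets lebesgue" by auto
      have "(LINT x:(\<Union>i. A i)|lebesgue. v x) = (\<Sum>i. (LINT x:A i|lebesgue. v x))"
        by (rule lebesgue_integral_countable_add)
          (use A si union.hyps in \<open>auto simp: disjoint_family_on_def\<close>)
      then show ?case using union.IH by simp
    qed
  qed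
  fix A assume A: "A \<in> sets (lebesgue :: 'a measure)"
  obtain S N N' where S: "A = S \<union> N" "N \<subseteq> N'" "N' \<in> null_sets lborel" "S \<in> sets lborel"
    using A by (rule sets_completionE)
  have aeN: "AE x in lebesgue. x \<notin> N'"
    by (intro AE_not_in) (use S(3) null_sets_completionI in blast)
  have "(LINT x:A|lebesgue. v x) = (LINT x:S|lebesgue. v x)"
    unfolding set_lebesgue_integral_def
  proof (rule integral_cong_AE)
    show "(\<lambda>x. indicat_real A x *\<^sub>R v x) \<in> borel_measurable lebesgue"
      using integrable_mult_indicator[OF A v] by simp
    show "(\<lambda>x. indicat_real S x *\<^sub>R v x) \<in> borel_measurable lebesgue"
      using integrable_mult_indicator[OF _ v, of S] S(4) by auto
    show "AE x in lebesgue. indicat_real A x *\<^sub>R v x = indicat_real S x *\<^sub>R v x"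
      using aeN by (rule eventually_mono) (use S(1,2) in \<open>auto simp: indicator_def\<close>)
  qed
  then show "(LINT x:A|lebesgue. v x) = 0" using borel S(4) by simp
qed

text \<open>
  Testing with bumps that tend to the indicator of a box shows that the integral of \<open>w\<close> over every
  box whose closure lies in \<open>\<Omega>\<close> vanishes.  Countably many such boxes cover \<open>\<Omega>\<close>.
\<close>

lemma fundamental_lemma:
  fixes w :: "'a::euclidean_space \<Rightarrow> real"
  assumes "open \<Omega>" and w[measurable]: "w \<in> borel_measurable lebesgue"
    and loc: "\<And>K. compact K \<Longrightarrow> K \<subseteq> \<Omega> \<Longrightarrow> integrable (lebesgue_on K) w"
    and test: "\<And>\<phi>. \<phi> \<in> test_functions \<Omega> \<Longrightarrow> (\<integral>x. w x * \<phi> x \<partial>lebesgue_on \<Omega>) = 0"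
  shows "AE x in lebesgue. x \<in> \<Omega> \<longrightarrow> w x = 0"
proof -
  have loc': "integrable lebesgue (\<lambda>x. indicator (cbox a c) x * w x)" if "cbox a c \<subseteq> \<Omega>" for a c
    using loc[OF compact_cbox that] by (simp add: integrable_restrict_space)
  have box0: "(\<integral>x. indicator (box a c) x * w x \<partial>lebesgue) = 0" if sub: "cbox a c \<subseteq> \<Omega>" for a c
  proof -
    have "(\<lambda>m. \<integral>x. w x * box_bump a c m x \<partial>lebesgue) \<longlonglongrightarrow> (\<integral>x. indicator (box a c) x * w x \<partial>lebesgue)"
    proof (rule integral_dominated_convergence)
      show "integrable lebesgue (\<lambda>x. norm (indicator (cbox a c) x * w x))"
        using loc'[OF sub] by (rule integrable_norm)
      show "AE x in lebesgue. (\<lambda>m. w x * box_bump a c m x) \<longlonglongrightarrow> indicator (box a c) x * w x"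
        by (auto intro!: AE_I2 tendsto_eq_intros box_bump_tendsto)
      have [measurable]: "box_bump a c m \<in> borel_measurable lebesgue" for m
        using test_function_continuous[OF box_bump_test_function[OF sub]]
        by (intro measurable_completion) (simp add: borel_measurable_continuous_onI)
      show "(\<lambda>x. w x * box_bump a c m x) \<in> borel_measurable lebesgue" for m by measurable
      show "AE x in lebesgue. norm (w x * box_bump a c m x) \<le> norm (indicator (cbox a c) x * w x)" for m
      proof (rule AE_I2)
        fix x
        show "norm (w x * box_bump a c m x) \<le> norm (indicator (cbox a c) x * w x)"
          using box_bump_bounds[of a c m x] box_bump_outside[of x a c m] box_subset_cbox[of a c]
          by (cases "x \<in> box a c") (auto simp: abs_mult mult_left_le)
      qed
      show "(\<lambda>x. indicat_real (box a c) x * w x) \<in> borel_measurable lebesgue" by (intro borel_measurable_times w borel_measurable_indicator) simp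
    qed
    moreover have "(\<integral>x. w x * box_bump a c m x \<partial>lebesgue) = 0" for m
    proof -
      have "(\<integral>x. w x * box_bump a c m x \<partial>lebesgue) = (\<integral>x. w x * box_bump a c m x \<partial>lebesgue_on \<Omega>)"
        using assms(1) box_subset_cbox[of a c] sub
        by (subst integral_restrict_space)
          (auto intro!: Bochner_Integration.integral_cong box_bump_outside simp: indicator_def subset_eq)
      then show ?thesis using test[OF box_bump_test_function[OF sub]] by simp
    qed
    ultimately show ?thesis by (simp add: tendsto_const_iff)
  qed
  have AEbox: "AE x in lebesgue. x \<in> box a c \<longrightarrow> w x = 0" if sub: "cbox a c \<subseteq> \<Omega>" for a c
  proof -
    let ?v = "\<lambda>x. indicator (box a c) x * w x"
    have "AE x in lebesgue. ?v x = 0"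
    proof (rule AE_zero_if_box_integrals_zero)
      have "integrable lebesgue (\<lambda>x. indicator (box a c) x *\<^sub>R (indicator (cbox a c) x * w x))"
        by (rule integrable_mult_indicator[OF _ loc'[OF sub]]) simp
      moreover have "(\<lambda>x. indicator (box a c) x *\<^sub>R (indicator (cbox a c) x * w x)) = ?v"
        using box_subset_cbox[of a c] by (intro ext) (auto simp: indicator_def)
      ultimately show "integrable lebesgue ?v" by (simp only:)
      show "(\<integral>x. ?v x \<partial>lebesgue) = 0" by (rule box0[OF sub])
      show "(LINT x:box a' c'|lebesgue. ?v x) = 0" for a' c'
      proof -
        obtain a'' c'' where eq: "box a c \<inter> box a' c' = box a'' c''" "cbox a'' c'' \<subseteq> cbox a c"
        proof
          show "box a c \<inter> box a' c' = box (\<Sum>b\<in>Basis. max (a \<bullet> b) (a' \<bullet> b) *\<^sub>R b) (\<Sum>b\<in>Basis. min (c \<bullet> b) (c' \<bullet> b) *\<^sub>R b)"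
            by (auto simp: box_Int_box)
          show "cbox (\<Sum>b\<in>Basis. max (a \<bullet> b) (a' \<bullet> b) *\<^sub>R b) (\<Sum>b\<in>Basis. min (c \<bullet> b) (c' \<bullet> b) *\<^sub>R b) \<subseteq> cbox a c"
            by (auto simp: mem_box)
        qed
        have "(LINT x:box a' c'|lebesgue. ?v x) = (\<integral>x. indicator (box a'' c'') x * w x \<partial>lebesgue)"
          unfolding set_lebesgue_integral_def eq(1)[symmetric]
          by (rule Bochner_Integration.integral_cong) (auto simp: indicator_def)
        then show ?thesis using box0[of a'' c''] eq(2) sub by auto
      qed
    qed
    then show ?thesis by (rule eventually_mono) auto
  qed
  define \<F> where "\<F> = {box a c |a c::'a. cbox a c \<subseteq> \<Omega>}"
  obtain \<F>' where F': "\<F>' \<subseteq> \<F>" "countable \<F>'" "\<Union>\<F>' = \<Union>\<F>"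
    by (rule Lindelof[of \<F>]) (auto simp: \<F>_def)
  have "\<Omega> \<subseteq> \<Union>\<F>"
  proof
    fix x assume "x \<in> \<Omega>"
    then obtain a c where "x \<in> box a c" "cbox a c \<subseteq> \<Omega>"
      using open_contains_cbox[of \<Omega>] \<open>open \<Omega>\<close> by blast
    then show "x \<in> \<Union>\<F>" by (auto simp: \<F>_def)
  qed
  moreover have "AE x in lebesgue. \<forall>X\<in>\<F>'. x \<in> X \<longrightarrow> w x = 0"
    unfolding AE_ball_countable[OF F'(2)] using AEbox F'(1) by (auto simp: \<F>_def)
  ultimately show ?thesis using F'(3) by (elim eventually_mono) blast
qed

section \<open>Lebesgue norms of functions\<close>

lemma powr_convex_combination:
  fixes a b t s :: real
  assumes "s \<ge> 1" "a \<ge> 0" "b \<ge> 0" "0 \<le> t" "t \<le> 1"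
  shows "(t * a + (1 - t) * b) powr s \<le> t * a powr s + (1 - t) * b powr s"
proof -
  have le: "(t * a) powr s \<le> t * a powr s" if "0 \<le> t" "t \<le> 1" "a \<ge> 0" for t a :: real
    using that assms(1) powr_mono'[of 1 s t]
    by (auto simp: powr_mult intro!: mult_right_mono)
  consider "a = 0" | "b = 0" | "a > 0" "b > 0" using assms by linarith
  then show ?thesis
  proof cases
    case 1 then show ?thesis using le[of "1 - t" b] assms by simp
  next
    case 2 then show ?thesis using le[of t a] assms by simp
  next
    case 3
    then show ?thesis
      using convex_onD[OF powr_convex[OF assms(1)], of "1 - t" a b] assms by simp
  qed
qed

definition pnorm :: "'a measure \<Rightarrow> real \<Rightarrow> ('a \<Rightarrow> 'b::real_normed_vector) \<Rightarrow> real" where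
  "pnorm M s f = (\<integral>x. norm (f x) powr s \<partial>M) powr (1 / s)"

lemma pnorm_nonneg: "0 \<le> pnorm M s f" by (simp add: pnorm_def)

lemma pnorm_powr: "s > 0 \<Longrightarrow> pnorm M s f powr s = (\<integral>x. norm (f x) powr s \<partial>M)"
  by (simp add: pnorm_def powr_powr)

lemma pnorm_le_iff:
  assumes "s > 0" "0 \<le> c"
  shows "pnorm M s f \<le> c \<longleftrightarrow> (\<integral>x. norm (f x) powr s \<partial>M) \<le> c powr s"
  using powr_mono2[of s "pnorm M s f" c] powr_less_mono2[of s c "pnorm M s f"]
    pnorm_powr[of s M f] pnorm_nonneg[of M s f] assms by fastforce

lemma integrable_powr_add:
  fixes f g :: "'a \<Rightarrow> 'b::{real_normed_vector, second_countable_topology}"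
  assumes "s \<ge> 1" and [measurable]: "f \<in> borel_measurable M" "g \<in> borel_measurable M"
    and "integrable M (\<lambda>x. norm (f x) powr s)" "integrable M (\<lambda>x. norm (g x) powr s)"
  shows "integrable M (\<lambda>x. norm (f x + g x) powr s)"
proof (rule Bochner_Integration.integrable_bound)
  show "integrable M (\<lambda>x. 2 powr s * (norm (f x) powr s + norm (g x) powr s))"
    using assms by (intro integrable_mult_right Bochner_Integration.integrable_add)
  have "norm (f x + g x) powr s \<le> 2 powr s * (norm (f x) powr s + norm (g x) powr s)" for x
  proof -
    have "norm (f x + g x) powr s \<le> (2 * (1/2 * norm (f x) + (1 - 1/2) * norm (g x))) powr s"
      using assms(1) by (intro powr_mono2) (auto intro: norm_triangle_ineq)
    also have "\<dots> = 2 powr s * (1/2 * norm (f x) + (1 - 1/2) * norm (g x)) powr s"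
      by (intro powr_mult)
    also have "\<dots> \<le> 2 powr s * (1/2 * norm (f x) powr s + (1 - 1/2) * norm (g x) powr s)"
      by (intro mult_left_mono powr_convex_combination assms) auto
    also have "\<dots> \<le> 2 powr s * (norm (f x) powr s + norm (g x) powr s)"
      by (intro mult_left_mono add_mono) auto
    finally show ?thesis .
  qed
  then show "AE x in M. norm (norm (f x + g x) powr s) \<le> norm (2 powr s * (norm (f x) powr s + norm (g x) powr s))"
    by (auto intro!: AE_I2 intro: order_trans[OF _ abs_ge_self])
qed measurable

text \<open>
  For \<open>a > \<parallel>f\<parallel>\<close> and \<open>b > \<parallel>g\<parallel>\<close> write \<open>(f + g) / (a + b)\<close> as the convex combination of \<open>f / a\<close> and \<open>g / b\<close>
  with weights \<open>a / (a + b)\<close> and \<open>b / (a + b)\<close>, and integrate the convexity inequality of the power.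
  Choosing \<open>a\<close> and \<open>b\<close> slightly larger than the norms avoids a division by zero.
\<close>

lemma Minkowski:
  fixes f g :: "'a \<Rightarrow> 'b::{real_normed_vector, second_countable_topology}"
  assumes "s \<ge> 1" and [measurable]: "f \<in> borel_measurable M" "g \<in> borel_measurable M"
    and f: "integrable M (\<lambda>x. norm (f x) powr s)" and g: "integrable M (\<lambda>x. norm (g x) powr s)"
  shows "pnorm M s (\<lambda>x. f x + g x) \<le> pnorm M s f + pnorm M s g"
proof (rule field_le_epsilon)
  fix e :: real assume "e > 0"
  define a b where "a = pnorm M s f + e / 2" and "b = pnorm M s g + e / 2"
  have ab: "a > 0" "b > 0" using \<open>e > 0\<close> by (auto simp: a_def b_def pnorm_def intro!: add_nonneg_pos)
  have ia: "(\<integral>x. norm (f x) powr s \<partial>M) \<le> a powr s" "(\<integral>x. norm (g x) powr s \<partial>M) \<le> b powr s"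
    using assms(1) ab \<open>e > 0\<close> pnorm_le_iff[of s a M f] pnorm_le_iff[of s b M g] by (auto simp: a_def b_def)
  define t where "t = a / (a + b)"
  have t: "0 \<le> t" "t \<le> 1" "1 - t = b / (a + b)" using ab by (auto simp: t_def field_simps)
  have "norm (f x + g x) powr s \<le> (a + b) powr s * (t * (norm (f x) powr s / a powr s) + (1 - t) * (norm (g x) powr s / b powr s))" for x
  proof -
    have "norm (f x + g x) powr s \<le> ((a + b) * (t * (norm (f x) / a) + (1 - t) * (norm (g x) / b))) powr s"
      unfolding t(3) using assms(1) ab
      by (intro powr_mono2) (auto simp: t_def distrib_left intro: norm_triangle_ineq)
    also have "\<dots> = (a + b) powr s * (t * (norm (f x) / a) + (1 - t) * (norm (g x) / b)) powr s"
      using ab t by (intro powr_mult) 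
    also have "\<dots> \<le> (a + b) powr s * (t * (norm (f x) / a) powr s + (1 - t) * (norm (g x) / b) powr s)"
      using ab t by (intro mult_left_mono powr_convex_combination assms) auto
    finally show ?thesis using ab by (simp add: powr_divide)
  qed
  then have "(\<integral>x. norm (f x + g x) powr s \<partial>M) \<le>
     (\<integral>x. (a + b) powr s * (t * (norm (f x) powr s / a powr s) + (1 - t) * (norm (g x) powr s / b powr s)) \<partial>M)"
    using f g assms(1) by (intro integral_mono integrable_powr_add) auto
  also have "\<dots> = (a + b) powr s * (t * ((\<integral>x. norm (f x) powr s \<partial>M) / a powr s) + (1 - t) * ((\<integral>x. norm (g x) powr s \<partial>M) / b powr s))"
    using f g by simp
  also have "\<dots> \<le> (a + b) powr s * (t * 1 + (1 - t) * 1)"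
    using ia t ab by (intro mult_left_mono add_mono) (auto simp: divide_le_eq)
  finally have "pnorm M s (\<lambda>x. f x + g x) \<le> a + b"
    using ab assms(1) by (subst pnorm_le_iff) auto
  then show "pnorm M s (\<lambda>x. f x + g x) \<le> pnorm M s f + pnorm M s g + e" by (simp add: a_def b_def)
qed

lemma pnorm_cong_AE:
  assumes "f \<in> borel_measurable M" "g \<in> borel_measurable M" "AE x in M. f x = g x"
  shows "pnorm M s f = pnorm M s (g :: 'a \<Rightarrow> 'b::{real_normed_vector, second_countable_topology})"
proof -
  note [measurable] = assms(1,2)
  show ?thesis unfolding pnorm_def
    using assms(3) by (intro arg_cong[where f="\<lambda>x. x powr _"] integral_cong_AE) auto
qed

lemma pnorm_scaleR: "s > 0 \<Longrightarrow> pnorm M s (\<lambda>x. c *\<^sub>R f x) = \<bar>c\<bar> * pnorm M s f"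
  by (simp add: pnorm_def powr_mult powr_powr)

lemma pnorm_eq_0_AE:
  fixes f :: "'a \<Rightarrow> 'b::{real_normed_vector, second_countable_topology}"
  assumes "integrable M (\<lambda>x. norm (f x) powr s)" "pnorm M s f = 0"
  shows "AE x in M. f x = 0"
proof -
  have "(\<integral>x. norm (f x) powr s \<partial>M) = 0" using assms(2) by (simp add: pnorm_def)
  then have "AE x in M. norm (f x) powr s = 0"
    using assms(1) by (subst (asm) integral_nonneg_eq_0_iff_AE) auto
  then show ?thesis by simp
qed

lemma powr_le_1_plus_powr:
  fixes t :: real assumes "0 < r" "r \<le> q" "0 \<le> t"
  shows "t powr r \<le> 1 + t powr q"
proof (cases "t \<le> 1")
  case True
  then have "t powr r \<le> 1 powr r" using assms by (intro powr_mono2) auto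
  then have "t powr r \<le> 1" by simp
  then show ?thesis using powr_ge_zero[of t q] by linarith
next
  case False
  then have "t powr r \<le> t powr q" using assms by (intro powr_mono) auto
  then show ?thesis by simp
qed

lemma integrable_powr_mono:
  fixes f :: "'a \<Rightarrow> 'b::{real_normed_vector, second_countable_topology}"
  assumes "finite_measure M" "0 < r" "r \<le> q" and [measurable]: "f \<in> borel_measurable M"
    and "integrable M (\<lambda>x. norm (f x) powr q)"
  shows "integrable M (\<lambda>x. norm (f x) powr r)"
proof (rule Bochner_Integration.integrable_bound)
  interpret finite_measure M by fact
  show "integrable M (\<lambda>x. 1 + norm (f x) powr q)"
    by (intro Bochner_Integration.integrable_add assms) simp
qed (use powr_le_1_plus_powr[OF assms(2,3)] in \<open>auto intro!: AE_I2\<close>)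

text \<open>
  For a function of norm one in \<open>L\<^sup>q\<close> this is the integral of \<open>t\<^sup>r \<le> 1 + t\<^sup>q\<close>; the general case follows
  by homogeneity.
\<close>

lemma pnorm_mono_exponent:
  fixes f :: "'a \<Rightarrow> 'b::{real_normed_vector, second_countable_topology}"
  assumes fin: "finite_measure M" and "0 < r" "r \<le> q" and f[measurable]: "f \<in> borel_measurable M"
    and int: "integrable M (\<lambda>x. norm (f x) powr q)"
  shows "pnorm M r f \<le> (measure M (space M) + 1) powr (1 / r) * pnorm M q f"
proof -
  interpret finite_measure M by fact
  note ir = integrable_powr_mono[OF assms]
  define a where "a = pnorm M q f"
  consider "a = 0" | "a > 0" using pnorm_nonneg[of M q f] unfolding a_def by linarith
  then show ?thesis
  proof cases
    case 1
    then have "AE x in M. f x = 0" using pnorm_eq_0_AE int by (auto simp: a_def)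
    then have "pnorm M r f = pnorm M r (\<lambda>x. 0::'b)" by (intro pnorm_cong_AE) auto
    then show ?thesis using 1 by (simp add: a_def pnorm_def)
  next
    case 2
    have "(\<integral>x. norm (f x) powr r \<partial>M) / a powr r = (\<integral>x. (norm (f x) / a) powr r \<partial>M)"
      using 2 by (simp add: powr_divide)
    also have "\<dots> \<le> (\<integral>x. 1 + norm (f x) powr q / a powr q \<partial>M)"
    proof (rule integral_mono)
      show "integrable M (\<lambda>x. (norm (f x) / a) powr r)" using ir 2 by (simp add: powr_divide)
      show "integrable M (\<lambda>x. 1 + norm (f x) powr q / a powr q)" using int by simp
      show "(norm (f x) / a) powr r \<le> 1 + norm (f x) powr q / a powr q" for x
        using powr_le_1_plus_powr[OF assms(2,3), of "norm (f x) / a"] 2 by (simp add: powr_divide)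
    qed
    also have "\<dots> = measure M (space M) + 1"
    proof -
      have "(\<integral>x. norm (f x) powr q \<partial>M) = a powr q"
        using pnorm_powr[of q M f] assms(2,3) by (simp add: a_def)
      moreover have "a powr q \<noteq> 0" using 2 by simp
      ultimately show ?thesis using int by simp
    qed
    finally have "(\<integral>x. norm (f x) powr r \<partial>M) \<le> (measure M (space M) + 1) * a powr r"
      using 2 by (simp add: field_simps)
    also have "\<dots> = ((measure M (space M) + 1) powr (1 / r) * a) powr r"
      using 2 assms(2) by (simp add: powr_mult powr_powr)
    finally show ?thesis
      unfolding a_def[symmetric] using 2 assms(2) by (subst pnorm_le_iff) auto
  qed
qed

section \<open>Function classes and their weak gradients\<close>

lemma rep_aefun_measurable [measurable]: "rep_aefun u \<in> borel_measurable lebesgue"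
  using Quotient3_rep_reflp[OF Quotient3_aefun, of u] by (simp add: ae_rel_def)

lemma aefun_eqI:
  assumes "AE x in lebesgue. rep_aefun u x = rep_aefun v x" shows "u = v"
  using Quotient3_rel_rep[OF Quotient3_aefun, of u v] assms by (simp add: ae_rel_def)

lemma rep_abs_aefun_AE:
  assumes "f \<in> borel_measurable lebesgue" shows "AE x in lebesgue. rep_aefun (abs_aefun f) x = f x"
proof -
  have "ae_rel f f" using assms by (simp add: ae_rel_def)
  then have "ae_rel (rep_aefun (abs_aefun f)) f"
    by (rule rep_abs_rsp_left[OF Quotient3_aefun])
  then show ?thesis by (simp add: ae_rel_def)
qed

lemma rep_aefun_add_AE: "AE x in lebesgue. rep_aefun (u + v) x = rep_aefun u x + rep_aefun v x"
  using rep_abs_aefun_AE[of "\<lambda>x. rep_aefun u x + rep_aefun v x"] by (simp add: plus_aefun_def)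

lemma rep_aefun_scaleR_AE: "AE x in lebesgue. rep_aefun (c *\<^sub>R u) x = c *\<^sub>R rep_aefun u x"
  using rep_abs_aefun_AE[of "\<lambda>x. c *\<^sub>R rep_aefun u x"] by (simp add: scaleR_aefun_def)

lemma rep_aefun_zero_AE: "AE x in lebesgue. rep_aefun 0 x = 0"
  using rep_abs_aefun_AE[of "\<lambda>x. 0"] by (simp add: zero_aefun_def)

lemma abs_aefun_add:
  assumes "f \<in> borel_measurable lebesgue" "g \<in> borel_measurable lebesgue"
  shows "abs_aefun (\<lambda>x. f x + g x) = abs_aefun f + abs_aefun g"
  by (rule aefun_eqI) (use rep_abs_aefun_AE[of "\<lambda>x. f x + g x"] rep_abs_aefun_AE[OF assms(1)]
    rep_abs_aefun_AE[OF assms(2)] rep_aefun_add_AE[of "abs_aefun f" "abs_aefun g"] assms in \<open>force elim: eventually_elim2\<close>)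

lemma abs_aefun_scaleR:
  assumes "f \<in> borel_measurable lebesgue"
  shows "abs_aefun (\<lambda>x. c *\<^sub>R f x) = c *\<^sub>R abs_aefun f"
proof (rule aefun_eqI)
  have "AE x in lebesgue. rep_aefun (abs_aefun (\<lambda>x. c *\<^sub>R f x)) x = c *\<^sub>R f x"
    using assms by (intro rep_abs_aefun_AE) simp
  with rep_abs_aefun_AE[OF assms] rep_aefun_scaleR_AE[of c "abs_aefun f"]
  show "AE x in lebesgue. rep_aefun (abs_aefun (\<lambda>x. c *\<^sub>R f x)) x = rep_aefun (c *\<^sub>R abs_aefun f) x"
    by eventually_elim simp
qed

lemma functions_on_add:
  assumes "u \<in> functions_on \<Omega>" "v \<in> functions_on \<Omega>" shows "u + v \<in> functions_on \<Omega>"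
  using assms rep_aefun_add_AE[of u v] unfolding functions_on_def mem_Collect_eq
  by eventually_elim simp

lemma functions_on_scaleR:
  assumes "u \<in> functions_on \<Omega>" shows "c *\<^sub>R u \<in> functions_on \<Omega>"
  using assms rep_aefun_scaleR_AE[of c u] unfolding functions_on_def mem_Collect_eq
  by eventually_elim simp

locale bounded_open_set =
  fixes \<Omega> :: "'a::euclidean_space set"
  assumes open_Omega: "open \<Omega>" and bounded_Omega: "bounded \<Omega>"
begin

lemma sets_Omega [measurable, simp]: "\<Omega> \<in> sets lebesgue" "\<Omega> \<in> sets borel"
  using open_Omega by auto

lemma finite_measure_Omega: "finite_measure (lebesgue_on \<Omega>)"
  by (intro finite_measure_lebesgue_on bounded_set_imp_lmeasurable bounded_Omega) simp

lemma rep_aefun_measurable_on [measurable]: "rep_aefun u \<in> borel_measurable (lebesgue_on K)"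
  by (rule measurable_restrict_space1) (rule rep_aefun_measurable)

lemma AE_lebesgue_on: "AE x in lebesgue. P x \<Longrightarrow> K \<in> sets lebesgue \<Longrightarrow> AE x in lebesgue_on K. P x"
  by (subst AE_restrict_space_iff) auto

lemmas AE_on_Omega = AE_lebesgue_on[OF _ sets_Omega(1)]

lemma Lp_norm_eq_pnorm: "Lp_norm \<Omega> s u = pnorm (lebesgue_on \<Omega>) s (rep_aefun u)"
  by (simp add: Lp_norm_def pnorm_def)

lemma Lp_norm_nonneg: "0 \<le> Lp_norm \<Omega> s u" by (simp add: Lp_norm_def)

lemma Lp_integrable: "u \<in> Lp \<Omega> s \<Longrightarrow> integrable (lebesgue_on \<Omega>) (\<lambda>x. norm (rep_aefun u x) powr s)"
  by (simp add: Lp_def)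

lemma Lp_add:
  assumes "s \<ge> 1" "u \<in> Lp \<Omega> s" "v \<in> Lp \<Omega> s" shows "u + v \<in> Lp \<Omega> s"
proof -
  have "integrable (lebesgue_on \<Omega>) (\<lambda>x. norm (rep_aefun u x + rep_aefun v x) powr s)"
    using assms by (intro integrable_powr_add Lp_integrable) auto
  then have "integrable (lebesgue_on \<Omega>) (\<lambda>x. norm (rep_aefun (u + v) x) powr s)"
    by (rule integrable_cong_AE_imp) (use AE_on_Omega[OF rep_aefun_add_AE[of u v]] in \<open>auto elim!: eventually_mono\<close>)
  then show ?thesis using assms functions_on_add by (auto simp: Lp_def)
qed

lemma Lp_scaleR:
  assumes "s > 0" "u \<in> Lp \<Omega> s" shows "c *\<^sub>R u \<in> Lp \<Omega> s"
proof -
  have "integrable (lebesgue_on \<Omega>) (\<lambda>x. \<bar>c\<bar> powr s * norm (rep_aefun u x) powr s)"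
    using assms by (intro integrable_mult_right Lp_integrable) auto
  then have "integrable (lebesgue_on \<Omega>) (\<lambda>x. norm (rep_aefun (c *\<^sub>R u) x) powr s)"
    by (rule integrable_cong_AE_imp)
      (use AE_on_Omega[OF rep_aefun_scaleR_AE[of c u]] in \<open>auto simp: powr_mult elim!: eventually_mono\<close>)
  then show ?thesis using assms functions_on_scaleR by (auto simp: Lp_def)
qed

lemma Lp_norm_add:
  assumes "s \<ge> 1" "u \<in> Lp \<Omega> s" "v \<in> Lp \<Omega> s"
  shows "Lp_norm \<Omega> s (u + v) \<le> Lp_norm \<Omega> s u + Lp_norm \<Omega> s v"
proof -
  have "Lp_norm \<Omega> s (u + v) = pnorm (lebesgue_on \<Omega>) s (\<lambda>x. rep_aefun u x + rep_aefun v x)"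
    unfolding Lp_norm_eq_pnorm
    by (rule pnorm_cong_AE) (use AE_on_Omega[OF rep_aefun_add_AE[of u v]] in auto)
  also have "\<dots> \<le> Lp_norm \<Omega> s u + Lp_norm \<Omega> s v"
    unfolding Lp_norm_eq_pnorm using assms by (intro Minkowski Lp_integrable) auto
  finally show ?thesis .
qed

lemma Lp_norm_scaleR:
  assumes "s > 0" shows "Lp_norm \<Omega> s (c *\<^sub>R u) = \<bar>c\<bar> * Lp_norm \<Omega> s u"
proof -
  have "Lp_norm \<Omega> s (c *\<^sub>R u) = pnorm (lebesgue_on \<Omega>) s (\<lambda>x. c *\<^sub>R rep_aefun u x)"
    unfolding Lp_norm_eq_pnorm
    by (rule pnorm_cong_AE) (use AE_on_Omega[OF rep_aefun_scaleR_AE[of c u]] in auto)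
  then show ?thesis using assms by (simp add: Lp_norm_eq_pnorm pnorm_scaleR)
qed

lemma Lp_norm_eq_0:
  assumes "u \<in> Lp \<Omega> s" "Lp_norm \<Omega> s u = 0" shows "u = 0"
proof (rule aefun_eqI)
  have "AE x in lebesgue_on \<Omega>. rep_aefun u x = 0"
    using assms by (intro pnorm_eq_0_AE[where s=s] Lp_integrable) (auto simp: Lp_norm_eq_pnorm)
  then have "AE x in lebesgue. x \<in> \<Omega> \<longrightarrow> rep_aefun u x = 0"
    by (subst (asm) AE_restrict_space_iff) auto
  moreover have "AE x in lebesgue. x \<notin> \<Omega> \<longrightarrow> rep_aefun u x = 0"
    using assms(1) by (simp add: Lp_def functions_on_def)
  ultimately show "AE x in lebesgue. rep_aefun u x = rep_aefun 0 x"
    using rep_aefun_zero_AE by eventually_elim auto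
qed

lemma Lp_mono_exponent:
  assumes "0 < r" "r \<le> q" "u \<in> Lp \<Omega> q" shows "u \<in> Lp \<Omega> r"
  using integrable_powr_mono[OF finite_measure_Omega assms(1,2) _ Lp_integrable[OF assms(3)]] assms(3)
  by (simp add: Lp_def)

lemma Lp_norm_mono_exponent:
  assumes "0 < r" "r \<le> q" "u \<in> Lp \<Omega> q"
  shows "Lp_norm \<Omega> r u \<le> (measure lebesgue \<Omega> + 1) powr (1 / r) * Lp_norm \<Omega> q u"
  using pnorm_mono_exponent[OF finite_measure_Omega assms(1,2) _ Lp_integrable[OF assms(3)]]
  by (simp add: Lp_norm_eq_pnorm measure_restrict_space)

lemma L1_locD: "u \<in> L1_loc \<Omega> \<Longrightarrow> compact K \<Longrightarrow> K \<subseteq> \<Omega> \<Longrightarrow> integrable (lebesgue_on K) (rep_aefun u)"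
  unfolding L1_loc_def by blast

lemma L1_locI:
  "u \<in> functions_on \<Omega> \<Longrightarrow> (\<And>K. compact K \<Longrightarrow> K \<subseteq> \<Omega> \<Longrightarrow> integrable (lebesgue_on K) (rep_aefun u)) \<Longrightarrow> u \<in> L1_loc \<Omega>"
  unfolding L1_loc_def by blast

lemma L1_loc_functions_on: "u \<in> L1_loc \<Omega> \<Longrightarrow> u \<in> functions_on \<Omega>"
  unfolding L1_loc_def by blast

lemma L1_loc_add:
  assumes "u \<in> L1_loc \<Omega>" "v \<in> L1_loc \<Omega>" shows "u + v \<in> L1_loc \<Omega>"
proof (rule L1_locI)
  fix K assume "compact K" "K \<subseteq> \<Omega>"
  then have "integrable (lebesgue_on K) (\<lambda>x. rep_aefun u x + rep_aefun v x)"
    by (intro Bochner_Integration.integrable_add L1_locD assms)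
  moreover have "AE x in lebesgue_on K. rep_aefun u x + rep_aefun v x = rep_aefun (u + v) x"
    using AE_lebesgue_on[OF rep_aefun_add_AE[of u v], of K] \<open>compact K\<close>
    by (auto simp: borel_compact elim!: eventually_mono)
  ultimately show "integrable (lebesgue_on K) (rep_aefun (u + v))"
    by (rule integrable_cong_AE_imp[OF _ rep_aefun_measurable_on])
qed (intro functions_on_add L1_loc_functions_on assms)

lemma L1_loc_scaleR:
  assumes "u \<in> L1_loc \<Omega>" shows "c *\<^sub>R u \<in> L1_loc \<Omega>"
proof (rule L1_locI)
  fix K assume "compact K" "K \<subseteq> \<Omega>"
  then have "integrable (lebesgue_on K) (\<lambda>x. c *\<^sub>R rep_aefun u x)"
    by (intro integrable_scaleR_right L1_locD assms)
  moreover have "AE x in lebesgue_on K. c *\<^sub>R rep_aefun u x = rep_aefun (c *\<^sub>R u) x"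
    using AE_lebesgue_on[OF rep_aefun_scaleR_AE[of c u], of K] \<open>compact K\<close>
    by (auto simp: borel_compact elim!: eventually_mono)
  ultimately show "integrable (lebesgue_on K) (rep_aefun (c *\<^sub>R u))"
    by (rule integrable_cong_AE_imp[OF _ rep_aefun_measurable_on])
qed (intro functions_on_scaleR L1_loc_functions_on assms)

text \<open>
  All integrals in the definition of a weak gradient exist.  Only this makes them additive, as the
  Bochner integral of a function that is not integrable is \<open>0\<close>.
\<close>

lemma L1_loc_times_continuous_integrable:
  assumes u: "u \<in> L1_loc \<Omega>" and \<psi>: "continuous_on UNIV \<psi>" "compact K" "K \<subseteq> \<Omega>" "\<And>x. x \<notin> K \<Longrightarrow> \<psi> x = (0::real)"
  shows "integrable (lebesgue_on \<Omega>) (\<lambda>x. \<psi> x *\<^sub>R rep_aefun u x)"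
proof -
  have [measurable]: "K \<in> sets borel" using \<psi>(2) by (simp add: borel_compact)
  obtain L where L: "L \<ge> 0" "\<And>x. norm (\<psi> x) \<le> L"
    using continuous_zero_outside_compact_bounded[OF \<psi>(1,2,4)] by metis
  have "integrable (lebesgue_on K) (rep_aefun u)" using L1_locD[OF u \<psi>(2,3)] .
  then have i: "integrable lebesgue (\<lambda>x. indicator K x *\<^sub>R rep_aefun u x)"
    by (subst (asm) integrable_restrict_space) auto
  have "\<psi> \<in> borel_measurable borel" using borel_measurable_continuous_onI[OF \<psi>(1)] .
  then have [measurable]: "\<psi> \<in> borel_measurable lebesgue" by (intro measurable_completion) simp
  have "integrable lebesgue (\<lambda>x. \<psi> x *\<^sub>R rep_aefun u x)"
  proof (rule Bochner_Integration.integrable_bound)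
    show "integrable lebesgue (\<lambda>x. L *\<^sub>R (indicator K x *\<^sub>R rep_aefun u x))" using i by (rule integrable_scaleR_right)
    show "AE x in lebesgue. norm (\<psi> x *\<^sub>R rep_aefun u x) \<le> norm (L *\<^sub>R indicat_real K x *\<^sub>R rep_aefun u x)"
    proof (rule AE_I2)
      fix x
      show "norm (\<psi> x *\<^sub>R rep_aefun u x) \<le> norm (L *\<^sub>R indicat_real K x *\<^sub>R rep_aefun u x)"
        using L \<psi>(4)[of x] by (cases "x \<in> K") (auto intro: mult_right_mono)
    qed
  qed measurable
  then have "integrable lebesgue (\<lambda>x. indicator \<Omega> x *\<^sub>R (\<psi> x *\<^sub>R rep_aefun u x))"
    by (intro integrable_mult_indicator) auto
  then show ?thesis by (subst integrable_restrict_space) auto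
qed

lemma weak_gradient_integrable:
  assumes "\<phi> \<in> test_functions \<Omega>" "b \<in> Basis"
  shows "u \<in> L1_loc \<Omega> \<Longrightarrow> integrable (lebesgue_on \<Omega>) (\<lambda>x. rep_aefun u x * partial_deriv b \<phi> x)"
    and "g \<in> L1_loc \<Omega> \<Longrightarrow> integrable (lebesgue_on \<Omega>) (\<lambda>x. (rep_aefun g x \<bullet> b) * \<phi> x)"
proof -
  obtain K where K: "compact K" "K \<subseteq> \<Omega>" "\<And>x. x \<notin> K \<Longrightarrow> \<phi> x = 0"
    "\<And>x. x \<notin> K \<Longrightarrow> partial_deriv b \<phi> x = 0"
    by (meson test_function_supportE assms(1))
  show "integrable (lebesgue_on \<Omega>) (\<lambda>x. rep_aefun u x * partial_deriv b \<phi> x)" if "u \<in> L1_loc \<Omega>"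
    using L1_loc_times_continuous_integrable[OF that test_function_partial_continuous[OF assms] K(1,2,4)]
    by (simp add: mult.commute)
  show "integrable (lebesgue_on \<Omega>) (\<lambda>x. (rep_aefun g x \<bullet> b) * \<phi> x)" if "g \<in> L1_loc \<Omega>"
    using integrable_inner_left[OF L1_loc_times_continuous_integrable[OF that test_function_continuous[OF assms(1)] K(1,2,3)], of b]
    by (simp add: mult.commute)
qed

lemma is_weak_gradient_add:
  assumes u: "is_weak_gradient \<Omega> u g" and v: "is_weak_gradient \<Omega> v h"
  shows "is_weak_gradient \<Omega> (u + v) (g + h)"
  unfolding is_weak_gradient_def
proof (intro conjI ballI)
  note u' = u[unfolded is_weak_gradient_def] and v' = v[unfolded is_weak_gradient_def]
  show "u + v \<in> L1_loc \<Omega>" "g + h \<in> L1_loc \<Omega>" using u' v' by (auto intro: L1_loc_add)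
  fix \<phi> :: "'a \<Rightarrow> real" and b :: 'a assume \<phi>: "\<phi> \<in> test_functions \<Omega>" and b: "b \<in> Basis"
  note i = weak_gradient_integrable[OF \<phi> b]
  note L = u'[THEN conjunct1] v'[THEN conjunct1] u'[THEN conjunct2, THEN conjunct1] v'[THEN conjunct2, THEN conjunct1]
  have "(\<integral>x. rep_aefun (u + v) x * partial_deriv b \<phi> x \<partial>lebesgue_on \<Omega>) =
    (\<integral>x. rep_aefun u x * partial_deriv b \<phi> x + rep_aefun v x * partial_deriv b \<phi> x \<partial>lebesgue_on \<Omega>)"
    using AE_on_Omega[OF rep_aefun_add_AE[of u v]] i(1) L L1_loc_add[OF L(1,2)]
    by (intro integral_cong_AE) (auto simp: distrib_right intro!: Bochner_Integration.integrable_add borel_measurable_integrable elim!: eventually_mono)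
  also have "\<dots> = (\<integral>x. rep_aefun u x * partial_deriv b \<phi> x \<partial>lebesgue_on \<Omega>) + (\<integral>x. rep_aefun v x * partial_deriv b \<phi> x \<partial>lebesgue_on \<Omega>)"
    using i(1) L by (intro Bochner_Integration.integral_add) auto
  also have "\<dots> = - ((\<integral>x. (rep_aefun g x \<bullet> b) * \<phi> x \<partial>lebesgue_on \<Omega>) + (\<integral>x. (rep_aefun h x \<bullet> b) * \<phi> x \<partial>lebesgue_on \<Omega>))"
    using u' v' \<phi> b by simp
  also have "(\<integral>x. (rep_aefun g x \<bullet> b) * \<phi> x \<partial>lebesgue_on \<Omega>) + (\<integral>x. (rep_aefun h x \<bullet> b) * \<phi> x \<partial>lebesgue_on \<Omega>)
     = (\<integral>x. (rep_aefun g x \<bullet> b) * \<phi> x + (rep_aefun h x \<bullet> b) * \<phi> x \<partial>lebesgue_on \<Omega>)"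
    using i(2) L by (intro Bochner_Integration.integral_add[symmetric]) auto
  also have "\<dots> = (\<integral>x. (rep_aefun (g + h) x \<bullet> b) * \<phi> x \<partial>lebesgue_on \<Omega>)"
    using AE_on_Omega[OF rep_aefun_add_AE[of g h]] i(2) L L1_loc_add[OF L(3,4)]
    by (intro integral_cong_AE) (auto simp: distrib_right inner_add_left intro!: Bochner_Integration.integrable_add borel_measurable_integrable elim!: eventually_mono)
  finally show "(\<integral>x. rep_aefun (u + v) x * partial_deriv b \<phi> x \<partial>lebesgue_on \<Omega>) =
    - (\<integral>x. (rep_aefun (g + h) x \<bullet> b) * \<phi> x \<partial>lebesgue_on \<Omega>)" .
qed

lemma is_weak_gradient_scaleR:
  assumes u: "is_weak_gradient \<Omega> u g"
  shows "is_weak_gradient \<Omega> (c *\<^sub>R u) (c *\<^sub>R g)"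
  unfolding is_weak_gradient_def
proof (intro conjI ballI)
  note u' = u[unfolded is_weak_gradient_def]
  show "c *\<^sub>R u \<in> L1_loc \<Omega>" "c *\<^sub>R g \<in> L1_loc \<Omega>" using u' by (auto intro: L1_loc_scaleR)
  fix \<phi> :: "'a \<Rightarrow> real" and b :: 'a assume \<phi>: "\<phi> \<in> test_functions \<Omega>" and b: "b \<in> Basis"
  note i = weak_gradient_integrable[OF \<phi> b]
  have L: "u \<in> L1_loc \<Omega>" "g \<in> L1_loc \<Omega>" using u' by auto
  have "(\<integral>x. rep_aefun (c *\<^sub>R u) x * partial_deriv b \<phi> x \<partial>lebesgue_on \<Omega>) =
    (\<integral>x. c * (rep_aefun u x * partial_deriv b \<phi> x) \<partial>lebesgue_on \<Omega>)"
    using AE_on_Omega[OF rep_aefun_scaleR_AE[of c u]] i(1) L L1_loc_scaleR[OF L(1)]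
    by (intro integral_cong_AE) (auto intro!: integrable_mult_right borel_measurable_integrable elim!: eventually_mono)
  also have "\<dots> = - (\<integral>x. c * ((rep_aefun g x \<bullet> b) * \<phi> x) \<partial>lebesgue_on \<Omega>)"
    using u' \<phi> b by simp
  also have "(\<integral>x. c * ((rep_aefun g x \<bullet> b) * \<phi> x) \<partial>lebesgue_on \<Omega>) = (\<integral>x. (rep_aefun (c *\<^sub>R g) x \<bullet> b) * \<phi> x \<partial>lebesgue_on \<Omega>)"
    using AE_on_Omega[OF rep_aefun_scaleR_AE[of c g]] i(2) L L1_loc_scaleR[OF L(2)]
    by (intro integral_cong_AE) (auto intro!: integrable_mult_right borel_measurable_integrable elim!: eventually_mono)
  finally show "(\<integral>x. rep_aefun (c *\<^sub>R u) x * partial_deriv b \<phi> x \<partial>lebesgue_on \<Omega>) =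
    - (\<integral>x. (rep_aefun (c *\<^sub>R g) x \<bullet> b) * \<phi> x \<partial>lebesgue_on \<Omega>)" .
qed

text \<open>
  Inside \<open>\<Omega>\<close> the components of the difference integrate to zero against all test functions; outside
  \<open>\<Omega>\<close> both classes vanish by convention.
\<close>

lemma is_weak_gradient_unique:
  assumes g: "is_weak_gradient \<Omega> u g" and h: "is_weak_gradient \<Omega> u h"
  shows "g = h"
proof (rule aefun_eqI)
  note L = g[unfolded is_weak_gradient_def] h[unfolded is_weak_gradient_def]
  have gh: "g \<in> L1_loc \<Omega>" "h \<in> L1_loc \<Omega>" using L by blast+
  have "AE x in lebesgue. x \<in> \<Omega> \<longrightarrow> rep_aefun g x \<bullet> b - rep_aefun h x \<bullet> b = 0" if b: "b \<in> Basis" for b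
  proof (rule fundamental_lemma[OF open_Omega])
    fix K assume K: "compact K" "K \<subseteq> \<Omega>"
    have "integrable (lebesgue_on K) (\<lambda>x. rep_aefun g x \<bullet> b)"
      using L1_locD[OF gh(1) K] by (rule integrable_inner_left)
    moreover have "integrable (lebesgue_on K) (\<lambda>x. rep_aefun h x \<bullet> b)"
      using L1_locD[OF gh(2) K] by (rule integrable_inner_left)
    ultimately show "integrable (lebesgue_on K) (\<lambda>x. rep_aefun g x \<bullet> b - rep_aefun h x \<bullet> b)"
      by (rule Bochner_Integration.integrable_diff)
  next
    show "(\<integral>x. (rep_aefun g x \<bullet> b - rep_aefun h x \<bullet> b) * \<phi> x \<partial>lebesgue_on \<Omega>) = 0"
      if \<phi>: "\<phi> \<in> test_functions \<Omega>" for \<phi>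
    proof -
      have "(\<integral>x. (rep_aefun g x \<bullet> b) * \<phi> x \<partial>lebesgue_on \<Omega>) = (\<integral>x. (rep_aefun h x \<bullet> b) * \<phi> x \<partial>lebesgue_on \<Omega>)"
        using L(1)[THEN conjunct2, THEN conjunct2, rule_format, OF \<phi> b]
          L(2)[THEN conjunct2, THEN conjunct2, rule_format, OF \<phi> b] by linarith
      then show ?thesis using weak_gradient_integrable(2)[OF \<phi> b] gh by (simp add: left_diff_distrib)
    qed
  qed measurable
  then have "AE x in lebesgue. \<forall>b\<in>Basis. x \<in> \<Omega> \<longrightarrow> rep_aefun g x \<bullet> b - rep_aefun h x \<bullet> b = 0"
    by (intro AE_finite_allI) auto
  moreover have "AE x in lebesgue. x \<notin> \<Omega> \<longrightarrow> rep_aefun g x = 0" "AE x in lebesgue. x \<notin> \<Omega> \<longrightarrow> rep_aefun h x = 0"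
    using gh[THEN L1_loc_functions_on] by (simp_all add: functions_on_def)
  ultimately show "AE x in lebesgue. rep_aefun g x = rep_aefun h x"
  proof eventually_elim
    case (elim x)
    then show ?case by (cases "x \<in> \<Omega>") (auto simp: euclidean_eq_iff[of "rep_aefun g x"])
  qed
qed

lemma weak_grad_eqI: "is_weak_gradient \<Omega> u g \<Longrightarrow> weak_grad \<Omega> u = g"
  unfolding weak_grad_def using is_weak_gradient_unique by blast

section \<open>Sobolev spaces\<close>

definition grad_norm :: "real \<Rightarrow> ('a, real) aefun \<Rightarrow> real" where
  "grad_norm s u = Lp_norm \<Omega> s (weak_grad \<Omega> u)"

lemma W1D:
  assumes "u \<in> W1 \<Omega> s"
  shows "u \<in> Lp \<Omega> s" "weak_grad \<Omega> u \<in> Lp \<Omega> s" "is_weak_gradient \<Omega> u (weak_grad \<Omega> u)"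
  using assms weak_grad_eqI by (auto simp: W1_def)

lemma W1I: "u \<in> Lp \<Omega> s \<Longrightarrow> g \<in> Lp \<Omega> s \<Longrightarrow> is_weak_gradient \<Omega> u g \<Longrightarrow> u \<in> W1 \<Omega> s"
  by (auto simp: W1_def)

lemma weak_grad_add:
  assumes "u \<in> W1 \<Omega> s" "v \<in> W1 \<Omega> t" shows "weak_grad \<Omega> (u + v) = weak_grad \<Omega> u + weak_grad \<Omega> v"
  using assms by (intro weak_grad_eqI is_weak_gradient_add W1D)

lemma weak_grad_scaleR:
  assumes "u \<in> W1 \<Omega> s" shows "weak_grad \<Omega> (c *\<^sub>R u) = c *\<^sub>R weak_grad \<Omega> u"
  using assms by (intro weak_grad_eqI is_weak_gradient_scaleR W1D)

lemma W1_add: "s \<ge> 1 \<Longrightarrow> u \<in> W1 \<Omega> s \<Longrightarrow> v \<in> W1 \<Omega> s \<Longrightarrow> u + v \<in> W1 \<Omega> s"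
  by (rule W1I[of _ _ "weak_grad \<Omega> u + weak_grad \<Omega> v"]) (simp_all add: Lp_add is_weak_gradient_add W1D)

lemma W1_scaleR: "s \<ge> 1 \<Longrightarrow> u \<in> W1 \<Omega> s \<Longrightarrow> c *\<^sub>R u \<in> W1 \<Omega> s"
  by (rule W1I[of _ _ "c *\<^sub>R weak_grad \<Omega> u"]) (simp_all add: Lp_scaleR is_weak_gradient_scaleR W1D)

lemma W1_diff: "s \<ge> 1 \<Longrightarrow> u \<in> W1 \<Omega> s \<Longrightarrow> v \<in> W1 \<Omega> s \<Longrightarrow> u - v \<in> W1 \<Omega> s"
  using W1_add[of s u "(-1) *\<^sub>R v"] W1_scaleR[of s v "-1"] by simp

lemma grad_norm_nonneg: "0 \<le> grad_norm s u" by (simp add: grad_norm_def Lp_norm_nonneg)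

lemma grad_norm_add:
  "s \<ge> 1 \<Longrightarrow> u \<in> W1 \<Omega> s \<Longrightarrow> v \<in> W1 \<Omega> s \<Longrightarrow> grad_norm s (u + v) \<le> grad_norm s u + grad_norm s v"
  unfolding grad_norm_def by (subst weak_grad_add) (auto intro: Lp_norm_add W1D)

lemma grad_norm_scaleR: "s > 0 \<Longrightarrow> u \<in> W1 \<Omega> s \<Longrightarrow> grad_norm s (c *\<^sub>R u) = \<bar>c\<bar> * grad_norm s u"
  unfolding grad_norm_def by (subst weak_grad_scaleR) (auto simp: Lp_norm_scaleR)

lemma grad_norm_mono_exponent:
  assumes "0 < r" "r \<le> q" "u \<in> W1 \<Omega> q"
  shows "grad_norm r u \<le> (measure lebesgue \<Omega> + 1) powr (1 / r) * grad_norm q u"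
  unfolding grad_norm_def using assms by (intro Lp_norm_mono_exponent W1D)

text \<open>
  The bridge between norms of classes over \<open>\<Omega>\<close> with Lebesgue measure and norms of Borel functions on
  the whole space, where translations act.
\<close>

lemma compact_support_Lp:
  fixes f :: "'a \<Rightarrow> 'b::euclidean_space"
  assumes f: "continuous_on UNIV f" "compact K" "K \<subseteq> \<Omega>" "\<And>x. x \<notin> K \<Longrightarrow> f x = 0" and s: "s > 0"
  shows "abs_aefun f \<in> L1_loc \<Omega>" "abs_aefun f \<in> Lp \<Omega> s" "Lp_norm \<Omega> s (abs_aefun f) = pnorm lborel s f"
proof -
  have fb: "f \<in> borel_measurable borel" using borel_measurable_continuous_onI[OF f(1)] .
  then have fm[measurable]: "f \<in> borel_measurable lebesgue" by (intro measurable_completion) simp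
  note ae = rep_abs_aefun_AE[OF fm]
  have fo: "abs_aefun f \<in> functions_on \<Omega>"
    unfolding functions_on_def mem_Collect_eq using ae
  proof eventually_elim
    case (elim x)
    then show ?case using f(3) f(4)[of x] by auto
  qed
  have fK[measurable]: "f \<in> borel_measurable (lebesgue_on A)" for A by (rule measurable_restrict_space1[OF fm])
  have "integrable (lebesgue_on A) (rep_aefun (abs_aefun f))" if "compact A" for A
  proof -
    have A: "A \<in> sets lebesgue" using that by (simp add: borel_compact)
    have "integrable lebesgue f"
      using integrable_continuous_compact_support[OF f(1,2,4)] fb by (simp add: integrable_completion)
    then have "integrable (lebesgue_on A) f"
      using integrable_mult_indicator[OF A] A by (subst integrable_restrict_space) auto
    then show ?thesis
      by (rule integrable_cong_AE_imp) (use AE_lebesgue_on[OF ae A] in \<open>auto elim!: eventually_mono\<close>)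
  qed
  then show "abs_aefun f \<in> L1_loc \<Omega>" by (intro L1_locI fo)
  let ?h = "\<lambda>x. norm (f x) powr s"
  have hb: "?h \<in> borel_measurable borel" using fb by measurable
  have ind: "(\<lambda>x. indicat_real \<Omega> x *\<^sub>R ?h x) = ?h"
    using f(3,4) s by (intro ext) (auto simp: indicator_def)
  have c: "continuous_on UNIV ?h"
    using s by (intro continuous_on_powr' continuous_intros f(1)) auto
  have ih: "integrable lebesgue ?h"
    using integrable_continuous_compact_support[OF c f(2)] f(4) s hb by (simp add: integrable_completion)
  then have "integrable (lebesgue_on \<Omega>) ?h"
    by (subst integrable_restrict_space) (auto simp del: real_scaleR_def simp: ind)
  then have "integrable (lebesgue_on \<Omega>) (\<lambda>x. norm (rep_aefun (abs_aefun f) x) powr s)"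
    by (rule integrable_cong_AE_imp) (use AE_on_Omega[OF ae] in \<open>auto elim!: eventually_mono\<close>)
  then show "abs_aefun f \<in> Lp \<Omega> s" using fo by (simp add: Lp_def)
  have "Lp_norm \<Omega> s (abs_aefun f) = pnorm (lebesgue_on \<Omega>) s f"
    unfolding Lp_norm_eq_pnorm by (rule pnorm_cong_AE) (use AE_on_Omega[OF ae] in auto)
  also have "\<dots> = pnorm lebesgue s f"
    unfolding pnorm_def by (subst integral_restrict_space) (auto simp del: real_scaleR_def simp: ind)
  also have "\<dots> = pnorm lborel s f"
    unfolding pnorm_def using hb by (simp add: integral_completion)
  finally show "Lp_norm \<Omega> s (abs_aefun f) = pnorm lborel s f" .
qed

lemma test_function_measurable_lebesgue: "\<phi> \<in> test_functions \<Omega> \<Longrightarrow> \<phi> \<in> borel_measurable lebesgue"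
  by (intro measurable_completion) (simp add: borel_measurable_continuous_onI test_function_continuous)

lemma test_function_weak_gradient:
  assumes \<phi>: "\<phi> \<in> test_functions \<Omega>" and s: "s > 0"
  shows "is_weak_gradient \<Omega> (abs_aefun \<phi>) (abs_aefun (grad \<phi>))"
    and "abs_aefun \<phi> \<in> W1 \<Omega> s" and "weak_grad \<Omega> (abs_aefun \<phi>) = abs_aefun (grad \<phi>)"
    and "Lp_norm \<Omega> s (abs_aefun \<phi>) = pnorm lborel s \<phi>"
    and "grad_norm s (abs_aefun \<phi>) = pnorm lborel s (grad \<phi>)"
proof -
  obtain K where K: "compact K" "K \<subseteq> \<Omega>" "\<And>x. x \<notin> K \<Longrightarrow> \<phi> x = 0"
    "\<And>b x. x \<notin> K \<Longrightarrow> partial_deriv b \<phi> x = 0"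
    by (meson test_function_supportE \<phi>)
  have K': "\<And>x. x \<notin> K \<Longrightarrow> grad \<phi> x = 0" using K(4) by (simp add: grad_def)
  have 1: "abs_aefun \<phi> \<in> L1_loc \<Omega>" "abs_aefun \<phi> \<in> Lp \<Omega> s"
      "Lp_norm \<Omega> s (abs_aefun \<phi>) = pnorm lborel s \<phi>"
    by (rule compact_support_Lp[OF test_function_continuous[OF \<phi>] K(1,2) _ s]; simp add: K(3))+
  have 2: "abs_aefun (grad \<phi>) \<in> L1_loc \<Omega>" "abs_aefun (grad \<phi>) \<in> Lp \<Omega> s"
      "Lp_norm \<Omega> s (abs_aefun (grad \<phi>)) = pnorm lborel s (grad \<phi>)"
    by (rule compact_support_Lp[OF test_function_grad_continuous[OF \<phi>] K(1,2) _ s]; simp add: K')+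
  have gm[measurable]: "grad \<phi> \<in> borel_measurable lebesgue"
    using test_function_grad_continuous[OF \<phi>] by (intro measurable_completion) (simp add: borel_measurable_continuous_onI)
  show wg: "is_weak_gradient \<Omega> (abs_aefun \<phi>) (abs_aefun (grad \<phi>))"
    unfolding is_weak_gradient_def
  proof (intro conjI ballI)
    show "abs_aefun \<phi> \<in> L1_loc \<Omega>" "abs_aefun (grad \<phi>) \<in> L1_loc \<Omega>" using 1(1) 2(1) by auto
    fix \<psi> :: "'a \<Rightarrow> real" and b :: 'a assume \<psi>: "\<psi> \<in> test_functions \<Omega>" and b: "b \<in> Basis"
    have pm[measurable]: "partial_deriv b \<psi> \<in> borel_measurable borel" "\<phi> \<in> borel_measurable borel"
      "\<psi> \<in> borel_measurable borel" "grad \<phi> \<in> borel_measurable borel"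
      using test_function_partial_continuous[OF \<psi> b] test_function_continuous[OF \<phi>] test_function_continuous[OF \<psi>]
         test_function_grad_continuous[OF \<phi>] by (auto intro: borel_measurable_continuous_onI)
    have swap: "(\<integral>x. rep_aefun (abs_aefun f) x \<bullet> c * h x \<partial>lebesgue_on \<Omega>) = (\<integral>x. f x \<bullet> c * h x \<partial>lborel)"
      if [measurable]: "f \<in> borel_measurable borel" "h \<in> borel_measurable borel" and 0: "\<And>x. x \<notin> \<Omega> \<Longrightarrow> f x = 0"
      for f :: "'a \<Rightarrow> 'c::euclidean_space" and c h
    proof -
      have [measurable]: "f \<in> borel_measurable lebesgue" "h \<in> borel_measurable lebesgue"
        by (auto intro: measurable_completion)
      have "(\<integral>x. rep_aefun (abs_aefun f) x \<bullet> c * h x \<partial>lebesgue_on \<Omega>)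
         = (\<integral>x. indicator \<Omega> x *\<^sub>R (rep_aefun (abs_aefun f) x \<bullet> c * h x) \<partial>lebesgue)"
        by (rule integral_restrict_space) simp
      also have "\<dots> = (\<integral>x. f x \<bullet> c * h x \<partial>lebesgue)"
        using rep_abs_aefun_AE[of f] 0
        by (intro integral_cong_AE) (auto simp: indicator_def elim!: eventually_mono)
      also have "\<dots> = (\<integral>x. f x \<bullet> c * h x \<partial>lborel)" by (rule integral_completion) measurable
      finally show ?thesis .
    qed
    have "(\<integral>x. rep_aefun (abs_aefun \<phi>) x * partial_deriv b \<psi> x \<partial>lebesgue_on \<Omega>) = (\<integral>x. \<phi> x * partial_deriv b \<psi> x \<partial>lborel)"
      using swap[of \<phi> "partial_deriv b \<psi>" 1] K(2,3) by auto
    also have "\<dots> = - (\<integral>x. (grad \<phi> x \<bullet> b) * \<psi> x \<partial>lborel)"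
      using integration_by_parts_test_functions[OF \<phi> \<psi> b] by (simp add: grad_inner_Basis[OF b])
    also have "(\<integral>x. (grad \<phi> x \<bullet> b) * \<psi> x \<partial>lborel) = (\<integral>x. rep_aefun (abs_aefun (grad \<phi>)) x \<bullet> b * \<psi> x \<partial>lebesgue_on \<Omega>)"
      using K(2) K' by (intro swap[symmetric]) auto
    finally show "(\<integral>x. rep_aefun (abs_aefun \<phi>) x * partial_deriv b \<psi> x \<partial>lebesgue_on \<Omega>) =
      - (\<integral>x. rep_aefun (abs_aefun (grad \<phi>)) x \<bullet> b * \<psi> x \<partial>lebesgue_on \<Omega>)" .
  qed
  show "abs_aefun \<phi> \<in> W1 \<Omega> s" using wg 1(2) 2(2) by (rule W1I[rotated 2])
  show "weak_grad \<Omega> (abs_aefun \<phi>) = abs_aefun (grad \<phi>)" using wg by (rule weak_grad_eqI)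
  then show "grad_norm s (abs_aefun \<phi>) = pnorm lborel s (grad \<phi>)" using 2(3) by (simp add: grad_norm_def)
  show "Lp_norm \<Omega> s (abs_aefun \<phi>) = pnorm lborel s \<phi>" using 1(3) .
qed

lemma W01D: "u \<in> W01 \<Omega> s \<Longrightarrow> u \<in> W1 \<Omega> s" by (simp add: W01_def)

lemma W01_approx:
  assumes "u \<in> W01 \<Omega> s" "e > 0"
  obtains \<phi> where "\<phi> \<in> test_functions \<Omega>" "Lp_norm \<Omega> s (u - abs_aefun \<phi>) + grad_norm s (u - abs_aefun \<phi>) < e"
  using assms by (auto simp: W01_def grad_norm_def)

lemma W01I:
  assumes "u \<in> W1 \<Omega> s" "\<And>e. e > 0 \<Longrightarrow> \<exists>\<phi>\<in>test_functions \<Omega>. Lp_norm \<Omega> s (u - abs_aefun \<phi>) + grad_norm s (u - abs_aefun \<phi>) < e"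
  shows "u \<in> W01 \<Omega> s"
  using assms by (auto simp: W01_def grad_norm_def)

lemma W01_add:
  assumes s: "s \<ge> 1" and u: "u \<in> W01 \<Omega> s" and v: "v \<in> W01 \<Omega> s"
  shows "u + v \<in> W01 \<Omega> s"
proof (rule W01I)
  show "u + v \<in> W1 \<Omega> s" using u v s by (auto intro: W1_add W01D)
  fix e :: real assume "e > 0"
  then have e: "e / 2 > 0" by simp
  obtain \<phi> where \<phi>: "\<phi> \<in> test_functions \<Omega>" "Lp_norm \<Omega> s (u - abs_aefun \<phi>) + grad_norm s (u - abs_aefun \<phi>) < e / 2"
    by (rule W01_approx[OF u e])
  obtain \<psi> where \<psi>: "\<psi> \<in> test_functions \<Omega>" "Lp_norm \<Omega> s (v - abs_aefun \<psi>) + grad_norm s (v - abs_aefun \<psi>) < e / 2"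
    by (rule W01_approx[OF v e])
  have eq: "u + v - abs_aefun (\<lambda>x. \<phi> x + \<psi> x) = (u - abs_aefun \<phi>) + (v - abs_aefun \<psi>)"
    using \<phi>(1) \<psi>(1) by (simp add: abs_aefun_add test_function_measurable_lebesgue)
  have W: "u - abs_aefun \<phi> \<in> W1 \<Omega> s" "v - abs_aefun \<psi> \<in> W1 \<Omega> s"
    using s by (auto intro!: W1_diff W01D[OF u] W01D[OF v] test_function_weak_gradient(2) \<phi>(1) \<psi>(1))
  have "Lp_norm \<Omega> s (u + v - abs_aefun (\<lambda>x. \<phi> x + \<psi> x)) + grad_norm s (u + v - abs_aefun (\<lambda>x. \<phi> x + \<psi> x)) < e"
    unfolding eq using Lp_norm_add[OF s W1D(1)[OF W(1)] W1D(1)[OF W(2)]] grad_norm_add[OF s W] \<phi>(2) \<psi>(2) by linarith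
  then show "\<exists>\<phi>\<in>test_functions \<Omega>. Lp_norm \<Omega> s (u + v - abs_aefun \<phi>) + grad_norm s (u + v - abs_aefun \<phi>) < e"
    using test_function_add[OF \<phi>(1) \<psi>(1)] by blast
qed

lemma W01_scaleR:
  assumes s: "s \<ge> 1" and u: "u \<in> W01 \<Omega> s"
  shows "c *\<^sub>R u \<in> W01 \<Omega> s"
proof (rule W01I)
  show "c *\<^sub>R u \<in> W1 \<Omega> s" using u s by (auto intro: W1_scaleR W01D)
  fix e :: real assume e: "e > 0"
  then have "e / (\<bar>c\<bar> + 1) > 0" by (intro divide_pos_pos) auto
  then obtain \<phi> where \<phi>: "\<phi> \<in> test_functions \<Omega>" "Lp_norm \<Omega> s (u - abs_aefun \<phi>) + grad_norm s (u - abs_aefun \<phi>) < e / (\<bar>c\<bar> + 1)"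
    by (rule W01_approx[OF u])
  have eq: "c *\<^sub>R u - abs_aefun (\<lambda>x. c * \<phi> x) = c *\<^sub>R (u - abs_aefun \<phi>)"
    using \<phi>(1) abs_aefun_scaleR[of \<phi> c] by (simp add: test_function_measurable_lebesgue scaleR_diff_right)
  have W: "u - abs_aefun \<phi> \<in> W1 \<Omega> s"
    using s by (auto intro!: W1_diff W01D[OF u] test_function_weak_gradient(2) \<phi>(1))
  have "Lp_norm \<Omega> s (c *\<^sub>R u - abs_aefun (\<lambda>x. c * \<phi> x)) + grad_norm s (c *\<^sub>R u - abs_aefun (\<lambda>x. c * \<phi> x))
     = \<bar>c\<bar> * (Lp_norm \<Omega> s (u - abs_aefun \<phi>) + grad_norm s (u - abs_aefun \<phi>))"
    unfolding eq using s W by (simp add: Lp_norm_scaleR grad_norm_scaleR distrib_left)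
  also have "\<dots> \<le> \<bar>c\<bar> * (e / (\<bar>c\<bar> + 1))" using \<phi>(2) by (intro mult_left_mono) auto
  also have "\<dots> < e" using e by (simp add: field_simps)
  finally show "\<exists>\<phi>\<in>test_functions \<Omega>. Lp_norm \<Omega> s (c *\<^sub>R u - abs_aefun \<phi>) + grad_norm s (c *\<^sub>R u - abs_aefun \<phi>) < e"
    using test_function_scale[OF \<phi>(1)] by blast
qed

lemma Lp_norm_zero: "s > 0 \<Longrightarrow> Lp_norm \<Omega> s (0 :: ('a, 'b::euclidean_space) aefun) = 0"
  using Lp_norm_scaleR[of s 0 "0::('a,'b) aefun"] by simp

lemma test_function_W01:
  assumes "s > 0" "\<phi> \<in> test_functions \<Omega>" shows "abs_aefun \<phi> \<in> W01 \<Omega> s"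
proof (rule W01I)
  show W: "abs_aefun \<phi> \<in> W1 \<Omega> s" using assms by (rule test_function_weak_gradient(2)[rotated])
  have "grad_norm s 0 = 0" using grad_norm_scaleR[OF assms(1) W, of 0] by simp
  then show "\<exists>\<phi>'\<in>test_functions \<Omega>. Lp_norm \<Omega> s (abs_aefun \<phi> - abs_aefun \<phi>') + grad_norm s (abs_aefun \<phi> - abs_aefun \<phi>') < e" if "e > 0" for e
    using assms that by (intro bexI[of _ \<phi>]) (auto simp: Lp_norm_zero)
qed

lemma W01_zero: "s > 0 \<Longrightarrow> 0 \<in> W01 \<Omega> s"
  using test_function_W01[OF _ test_function_zero, of s] by (simp add: zero_aefun_def)

lemma W01_diff: "s \<ge> 1 \<Longrightarrow> u \<in> W01 \<Omega> s \<Longrightarrow> v \<in> W01 \<Omega> s \<Longrightarrow> u - v \<in> W01 \<Omega> s"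
  using W01_add[of s u "(-1) *\<^sub>R v"] W01_scaleR[of s v "-1"] by simp

lemma W01_sum: "s \<ge> 1 \<Longrightarrow> (\<And>i. i \<in> I \<Longrightarrow> f i \<in> W01 \<Omega> s) \<Longrightarrow> sum f I \<in> W01 \<Omega> s"
  by (induction I rule: infinite_finite_induct) (auto intro: W01_add W01_zero)

end

section \<open>The Poincare and Ehrling inequalities\<close>

lemma test_function_powr_integrable:
  fixes f :: "'a::euclidean_space \<Rightarrow> 'b::euclidean_space"
  assumes "continuous_on UNIV f" "compact K" "\<And>x. x \<notin> K \<Longrightarrow> f x = 0" "s > 0"
  shows "integrable lborel (\<lambda>x. norm (f x) powr s)"
  using assms by (intro integrable_continuous_compact_support[OF _ assms(2)] continuous_on_powr' continuous_intros) auto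

lemma powr_le_powr_imp_le:
  fixes a c s :: real
  assumes "a powr s \<le> c powr s" "0 < s" "0 \<le> c"
  shows "a \<le> c"
  using powr_less_mono2[of s c a] assms by linarith

lemma pnorm_translate:
  fixes f :: "'a::euclidean_space \<Rightarrow> real"
  assumes [measurable]: "f \<in> borel_measurable borel"
  shows "pnorm lborel s (\<lambda>x. f (x + h)) = pnorm lborel s f"
  unfolding pnorm_def using integral_lborel_translate[of "\<lambda>x. norm (f x) powr s" h] by simp

context
  fixes \<phi> :: "'a::euclidean_space \<Rightarrow> real" and \<Omega> :: "'a set" and s :: real
  assumes \<phi>: "\<phi> \<in> test_functions \<Omega>" and s: "s \<ge> 1"
begin

lemma borel_measurable_test_function [measurable]: "\<phi> \<in> borel_measurable borel" "grad \<phi> \<in> borel_measurable borel"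
  using test_function_continuous[OF \<phi>] test_function_grad_continuous[OF \<phi>]
  by (auto intro: borel_measurable_continuous_onI)

lemma integrable_difference_powr: "integrable lborel (\<lambda>x. norm (\<phi> (x + h) - \<phi> x) powr s)"
proof -
  obtain K where K: "compact K" "\<And>x. x \<notin> K \<Longrightarrow> \<phi> x = 0"
    by (meson test_function_supportE \<phi>)
  have i: "integrable lborel (\<lambda>x. norm (\<phi> x) powr s)"
    by (rule test_function_powr_integrable[OF test_function_continuous[OF \<phi>] K]) (use s in auto)
  have "integrable lborel (\<lambda>x. norm (\<phi> (x + h) + - \<phi> x) powr s)"
    using i integrable_lborel_translate[OF i, of h] s by (intro integrable_powr_add) auto
  then show ?thesis by simp
qed

lemma integrable_grad_powr: "integrable lborel (\<lambda>x. norm (grad \<phi> x) powr s)"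
proof -
  obtain K where K: "compact K" "\<And>b x. x \<notin> K \<Longrightarrow> partial_deriv b \<phi> x = 0"
    by (meson test_function_supportE \<phi>)
  show ?thesis
    by (rule test_function_powr_integrable[OF test_function_grad_continuous[OF \<phi>] K(1)])
      (use s K(2) in \<open>auto simp: grad_def\<close>)
qed

text \<open>A translation by \<open>m h\<close> is made up of \<open>m\<close> translations by \<open>h\<close>, each with the same norm.\<close>

lemma pnorm_difference_multiple:
  "pnorm lborel s (\<lambda>x. \<phi> (x + real m *\<^sub>R h) - \<phi> x) \<le> real m * pnorm lborel s (\<lambda>x. \<phi> (x + h) - \<phi> x)"
proof (induction m)
  case 0
  then show ?case by (simp add: pnorm_def)
next
  case (Suc m)
  let ?d = "\<lambda>x. \<phi> (x + h) - \<phi> x"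
  have "pnorm lborel s (\<lambda>x. \<phi> (x + real (Suc m) *\<^sub>R h) - \<phi> x)
     = pnorm lborel s (\<lambda>x. ?d (x + real m *\<^sub>R h) + (\<phi> (x + real m *\<^sub>R h) - \<phi> x))"
    by (simp add: algebra_simps)
  also have "\<dots> \<le> pnorm lborel s (\<lambda>x. ?d (x + real m *\<^sub>R h)) + pnorm lborel s (\<lambda>x. \<phi> (x + real m *\<^sub>R h) - \<phi> x)"
    using s integrable_lborel_translate[OF integrable_difference_powr[of h], of "real m *\<^sub>R h"]
      integrable_difference_powr
    by (intro Minkowski) auto
  also have "pnorm lborel s (\<lambda>x. ?d (x + real m *\<^sub>R h)) = pnorm lborel s ?d"
    by (rule pnorm_translate) measurable
  finally show ?case using Suc by (simp add: algebra_simps)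
qed

text \<open>
  Cut \<open>y\<close> into \<open>n\<close> equal steps: the norm of the difference is at most \<open>n\<close> times the norm of one step,
  that is, the norm of the difference quotient, which tends to \<open>\<parallel>\<nabla>\<phi> \<cdot> y\<parallel>\<close>.
\<close>

lemma pnorm_difference_le:
  "pnorm lborel s (\<lambda>x. \<phi> (x + y) - \<phi> x) \<le> norm y * pnorm lborel s (grad \<phi>)"
proof -
  let ?D = "\<lambda>n x. real (Suc n) * (\<phi> (x + y /\<^sub>R real (Suc n)) - \<phi> x)"
  have le: "pnorm lborel s (\<lambda>x. \<phi> (x + y) - \<phi> x) powr s \<le> (\<integral>x. \<bar>?D n x\<bar> powr s \<partial>lborel)" for n
  proof -
    have "pnorm lborel s (\<lambda>x. \<phi> (x + y) - \<phi> x) \<le> real (Suc n) * pnorm lborel s (\<lambda>x. \<phi> (x + y /\<^sub>R real (Suc n)) - \<phi> x)"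
      using pnorm_difference_multiple[of "Suc n" "y /\<^sub>R real (Suc n)"] by simp
    also have "\<dots> = pnorm lborel s (?D n)"
      using pnorm_scaleR[of s lborel "real (Suc n)" "\<lambda>x. \<phi> (x + y /\<^sub>R real (Suc n)) - \<phi> x"] s by simp
    finally have "pnorm lborel s (\<lambda>x. \<phi> (x + y) - \<phi> x) powr s \<le> pnorm lborel s (?D n) powr s"
      using s by (intro powr_mono2) (auto simp: pnorm_nonneg)
    then show ?thesis using s by (simp add: pnorm_powr)
  qed
  have "continuous_on UNIV (\<lambda>t::real. \<bar>t\<bar> powr s)"
    using s by (intro continuous_on_powr' continuous_intros) auto
  from difference_quotient_integral_tendsto[OF \<phi> this, of y]
  have lim: "(\<lambda>n. \<integral>x. \<bar>?D n x\<bar> powr s \<partial>lborel) \<longlonglongrightarrow> (\<integral>x. \<bar>grad \<phi> x \<bullet> y\<bar> powr s \<partial>lborel)" by simp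
  have "pnorm lborel s (\<lambda>x. \<phi> (x + y) - \<phi> x) powr s \<le> (\<integral>x. \<bar>grad \<phi> x \<bullet> y\<bar> powr s \<partial>lborel)"
    using le by (intro LIMSEQ_le_const[OF lim]) auto
  also have "\<dots> \<le> (\<integral>x. norm y powr s * norm (grad \<phi> x) powr s \<partial>lborel)"
  proof (rule integral_mono')
    show "integrable lborel (\<lambda>x. norm y powr s * norm (grad \<phi> x) powr s)"
      using integrable_grad_powr by simp
    show "\<bar>grad \<phi> x \<bullet> y\<bar> powr s \<le> norm y powr s * norm (grad \<phi> x) powr s" for x
      using powr_mono2[of s "\<bar>grad \<phi> x \<bullet> y\<bar>" "norm y * norm (grad \<phi> x)"] s Cauchy_Schwarz_ineq2[of "grad \<phi> x" y]
      by (simp add: powr_mult mult.commute)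
  qed simp
  also have "\<dots> = (norm y * pnorm lborel s (grad \<phi>)) powr s"
    using s by (simp add: powr_mult pnorm_powr pnorm_nonneg)
  finally have "pnorm lborel s (\<lambda>x. \<phi> (x + y) - \<phi> x) powr s \<le> (norm y * pnorm lborel s (grad \<phi>)) powr s" .
  moreover have "0 \<le> norm y * pnorm lborel s (grad \<phi>)" by (simp add: pnorm_nonneg)
  ultimately show ?thesis using s by (auto intro: powr_le_powr_imp_le[of _ s])
qed

text \<open>
  A translation by \<open>2 R\<close> moves \<open>\<Omega>\<close> off itself, so on the support of \<open>\<phi>\<close> the difference
  \<open>\<phi>(\<cdot> + y) - \<phi>\<close> is just \<open>- \<phi>\<close>.
\<close>

lemma Poincare_test_function:
  assumes R: "\<Omega> \<subseteq> ball 0 R"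
  shows "pnorm lborel s \<phi> \<le> 2 * \<bar>R\<bar> * pnorm lborel s (grad \<phi>)"
proof -
  define b where "b = (SOME i. i \<in> (Basis :: 'a set))"
  have b: "b \<in> Basis" unfolding b_def by (rule SOME_Basis)
  obtain K where K: "compact K" "K \<subseteq> \<Omega>" "\<And>x. x \<notin> K \<Longrightarrow> \<phi> x = 0"
    by (meson test_function_supportE \<phi>)
  let ?y = "(2 * \<bar>R\<bar>) *\<^sub>R b"
  have ny: "norm ?y = 2 * \<bar>R\<bar>" using b by simp
  have pt: "norm (\<phi> x) \<le> norm (\<phi> (x + ?y) - \<phi> x)" for x
  proof (cases "x \<in> K")
    case True
    then have "x \<in> ball 0 R" using K(2) R by blast
    then have x: "norm x < R" by simp
    have "norm ?y \<le> norm (x + ?y) + norm x"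
      using norm_triangle_ineq4[of "x + ?y" x] by simp
    then have "x + ?y \<notin> ball 0 R" using x ny by auto
    then have "x + ?y \<notin> K" using K(2) R by blast
    then have "\<phi> (x + ?y) = 0" by (rule K(3))
    then show ?thesis by simp
  qed (simp add: K(3))
  have "(\<integral>x. norm (\<phi> x) powr s \<partial>lborel) \<le> (\<integral>x. norm (\<phi> (x + ?y) - \<phi> x) powr s \<partial>lborel)"
    using s pt by (intro integral_mono' integrable_difference_powr powr_mono2) auto
  then have "pnorm lborel s \<phi> \<le> pnorm lborel s (\<lambda>x. \<phi> (x + ?y) - \<phi> x)"
    unfolding pnorm_def using s by (intro powr_mono2) auto
  also have "\<dots> \<le> 2 * \<bar>R\<bar> * pnorm lborel s (grad \<phi>)" using pnorm_difference_le[of ?y] unfolding ny .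
  finally show ?thesis .
qed

text \<open>
  One of \<open>\<bar>d\<bar>\<close> and \<open>\<bar>w\<bar>\<close> is at least \<open>a / 2\<close>.  The second term is linear in \<open>w\<close>, so that averaging over
  \<open>w\<close> costs only a norm in \<open>L\<^sup>1\<close>.
\<close>

lemma powr_le_difference_average:
  fixes a d w :: real
  assumes "0 \<le> a" "a \<le> \<bar>d\<bar> + \<bar>w\<bar>"
  shows "a powr s \<le> 2 powr s * \<bar>d\<bar> powr s + 2 * a powr (s - 1) * \<bar>w\<bar>"
proof (cases "\<bar>d\<bar> \<ge> a / 2")
  case True
  then have "a powr s \<le> (2 * \<bar>d\<bar>) powr s" using assms(1) s by (intro powr_mono2) auto
  also have "\<dots> = 2 powr s * \<bar>d\<bar> powr s" by (simp add: powr_mult)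
  finally have "a powr s \<le> 2 powr s * \<bar>d\<bar> powr s" .
  moreover have "0 \<le> 2 * a powr (s - 1) * \<bar>w\<bar>" by simp
  ultimately show ?thesis by linarith
next
  case False
  then have a: "a > 0" "a \<le> 2 * \<bar>w\<bar>" using assms by auto
  have "a powr s = a powr (s - 1) * a" using a powr_add[of a "s - 1" 1] by simp
  also have "\<dots> \<le> a powr (s - 1) * (2 * \<bar>w\<bar>)" using a by (intro mult_left_mono) auto
  finally have "a powr s \<le> 2 * a powr (s - 1) * \<bar>w\<bar>" by simp
  moreover have "0 \<le> 2 powr s * \<bar>d\<bar> powr s" by simp
  ultimately show ?thesis by linarith
qed

text \<open>
  Average the preceding inequality over \<open>a = \<bar>\<phi>(x)\<bar>\<close>, \<open>d = \<phi>(x + h) - \<phi>(x)\<close>, \<open>w = \<phi>(x + h)\<close> with \<open>\<bar>h\<bar> \<le> \<epsilon>\<close>.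
  The average of \<open>\<bar>w\<bar>\<close> is at most \<open>\<Lambda>\<close>; unless \<open>a \<le> 4 \<Lambda>\<close>, the resulting term \<open>2 a\<^sup>s\<^sup>-\<^sup>1 \<Lambda>\<close> is at most half
  of \<open>a\<^sup>s\<close> and is absorbed into the left-hand side.
\<close>

lemma powr_le_ball_average:
  fixes \<epsilon> :: real and x :: 'a
  assumes e: "\<epsilon> > 0"
  defines "\<beta> \<equiv> measure lborel (cball (0::'a) \<epsilon>)"
  defines "\<Lambda> \<equiv> pnorm lborel 1 \<phi> / \<beta>"
  shows "\<bar>\<phi> x\<bar> powr s \<le> 2 powr (s + 1) / \<beta> * (\<integral>h. indicator (cball 0 \<epsilon>) h * \<bar>\<phi> (x + h) - \<phi> x\<bar> powr s \<partial>lborel) + (4 * \<Lambda>) powr s"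
    and "integrable lborel (\<lambda>h. indicator (cball 0 \<epsilon>) h * \<bar>\<phi> (x + h) - \<phi> x\<bar> powr s)"
    and "\<beta> > 0"
proof -
  let ?B = "cball (0::'a) \<epsilon>"
  let ?I = "\<integral>h. indicator ?B h * \<bar>\<phi> (x + h) - \<phi> x\<bar> powr s \<partial>lborel"
  define a where "a = \<bar>\<phi> x\<bar>"
  show beta: "\<beta> > 0" unfolding \<beta>_def using e content_cball_pos[of \<epsilon> "0::'a"] by (simp add: measure_completion)
  have c: "continuous_on A (\<lambda>h. \<phi> (x + h))" for A
    by (rule continuous_on_compose2[OF test_function_continuous[OF \<phi>]]) (auto intro!: continuous_intros)
  show iI: "integrable lborel (\<lambda>h. indicator ?B h * \<bar>\<phi> (x + h) - \<phi> x\<bar> powr s)"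
  proof -
    have "continuous_on ?B (\<lambda>h. \<bar>\<phi> (x + h) - \<phi> x\<bar> powr s)"
      using s by (intro continuous_on_powr' continuous_intros c) auto
    from borel_integrable_compact[OF compact_cball this]
    show ?thesis by (simp only: real_scaleR_def)
  qed
  obtain K where K: "compact K" "\<And>x. x \<notin> K \<Longrightarrow> \<phi> x = 0"
    by (meson test_function_supportE \<phi>)
  have i1: "integrable lborel (\<lambda>h. \<bar>\<phi> h\<bar>)"
    using integrable_continuous_compact_support[OF test_function_continuous[OF \<phi>] K] by simp
  have i1': "integrable lborel (\<lambda>h. \<bar>\<phi> (x + h)\<bar>)"
    using integrable_lborel_translate[OF i1, of x] by (simp add: add.commute)
  have i1'': "integrable lborel (\<lambda>h. indicator ?B h * \<bar>\<phi> (x + h)\<bar>)"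
    using integrable_mult_indicator[OF _ i1', of ?B] by simp
  have iB: "integrable lborel (\<lambda>h. indicat_real ?B h)"
    using emeasure_compact_finite[of ?B] by (intro integrable_real_indicator) auto
  have "(\<integral>h. indicator ?B h * \<bar>\<phi> (x + h)\<bar> \<partial>lborel) \<le> (\<integral>h. \<bar>\<phi> (x + h)\<bar> \<partial>lborel)"
    by (intro integral_mono i1' i1'') (auto simp: indicator_def)
  also have "\<dots> = (\<integral>h. \<bar>\<phi> h\<bar> \<partial>lborel)"
    using integral_lborel_translate[of "\<lambda>h. \<bar>\<phi> h\<bar>" x] by (simp add: add.commute)
  also have "\<dots> = \<beta> * \<Lambda>" using beta by (simp add: \<Lambda>_def pnorm_def)
  finally have J: "(\<integral>h. indicator ?B h * \<bar>\<phi> (x + h)\<bar> \<partial>lborel) \<le> \<beta> * \<Lambda>" .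
  have "\<beta> * a powr s = (\<integral>h. indicator ?B h * a powr s \<partial>lborel)"
    by (simp add: \<beta>_def)
  also have "\<dots> \<le> (\<integral>h. 2 powr s * (indicator ?B h * \<bar>\<phi> (x + h) - \<phi> x\<bar> powr s) +
      2 * a powr (s - 1) * (indicator ?B h * \<bar>\<phi> (x + h)\<bar>) \<partial>lborel)"
  proof (rule integral_mono)
    show "integrable lborel (\<lambda>h. indicator ?B h * a powr s)" using iB by simp
    show "integrable lborel (\<lambda>h. 2 powr s * (indicator ?B h * \<bar>\<phi> (x + h) - \<phi> x\<bar> powr s) +
      2 * a powr (s - 1) * (indicator ?B h * \<bar>\<phi> (x + h)\<bar>))"
      using iI i1'' by (intro Bochner_Integration.integrable_add integrable_mult_right)
    show "indicator ?B h * a powr s \<le> 2 powr s * (indicator ?B h * \<bar>\<phi> (x + h) - \<phi> x\<bar> powr s) +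
      2 * a powr (s - 1) * (indicator ?B h * \<bar>\<phi> (x + h)\<bar>)" for h
      using powr_le_difference_average[of a "\<phi> (x + h) - \<phi> x" "\<phi> (x + h)"]
      by (cases "h \<in> ?B") (auto simp: a_def)
  qed
  also have "\<dots> = 2 powr s * ?I + 2 * a powr (s - 1) * (\<integral>h. indicator ?B h * \<bar>\<phi> (x + h)\<bar> \<partial>lborel)"
    using iI i1'' by simp
  also have "\<dots> \<le> 2 powr s * ?I + 2 * a powr (s - 1) * (\<beta> * \<Lambda>)"
    using J by (intro add_left_mono mult_left_mono) auto
  finally have main: "\<beta> * a powr s \<le> 2 powr s * ?I + 2 * a powr (s - 1) * (\<beta> * \<Lambda>)" .
  have I0: "?I \<ge> 0" by (intro Bochner_Integration.integral_nonneg) auto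
  have L0: "\<Lambda> \<ge> 0" using beta by (simp add: \<Lambda>_def pnorm_nonneg)
  show "\<bar>\<phi> x\<bar> powr s \<le> 2 powr (s + 1) / \<beta> * ?I + (4 * \<Lambda>) powr s"
  proof (cases "a \<le> 4 * \<Lambda>")
    case True
    then have "a powr s \<le> (4 * \<Lambda>) powr s" using s by (intro powr_mono2) (auto simp: a_def)
    moreover have "0 \<le> 2 powr (s + 1) / \<beta> * ?I" using I0 beta by (intro mult_nonneg_nonneg divide_nonneg_pos) auto
    ultimately show ?thesis unfolding a_def by linarith
  next
    case False
    then have a: "a > 0" using L0 by linarith
    have "2 * a powr (s - 1) * (\<beta> * \<Lambda>) \<le> 2 * a powr (s - 1) * (\<beta> * (a / 4))"
      using False beta by (intro mult_left_mono) auto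
    also have "\<dots> = \<beta> * a powr s / 2" using a powr_add[of a "s - 1" 1] by simp
    finally have "\<beta> * a powr s / 2 \<le> 2 powr s * ?I" using main by linarith
    then have "a powr s \<le> 2 powr (s + 1) / \<beta> * ?I"
      using beta by (simp add: powr_add field_simps)
    then show ?thesis unfolding a_def using powr_ge_zero[of "4 * \<Lambda>" s] by linarith
  qed
qed

text \<open>
  Integrate the pointwise bound over \<open>\<Omega>\<close> and exchange the integrals over \<open>x\<close> and \<open>h\<close>; the translation
  estimate bounds the integral over \<open>x\<close> for each \<open>\<bar>h\<bar> \<le> \<epsilon>\<close>.
\<close>

lemma Ehrling_test_function_powr:
  assumes e: "\<epsilon> > 0" and O: "\<Omega> \<in> sets borel" "emeasure lborel \<Omega> < \<infinity>"
  shows "pnorm lborel s \<phi> powr s \<le> 2 powr (s + 1) * (\<epsilon> * pnorm lborel s (grad \<phi>)) powr s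
     + measure lborel \<Omega> * (4 * (pnorm lborel 1 \<phi> / measure lborel (cball (0::'a) \<epsilon>))) powr s"
proof -
  let ?B = "cball (0::'a) \<epsilon>"
  define \<beta> where "\<beta> = measure lborel ?B"
  define \<Lambda> where "\<Lambda> = pnorm lborel 1 \<phi> / \<beta>"
  define G where "G = (\<epsilon> * pnorm lborel s (grad \<phi>)) powr s"
  let ?D = "\<lambda>x h. indicator ?B h * \<bar>\<phi> (x + h) - \<phi> x\<bar> powr s"
  note avg = powr_le_ball_average[OF e, folded \<beta>_def, folded \<Lambda>_def]
  obtain K where K: "compact K" "K \<subseteq> \<Omega>" "\<And>x. x \<notin> K \<Longrightarrow> \<phi> x = 0"
    by (meson test_function_supportE \<phi>)
  have beta: "\<beta> > 0" by (rule avg(3))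
  have c0: "0 \<le> 2 powr (s + 1) / \<beta>" using beta by simp
  have I0: "0 \<le> (\<integral>h. ?D x h \<partial>lborel)" for x by (intro Bochner_Integration.integral_nonneg) auto
  have pt: "ennreal (\<bar>\<phi> x\<bar> powr s) \<le> ennreal (2 powr (s + 1) / \<beta>) * (\<integral>\<^sup>+h. ennreal (?D x h) \<partial>lborel)
       + ennreal ((4 * \<Lambda>) powr s) * indicator \<Omega> x" for x
  proof (cases "x \<in> \<Omega>")
    case True
    have "(\<integral>\<^sup>+h. ennreal (?D x h) \<partial>lborel) = ennreal (\<integral>h. ?D x h \<partial>lborel)"
      by (rule nn_integral_eq_integral[OF avg(2)]) auto
    moreover have "ennreal (2 powr (s + 1) / \<beta>) * ennreal (\<integral>h. ?D x h \<partial>lborel) + ennreal ((4 * \<Lambda>) powr s)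
      = ennreal (2 powr (s + 1) / \<beta> * (\<integral>h. ?D x h \<partial>lborel) + (4 * \<Lambda>) powr s)"
      using c0 I0[of x] mult_nonneg_nonneg[OF c0 I0[of x]]
      by (simp only: ennreal_mult[symmetric] ennreal_plus[symmetric] powr_ge_zero)
    ultimately show ?thesis
      using True ennreal_leI[OF avg(1)[of x]] by simp
  next
    case False
    then have "\<phi> x = 0" using K by blast
    then show ?thesis using s by simp
  qed
  have col: "(\<integral>\<^sup>+x. ennreal (?D x h) \<partial>lborel) \<le> ennreal G * indicator ?B h" for h
  proof (cases "h \<in> ?B")
    case True
    have "(\<integral>\<^sup>+x. ennreal (\<bar>\<phi> (x + h) - \<phi> x\<bar> powr s) \<partial>lborel) = ennreal (pnorm lborel s (\<lambda>x. \<phi> (x + h) - \<phi> x) powr s)"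
      using integrable_difference_powr[of h] s by (subst nn_integral_eq_integral) (auto simp: pnorm_powr)
    also have "\<dots> \<le> ennreal G"
      unfolding G_def
    proof (intro ennreal_leI powr_mono2)
      have "pnorm lborel s (\<lambda>x. \<phi> (x + h) - \<phi> x) \<le> norm h * pnorm lborel s (grad \<phi>)" by (rule pnorm_difference_le)
      also have "\<dots> \<le> \<epsilon> * pnorm lborel s (grad \<phi>)" using True by (intro mult_right_mono) (auto simp: pnorm_nonneg)
      finally show "pnorm lborel s (\<lambda>x. \<phi> (x + h) - \<phi> x) \<le> \<epsilon> * pnorm lborel s (grad \<phi>)" .
    qed (use s in \<open>auto simp: pnorm_nonneg\<close>)
    finally show ?thesis using True by simp
  qed simp
  have ms: "case_prod (\<lambda>x h. ennreal (?D x h)) \<in> borel_measurable (lborel \<Otimes>\<^sub>M lborel)"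
  proof -
    have [measurable]: "?B \<in> sets borel" by simp
    have "(\<lambda>(x, h). ennreal (?D x h)) \<in> borel_measurable (borel \<Otimes>\<^sub>M borel)" by measurable
    then show ?thesis
      by (subst measurable_cong_sets[OF sets_pair_measure_cong[OF sets_lborel sets_lborel] refl])
  qed
  have "(\<integral>\<^sup>+x. (\<integral>\<^sup>+h. ennreal (?D x h) \<partial>lborel) \<partial>lborel) = (\<integral>\<^sup>+h. (\<integral>\<^sup>+x. ennreal (?D x h) \<partial>lborel) \<partial>lborel)"
    by (rule lborel_pair.Fubini'[OF ms, symmetric])
  also have "\<dots> \<le> (\<integral>\<^sup>+h. ennreal G * indicator ?B h \<partial>lborel)"
    by (intro nn_integral_mono col)
  also have "\<dots> = ennreal G * emeasure lborel ?B" by (simp add: nn_integral_cmult_indicator)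
  also have "emeasure lborel ?B = ennreal \<beta>"
    unfolding \<beta>_def using emeasure_compact_finite[of ?B] by (intro emeasure_eq_ennreal_measure) (auto simp: top.not_eq_extremum)
  finally have dbl: "(\<integral>\<^sup>+x. (\<integral>\<^sup>+h. ennreal (?D x h) \<partial>lborel) \<partial>lborel) \<le> ennreal G * ennreal \<beta>" .
  have "ennreal (pnorm lborel s \<phi> powr s) = (\<integral>\<^sup>+x. ennreal (\<bar>\<phi> x\<bar> powr s) \<partial>lborel)"
    using test_function_powr_integrable[OF test_function_continuous[OF \<phi>] K(1,3), of s] s
    by (subst nn_integral_eq_integral) (auto simp: pnorm_powr)
  also have "\<dots> \<le> (\<integral>\<^sup>+x. ennreal (2 powr (s + 1) / \<beta>) * (\<integral>\<^sup>+h. ennreal (?D x h) \<partial>lborel)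
       + ennreal ((4 * \<Lambda>) powr s) * indicator \<Omega> x \<partial>lborel)"
    by (intro nn_integral_mono pt)
  also have "\<dots> = ennreal (2 powr (s + 1) / \<beta>) * (\<integral>\<^sup>+x. (\<integral>\<^sup>+h. ennreal (?D x h) \<partial>lborel) \<partial>lborel)
       + ennreal ((4 * \<Lambda>) powr s) * emeasure lborel \<Omega>"
    using O ms by (subst nn_integral_add) (auto simp: nn_integral_cmult nn_integral_cmult_indicator)
  also have "\<dots> \<le> ennreal (2 powr (s + 1) / \<beta>) * (ennreal G * ennreal \<beta>) + ennreal ((4 * \<Lambda>) powr s) * ennreal (measure lborel \<Omega>)"
    using O by (intro add_mono mult_left_mono dbl) (auto simp: emeasure_eq_ennreal_measure)
  also have "\<dots> = ennreal (2 powr (s + 1) / \<beta> * (G * \<beta>) + (4 * \<Lambda>) powr s * measure lborel \<Omega>)"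
    using beta c0 by (simp add: G_def flip: ennreal_mult ennreal_plus)
  also have "2 powr (s + 1) / \<beta> * (G * \<beta>) = 2 powr (s + 1) * G" using beta by simp
  finally have "pnorm lborel s \<phi> powr s \<le> 2 powr (s + 1) * G + (4 * \<Lambda>) powr s * measure lborel \<Omega>"
    by (subst (asm) ennreal_le_iff) (auto simp: G_def)
  then show ?thesis by (simp add: G_def \<Lambda>_def \<beta>_def mult.commute)
qed

end

lemma powr_add_le_add_powr:
  fixes a b s :: real
  assumes "s \<ge> 1" "a \<ge> 0" "b \<ge> 0"
  shows "a powr s + b powr s \<le> (a + b) powr s"
proof (cases "a + b = 0")
  case False
  have p: "x powr s = x * x powr (s - 1)" if "x \<ge> 0" for x :: real
    using that powr_add[of x 1 "s - 1"] by (cases "x = 0") auto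
  have "a powr s + b powr s = a * a powr (s - 1) + b * b powr (s - 1)" using assms by (simp add: p)
  also have "\<dots> \<le> a * (a + b) powr (s - 1) + b * (a + b) powr (s - 1)"
    using assms by (intro add_mono mult_left_mono powr_mono2) auto
  also have "\<dots> = (a + b) powr s" using assms by (simp add: p distrib_right)
  finally show ?thesis .
next
  case True
  then have "a = 0" "b = 0" using assms by auto
  then show ?thesis by simp
qed

context bounded_open_set
begin

text \<open>
  Every term is continuous for the norm of \<open>W\<^sup>1\<^sup>,\<^sup>q\<close>, the norm of \<open>L\<^sup>r\<close> because \<open>\<Omega>\<close> has finite measure.
  The Poincare inequality is the case \<open>b = 0\<close>, Ehrling's inequality the case of small \<open>a\<close>.
\<close>

lemma W01_inequality_from_test_functions:
  assumes "1 \<le> r" "r \<le> q" "0 \<le> a" "0 \<le> b"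
    and test: "\<And>\<phi>. \<phi> \<in> test_functions \<Omega> \<Longrightarrow>
       Lp_norm \<Omega> q (abs_aefun \<phi>) \<le> a * grad_norm q (abs_aefun \<phi>) + b * Lp_norm \<Omega> r (abs_aefun \<phi>)"
    and u: "u \<in> W01 \<Omega> q"
  shows "Lp_norm \<Omega> q u \<le> a * grad_norm q u + b * Lp_norm \<Omega> r u"
proof (rule field_le_epsilon)
  fix \<eta> :: real assume "\<eta> > 0"
  define c where "c = (measure lebesgue \<Omega> + 1) powr (1 / r)"
  have c: "c \<ge> 0" by (simp add: c_def)
  define e where "e = \<eta> / (a + b * c + 1)"
  have den: "a + b * c + 1 > 0" using assms c by (intro add_nonneg_pos add_nonneg_nonneg) auto
  have e: "e > 0" using \<open>\<eta> > 0\<close> den by (simp add: e_def)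
  obtain \<phi> where \<phi>: "\<phi> \<in> test_functions \<Omega>" "Lp_norm \<Omega> q (u - abs_aefun \<phi>) + grad_norm q (u - abs_aefun \<phi>) < e"
    by (rule W01_approx[OF u e])
  define w where "w = abs_aefun \<phi>"
  define v where "v = u - w"
  have q: "q \<ge> 1" using assms by simp
  have W: "u \<in> W1 \<Omega> q" "w \<in> W1 \<Omega> q" "v \<in> W1 \<Omega> q"
    using W01D[OF u] test_function_weak_gradient(2)[OF \<phi>(1), of q] q
    by (auto simp: w_def v_def intro!: W1_diff)
  have v: "Lp_norm \<Omega> q v \<le> e" "grad_norm q v \<le> e"
    using \<phi>(2) grad_norm_nonneg[of q v] Lp_norm_nonneg[of q v] by (auto simp: v_def w_def)
  have u_eq: "u = w + v" and w_eq: "w = u + (-1) *\<^sub>R v" by (simp_all add: v_def)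
  have m: "(-1) *\<^sub>R v \<in> W1 \<Omega> q" using W(3) q by (intro W1_scaleR) auto
  have gw: "grad_norm q w \<le> grad_norm q u + e"
  proof -
    have "grad_norm q w \<le> grad_norm q u + grad_norm q ((-1) *\<^sub>R v)"
      by (subst w_eq) (rule grad_norm_add[OF q W(1) m])
    also have "grad_norm q ((-1) *\<^sub>R v) = grad_norm q v" using grad_norm_scaleR[of q v "-1"] W(3) q by simp
    finally show ?thesis using v by simp
  qed
  have Lr: "u \<in> Lp \<Omega> r" "v \<in> Lp \<Omega> r" "(-1) *\<^sub>R v \<in> Lp \<Omega> r"
    using W W1D m assms by (auto intro!: Lp_mono_exponent[of r q])
  have "Lp_norm \<Omega> r v \<le> c * Lp_norm \<Omega> q v"
    unfolding c_def using assms W by (intro Lp_norm_mono_exponent W1D) auto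
  also have "\<dots> \<le> c * e" using v c by (intro mult_left_mono)
  finally have rv: "Lp_norm \<Omega> r v \<le> c * e" .
  have rw: "Lp_norm \<Omega> r w \<le> Lp_norm \<Omega> r u + c * e"
  proof -
    have "Lp_norm \<Omega> r w \<le> Lp_norm \<Omega> r u + Lp_norm \<Omega> r ((-1) *\<^sub>R v)"
      by (subst w_eq) (rule Lp_norm_add[OF assms(1) Lr(1,3)])
    also have "Lp_norm \<Omega> r ((-1) *\<^sub>R v) = Lp_norm \<Omega> r v" using Lp_norm_scaleR[of r "-1" v] assms(1) by simp
    finally show ?thesis using rv by simp
  qed
  have "Lp_norm \<Omega> q u \<le> Lp_norm \<Omega> q w + Lp_norm \<Omega> q v"
    unfolding u_eq using W q by (intro Lp_norm_add W1D)
  also have "\<dots> \<le> (a * grad_norm q w + b * Lp_norm \<Omega> r w) + e"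
    using test[OF \<phi>(1)] v by (simp add: w_def)
  also have "\<dots> \<le> (a * (grad_norm q u + e) + b * (Lp_norm \<Omega> r u + c * e)) + e"
    using gw rw assms by (intro add_right_mono add_mono mult_left_mono)
  also have "\<dots> = a * grad_norm q u + b * Lp_norm \<Omega> r u + e * (a + b * c + 1)" by (simp add: algebra_simps)
  also have "e * (a + b * c + 1) = \<eta>" using den by (simp add: e_def)
  finally show "Lp_norm \<Omega> q u \<le> a * grad_norm q u + b * Lp_norm \<Omega> r u + \<eta>" .
qed

lemma Poincare:
  assumes "s \<ge> 1"
  obtains C where "C \<ge> 0" "\<And>u. u \<in> W01 \<Omega> s \<Longrightarrow> Lp_norm \<Omega> s u \<le> C * grad_norm s u"
proof -
  obtain R where R: "\<Omega> \<subseteq> ball 0 R" using bounded_Omega bounded_subset_ballD by blast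
  have "Lp_norm \<Omega> s u \<le> (2 * \<bar>R\<bar>) * grad_norm s u" if u: "u \<in> W01 \<Omega> s" for u
  proof -
    have "Lp_norm \<Omega> s u \<le> (2 * \<bar>R\<bar>) * grad_norm s u + 0 * Lp_norm \<Omega> s u"
    proof (rule W01_inequality_from_test_functions[OF _ _ _ _ _ u])
      fix \<phi> assume \<phi>: "\<phi> \<in> test_functions \<Omega>"
      show "Lp_norm \<Omega> s (abs_aefun \<phi>) \<le> 2 * \<bar>R\<bar> * grad_norm s (abs_aefun \<phi>) + 0 * Lp_norm \<Omega> s (abs_aefun \<phi>)"
        using Poincare_test_function[OF \<phi> assms R] test_function_weak_gradient(4,5)[OF \<phi>, of s] assms by simp
    qed (use assms in auto)
    then show ?thesis by simp
  qed
  then show thesis by (intro that[of "2 * \<bar>R\<bar>"]) auto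
qed

text \<open>
  The radius \<open>\<epsilon>\<close> of the ball in the averaged estimate is chosen so that the factor of the gradient term
  becomes \<open>\<delta>\<close>; the norm in \<open>L\<^sup>1\<close> is controlled by the one in \<open>L\<^sup>r\<close>.
\<close>

lemma Ehrling:
  assumes "1 \<le> r" "r \<le> q" "\<delta> > 0"
  obtains C where "C \<ge> 0" "\<And>u. u \<in> W01 \<Omega> q \<Longrightarrow> Lp_norm \<Omega> q u \<le> \<delta> * grad_norm q u + C * Lp_norm \<Omega> r u"
proof -
  have q: "q \<ge> 1" using assms by simp
  define \<kappa> where "\<kappa> = (2::real) powr ((q + 1) / q)"
  define \<epsilon> where "\<epsilon> = \<delta> / \<kappa>"
  have kappa: "\<kappa> > 0" "\<kappa> powr q = 2 powr (q + 1)" using q by (auto simp: \<kappa>_def powr_powr)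
  have eps: "\<epsilon> > 0" "\<kappa> * \<epsilon> = \<delta>" using kappa assms by (auto simp: \<epsilon>_def)
  define \<beta> where "\<beta> = measure lborel (cball (0::'a) \<epsilon>)"
  have O: "\<Omega> \<in> sets borel" "emeasure lborel \<Omega> < \<infinity>"
    using emeasure_bounded_finite[OF bounded_Omega] by (auto simp: top.not_eq_extremum)
  define V where "V = measure lborel \<Omega>"
  define C where "C = V powr (1 / q) * 4 * ((measure lebesgue \<Omega> + 1) / \<beta>)"
  have V: "V \<ge> 0" by (simp add: V_def)
  have "Lp_norm \<Omega> q (abs_aefun \<phi>) \<le> \<delta> * grad_norm q (abs_aefun \<phi>) + C * Lp_norm \<Omega> r (abs_aefun \<phi>)"
    if \<phi>: "\<phi> \<in> test_functions \<Omega>" for \<phi>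
  proof -
    let ?g = "pnorm lborel q (grad \<phi>)" and ?l = "4 * (pnorm lborel 1 \<phi> / \<beta>)"
    have beta: "\<beta> > 0" unfolding \<beta>_def by (rule powr_le_ball_average(3)[OF \<phi> q eps(1)])
    have l0: "0 \<le> ?l" using beta by (simp add: pnorm_nonneg)
    have "pnorm lborel q \<phi> powr q \<le> \<kappa> powr q * (\<epsilon> * ?g) powr q + (V powr (1 / q)) powr q * ?l powr q"
      using Ehrling_test_function_powr[OF \<phi> q eps(1) O] q V kappa by (simp add: \<beta>_def V_def powr_powr)
    also have "\<dots> = (\<kappa> * (\<epsilon> * ?g)) powr q + (V powr (1 / q) * ?l) powr q"
      by (simp only: powr_mult)
    also have "\<dots> \<le> (\<kappa> * (\<epsilon> * ?g) + V powr (1 / q) * ?l) powr q"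
      using kappa eps l0 by (intro powr_add_le_add_powr q mult_nonneg_nonneg) (auto simp: pnorm_nonneg)
    finally have pw: "pnorm lborel q \<phi> powr q \<le> (\<kappa> * (\<epsilon> * ?g) + V powr (1 / q) * ?l) powr q" .
    have "0 \<le> \<kappa> * (\<epsilon> * ?g) + V powr (1 / q) * ?l"
      using kappa eps l0 by (intro add_nonneg_nonneg mult_nonneg_nonneg) (auto simp: pnorm_nonneg)
    with pw q have "pnorm lborel q \<phi> \<le> \<kappa> * (\<epsilon> * ?g) + V powr (1 / q) * ?l"
      by (auto intro: powr_le_powr_imp_le[of _ q])
    also have "\<dots> = \<delta> * ?g + V powr (1 / q) * ?l" using eps(2) by (simp flip: mult.assoc)
    also have "V powr (1 / q) * ?l \<le> C * Lp_norm \<Omega> r (abs_aefun \<phi>)"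
    proof -
      have "pnorm lborel 1 \<phi> = Lp_norm \<Omega> 1 (abs_aefun \<phi>)"
        using test_function_weak_gradient(4)[OF \<phi>, of 1] by simp
      also have "\<dots> \<le> (measure lebesgue \<Omega> + 1) powr (1 / 1) * Lp_norm \<Omega> r (abs_aefun \<phi>)"
        using assms test_function_weak_gradient(2)[OF \<phi>, of r] by (intro Lp_norm_mono_exponent W1D) auto
      finally have *: "pnorm lborel 1 \<phi> \<le> (measure lebesgue \<Omega> + 1) * Lp_norm \<Omega> r (abs_aefun \<phi>)" by simp
      have "V powr (1 / q) * ?l = V powr (1 / q) * 4 / \<beta> * pnorm lborel 1 \<phi>" by simp
      also have "\<dots> \<le> V powr (1 / q) * 4 / \<beta> * ((measure lebesgue \<Omega> + 1) * Lp_norm \<Omega> r (abs_aefun \<phi>))"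
        using * beta by (intro mult_left_mono) auto
      finally show ?thesis by (simp add: C_def)
    qed
    finally show ?thesis
      using test_function_weak_gradient(4,5)[OF \<phi>, of q] q by simp
  qed
  note test = this
  show thesis
  proof (rule that)
    show C: "C \<ge> 0" by (simp add: C_def \<beta>_def)
    show "Lp_norm \<Omega> q u \<le> \<delta> * grad_norm q u + C * Lp_norm \<Omega> r u" if "u \<in> W01 \<Omega> q" for u
      by (rule W01_inequality_from_test_functions[OF assms(1,2) _ C test that]) (use assms(3) in simp)
  qed
qed

end

section \<open>Genus and continuous odd maps\<close>

lemma (in Metric_space) continuous_map_if_Lipschitz:
  assumes "Metric_space M' d'" "\<And>x. x \<in> M \<Longrightarrow> f x \<in> M'"
    and L: "\<And>x y. x \<in> M \<Longrightarrow> y \<in> M \<Longrightarrow> d' (f x) (f y) \<le> L * d x y"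
  shows "continuous_map mtopology (Metric_space.mtopology M' d') f"
proof -
  interpret N: Metric_space M' d' by fact
  have "\<exists>U. openin mtopology U \<and> x \<in> U \<and> (\<forall>y\<in>U. f y \<in> N.mball (f x) \<epsilon>)" if x: "x \<in> M" and e: "\<epsilon> > 0" for x \<epsilon>
  proof (intro exI conjI ballI)
    have e': "0 < \<epsilon> / (\<bar>L\<bar> + 1)" using e by (intro divide_pos_pos) auto
    then show "x \<in> mball x (\<epsilon> / (\<bar>L\<bar> + 1))" using x by simp
    fix y assume y: "y \<in> mball x (\<epsilon> / (\<bar>L\<bar> + 1))"
    then have "d' (f x) (f y) \<le> L * d x y" using x L by simp
    also have "\<dots> \<le> \<bar>L\<bar> * d x y" by (intro mult_right_mono) auto
    also have "\<dots> \<le> \<bar>L\<bar> * (\<epsilon> / (\<bar>L\<bar> + 1))" using y by (intro mult_left_mono) auto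
    also have "\<dots> < \<epsilon>" using e by (simp add: field_simps)
    finally show "f y \<in> N.mball (f x) \<epsilon>" using x y assms(2) by simp
  qed (rule openin_mball)
  then show ?thesis unfolding N.continuous_map_to_metric by simp
qed

lemma (in Metric_space) continuous_map_real_if_Lipschitz:
  fixes f :: "'a \<Rightarrow> real"
  assumes "\<And>x y. x \<in> M \<Longrightarrow> y \<in> M \<Longrightarrow> \<bar>f x - f y\<bar> \<le> L * d x y"
  shows "continuous_map mtopology euclideanreal f"
  using continuous_map_if_Lipschitz[of UNIV dist f L] assms Met_TC.Metric_space_axioms
  by (simp add: dist_real_def)

text \<open>
  Every odd map from \<open>B\<close> into a punctured Euclidean space can be composed with \<open>f\<close>, so \<open>A\<close> admits all
  the dimensions that \<open>B\<close> admits.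
\<close>

lemma genus_le_genus_of_odd_map:
  assumes f: "continuous_map (subtopology X A) (subtopology Y B) f" and AB: "f ` A \<subseteq> B"
    and odd: "\<And>u. u \<in> A \<Longrightarrow> f (- u) = - f u"
  shows "genus X A \<le> genus Y B"
proof (cases "A = {}")
  case True
  then show ?thesis by (simp add: genus_def)
next
  case False
  then have "B \<noteq> {}" using AB by auto
  let ?E = "\<lambda>k. subtopology (Euclidean_space k) (topspace (Euclidean_space k) - {\<lambda>_. 0})"
  have "{enat k |k. \<exists>h. continuous_map (subtopology Y B) (?E k) h \<and> (\<forall>u\<in>B. h (- u) = (\<lambda>i. - h u i))}
     \<subseteq> {enat k |k. \<exists>h. continuous_map (subtopology X A) (?E k) h \<and> (\<forall>u\<in>A. h (- u) = (\<lambda>i. - h u i))}"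
  proof clarify
    fix k h assume h: "continuous_map (subtopology Y B) (?E k) h" "\<forall>u\<in>B. h (- u) = (\<lambda>i. - h u i)"
    have "continuous_map (subtopology X A) (?E k) (h \<circ> f)" by (rule continuous_map_compose[OF f h(1)])
    moreover have "\<forall>u\<in>A. (h \<circ> f) (- u) = (\<lambda>i. - (h \<circ> f) u i)" using h(2) odd AB by auto
    ultimately show "\<exists>k'. enat k = enat k' \<and>
       (\<exists>h. continuous_map (subtopology X A) (?E k') h \<and> (\<forall>u\<in>A. h (- u) = (\<lambda>i. - h u i)))" by blast
  qed
  then show ?thesis using False \<open>B \<noteq> {}\<close> unfolding genus_def by (simp add: Inf_superset_mono)
qed

context bounded_open_set
begin

section \<open>Finite-dimensional approximation of compact sets\<close>

lemma Lp_norm_sum_le: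
  fixes w :: "'i \<Rightarrow> ('a, 'b::euclidean_space) aefun"
  assumes s: "s \<ge> 1" and "finite I" "\<And>i. i \<in> I \<Longrightarrow> w i \<in> Lp \<Omega> s" "\<And>i. i \<in> I \<Longrightarrow> c i \<ge> 0"
  shows "(\<Sum>i\<in>I. c i *\<^sub>R w i) \<in> Lp \<Omega> s \<and> Lp_norm \<Omega> s (\<Sum>i\<in>I. c i *\<^sub>R w i) \<le> (\<Sum>i\<in>I. c i * Lp_norm \<Omega> s (w i))"
  using assms(2-4)
proof (induction I rule: finite_induct)
  case empty
  have "(0 :: ('a, 'b) aefun) \<in> Lp \<Omega> s"
  proof -
    have "AE x in lebesgue_on \<Omega>. 0 = norm (rep_aefun (0 :: ('a, 'b) aefun) x) powr s"
      using AE_on_Omega[OF rep_aefun_zero_AE[where 'b='b]] by (rule eventually_mono) simp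
    then have "integrable (lebesgue_on \<Omega>) (\<lambda>x. norm (rep_aefun (0 :: ('a, 'b) aefun) x) powr s)"
      by (rule integrable_cong_AE_imp[OF integrable_zero, rotated]) measurable
    moreover have "(0 :: ('a, 'b) aefun) \<in> functions_on \<Omega>"
      unfolding functions_on_def mem_Collect_eq using rep_aefun_zero_AE[where 'a='a and 'b='b] by (rule eventually_mono) simp
    ultimately show ?thesis by (simp add: Lp_def)
  qed
  then show ?case using s by (simp add: Lp_norm_zero)
next
  case (insert i I)
  then have I: "(\<Sum>i\<in>I. c i *\<^sub>R w i) \<in> Lp \<Omega> s"
      "Lp_norm \<Omega> s (\<Sum>i\<in>I. c i *\<^sub>R w i) \<le> (\<Sum>i\<in>I. c i * Lp_norm \<Omega> s (w i))"
    and i: "c i *\<^sub>R w i \<in> Lp \<Omega> s" "Lp_norm \<Omega> s (c i *\<^sub>R w i) = c i * Lp_norm \<Omega> s (w i)"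
    using s by (auto simp: Lp_scaleR Lp_norm_scaleR)
  show ?case using insert(1,2) Lp_add[OF s i(1) I(1)] Lp_norm_add[OF s i(1) I(1)] I(2) i(2) by simp
qed

lemma W1_sum_weak_grad:
  assumes s: "s \<ge> 1" and "finite I" "I \<noteq> {}" "\<And>i. i \<in> I \<Longrightarrow> w i \<in> W1 \<Omega> s"
  shows "(\<Sum>i\<in>I. c i *\<^sub>R w i) \<in> W1 \<Omega> s \<and> weak_grad \<Omega> (\<Sum>i\<in>I. c i *\<^sub>R w i) = (\<Sum>i\<in>I. c i *\<^sub>R weak_grad \<Omega> (w i))"
  using assms(2-4)
proof (induction I rule: finite_ne_induct)
  case (singleton i)
  then show ?case using s by (simp add: W1_scaleR weak_grad_scaleR)
next
  case (insert i I)
  have w: "w i \<in> W1 \<Omega> s" using insert.prems by simp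
  have i: "c i *\<^sub>R w i \<in> W1 \<Omega> s" "weak_grad \<Omega> (c i *\<^sub>R w i) = c i *\<^sub>R weak_grad \<Omega> (w i)"
    using s W1_scaleR[OF s w] weak_grad_scaleR[OF w] by auto
  have I: "(\<Sum>i\<in>I. c i *\<^sub>R w i) \<in> W1 \<Omega> s"
    "weak_grad \<Omega> (\<Sum>i\<in>I. c i *\<^sub>R w i) = (\<Sum>i\<in>I. c i *\<^sub>R weak_grad \<Omega> (w i))"
    using insert.IH insert.prems by auto
  show ?case using insert.hyps W1_add[OF s i(1) I(1)] weak_grad_add[OF i(1) I(1)] i(2) I(2) by simp
qed

lemma grad_norm_sum_le:
  assumes s: "s \<ge> 1" and I: "finite I" "I \<noteq> {}" "\<And>i. i \<in> I \<Longrightarrow> w i \<in> W1 \<Omega> s" and c: "\<And>i. i \<in> I \<Longrightarrow> c i \<ge> 0"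
  shows "grad_norm s (\<Sum>i\<in>I. c i *\<^sub>R w i) \<le> (\<Sum>i\<in>I. c i * grad_norm s (w i))"
  using W1_sum_weak_grad[OF s I, where c=c] Lp_norm_sum_le[OF s I(1), where w="\<lambda>i. weak_grad \<Omega> (w i)" and c=c] c W1D(2)[OF I(3)]
  by (simp add: grad_norm_def)

text \<open>
  A metric has to be symmetric for arbitrary arguments, so classes without a weak gradient matter as
  well: for such \<open>w\<close> the definite descriptions of the gradients of \<open>w\<close> and \<open>- w\<close> both denote the same
  unspecified object.
\<close>

lemma grad_norm_uminus:
  assumes s: "s > 0" shows "grad_norm s (- w) = grad_norm s w"
proof (cases "\<exists>g. is_weak_gradient \<Omega> w g")
  case True
  then obtain g where g: "is_weak_gradient \<Omega> w g" ..
  then have "is_weak_gradient \<Omega> (- w) (- g)" using is_weak_gradient_scaleR[of w g "-1"] by simp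
  then show ?thesis using g Lp_norm_scaleR[OF s, of "-1" g] by (simp add: grad_norm_def weak_grad_eqI)
next
  case False
  then have "\<not> is_weak_gradient \<Omega> (- w) g" for g
    using is_weak_gradient_scaleR[of "- w" g "-1"] by auto
  with False show ?thesis by (simp add: grad_norm_def weak_grad_def)
qed

lemma Metric_space_W01:
  assumes s: "s \<ge> 1" shows "Metric_space (W01 \<Omega> s) (\<lambda>u v. grad_norm s (u - v))"
proof
  show "0 \<le> grad_norm s (u - v)" for u v by (rule grad_norm_nonneg)
  show "grad_norm s (u - v) = grad_norm s (v - u)" for u v
    using grad_norm_uminus[of s "u - v"] s by simp
  obtain C where C: "C \<ge> 0" "\<And>u. u \<in> W01 \<Omega> s \<Longrightarrow> Lp_norm \<Omega> s u \<le> C * grad_norm s u"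
    using Poincare[OF s] by blast
  show "grad_norm s (u - v) = 0 \<longleftrightarrow> u = v" if "u \<in> W01 \<Omega> s" "v \<in> W01 \<Omega> s" for u v
  proof
    assume 0: "grad_norm s (u - v) = 0"
    have w: "u - v \<in> W01 \<Omega> s" using that s by (intro W01_diff)
    then have "Lp_norm \<Omega> s (u - v) = 0" using C(2)[OF w] 0 Lp_norm_nonneg[of s "u - v"] by simp
    then have "u - v = 0" using Lp_norm_eq_0 W1D(1)[OF W01D[OF w]] by blast
    then show "u = v" by simp
  next
    assume "u = v"
    then show "grad_norm s (u - v) = 0"
      using grad_norm_scaleR[of s u 0] W01D[OF that(1)] s by simp
  qed
  show "grad_norm s (u - w) \<le> grad_norm s (u - v) + grad_norm s (v - w)"
    if "u \<in> W01 \<Omega> s" "v \<in> W01 \<Omega> s" "w \<in> W01 \<Omega> s" for u v w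
    using grad_norm_add[OF s W01D[OF W01_diff[OF s that(1,2)]] W01D[OF W01_diff[OF s that(2,3)]]] by simp
qed

lemma W01_topology_eq: "W01_topology \<Omega> s = Metric_space.mtopology (W01 \<Omega> s) (\<lambda>u v. grad_norm s (u - v))"
  by (simp add: W01_topology_def grad_norm_def)

lemma rayleigh_eq: "rayleigh \<Omega> q u = grad_norm q u powr q / Lp_norm \<Omega> q u powr q"
  by (simp add: rayleigh_def grad_norm_def)

lemma compact_W01_Lp_bounds:
  assumes r: "r \<ge> 1" and A: "compactin (W01_topology \<Omega> r) A" "A \<noteq> {}" "0 \<notin> A"
  obtains a b where "a > 0" "\<And>u. u \<in> A \<Longrightarrow> a \<le> Lp_norm \<Omega> r u \<and> Lp_norm \<Omega> r u \<le> b"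
proof -
  interpret R: Metric_space "W01 \<Omega> r" "\<lambda>u v. grad_norm r (u - v)" by (rule Metric_space_W01[OF r])
  obtain C where C: "C \<ge> 0" "\<And>u. u \<in> W01 \<Omega> r \<Longrightarrow> Lp_norm \<Omega> r u \<le> C * grad_norm r u"
    using Poincare[OF r] by blast
  have cA: "compactin R.mtopology A" using A(1) by (simp add: W01_topology_eq)
  then have sub: "A \<subseteq> W01 \<Omega> r" using compactin_subset_topspace by fastforce
  have le: "Lp_norm \<Omega> r u - Lp_norm \<Omega> r v \<le> C * grad_norm r (u - v)" if "u \<in> W01 \<Omega> r" "v \<in> W01 \<Omega> r" for u v
    using Lp_norm_add[OF r W1D(1)[OF W01D[OF W01_diff[OF r that]]] W1D(1)[OF W01D[OF that(2)]]] C(2)[OF W01_diff[OF r that]] by simp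
  have "continuous_map R.mtopology euclideanreal (\<lambda>u. Lp_norm \<Omega> r u)"
  proof (rule R.continuous_map_real_if_Lipschitz[where L=C])
    show "\<bar>Lp_norm \<Omega> r u - Lp_norm \<Omega> r v\<bar> \<le> C * grad_norm r (u - v)" if "u \<in> W01 \<Omega> r" "v \<in> W01 \<Omega> r" for u v
      using le[OF that] le[OF that(2,1)] R.commute[of u v] by (simp add: abs_le_iff)
  qed
  from image_compactin[OF cA this] have cI: "compact (Lp_norm \<Omega> r ` A)" by simp
  obtain x where x: "x \<in> A" "\<And>u. u \<in> A \<Longrightarrow> Lp_norm \<Omega> r x \<le> Lp_norm \<Omega> r u"
    using compact_attains_inf[OF cI] A(2) by auto
  obtain t where "\<forall>t'\<in>Lp_norm \<Omega> r ` A. t' \<le> t"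
    using compact_attains_sup[OF cI] A(2) by blast
  then have y: "\<And>u. u \<in> A \<Longrightarrow> Lp_norm \<Omega> r u \<le> t" by blast
  have "Lp_norm \<Omega> r x \<noteq> 0" using Lp_norm_eq_0 W1D(1)[OF W01D] sub x(1) A(3) by blast
  then have "Lp_norm \<Omega> r x > 0" using Lp_norm_nonneg[of r x] by simp
  then show thesis using that x(2) y by blast
qed

text \<open>
  The constants are chosen in this order.  The compact set \<open>A\<close> is bounded and bounded away from zero in
  \<open>L\<^sup>r\<close>, hence by Ehrling's inequality \<open>\<tau> \<le> \<parallel>u\<parallel>\<^sub>q \<le> \<kappa>\<close> on \<open>A\<close>.  Then \<open>\<delta> = \<theta> \<tau>\<close> is the admissible error
  in \<open>L\<^sup>q\<close>, and \<open>\<rho>\<close> is the radius for \<open>d\<^sub>r\<close> that guarantees it.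
\<close>

lemma finite_dimensional_approximation:
  assumes r: "1 \<le> r" "r \<le> q" and sub: "A \<subseteq> W01 \<Omega> q" and sym: "uminus ` A = A"
    and A: "compactin (W01_topology \<Omega> r) A" "A \<noteq> {}" "0 \<notin> A"
    and mu: "0 \<le> \<mu>" "\<And>u. u \<in> A \<Longrightarrow> grad_norm q u \<le> \<mu> * Lp_norm \<Omega> q u"
    and th: "0 < \<theta>"
  obtains P where "continuous_map (subtopology (W01_topology \<Omega> r) A) (W01_topology \<Omega> q) P"
    "\<And>u. u \<in> A \<Longrightarrow> P (- u) = - P u"
    "\<And>u. u \<in> A \<Longrightarrow> grad_norm q (P u) \<le> \<mu> * ((1 + \<theta>) * Lp_norm \<Omega> q u)"
    "\<And>u. u \<in> A \<Longrightarrow> (1 - \<theta>) * Lp_norm \<Omega> q u \<le> Lp_norm \<Omega> q (P u)"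
    "\<And>u. u \<in> A \<Longrightarrow> 0 < Lp_norm \<Omega> q u"
proof -
  have q: "q \<ge> 1" using r by simp
  interpret R: Metric_space "W01 \<Omega> r" "\<lambda>u v. grad_norm r (u - v)" by (rule Metric_space_W01[OF r(1)])
  interpret Q: Metric_space "W01 \<Omega> q" "\<lambda>u v. grad_norm q (u - v)" by (rule Metric_space_W01[OF q])
  have cA: "compactin R.mtopology A" using A(1) by (simp add: W01_topology_eq)
  then have subr: "A \<subseteq> W01 \<Omega> r" using compactin_subset_topspace by fastforce
  have Lq: "u \<in> Lp \<Omega> q" "u \<in> W1 \<Omega> q" if "u \<in> A" for u using that sub W01D W1D by blast+
  obtain a b where ab: "a > 0" "\<And>u. u \<in> A \<Longrightarrow> a \<le> Lp_norm \<Omega> r u" "\<And>u. u \<in> A \<Longrightarrow> Lp_norm \<Omega> r u \<le> b"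
    using compact_W01_Lp_bounds[OF r(1) A] by metis
  define c where "c = (measure lebesgue \<Omega> + 1) powr (1 / r)"
  have "measure lebesgue \<Omega> + 1 > 0" using measure_nonneg[of lebesgue \<Omega>] by linarith
  then have c: "c > 0" by (simp add: c_def)
  define \<tau> where "\<tau> = a / c"
  have tau: "\<tau> > 0" using ab(1) c by (simp add: \<tau>_def)
  have tau_le: "\<tau> \<le> Lp_norm \<Omega> q u" if u: "u \<in> A" for u
  proof -
    have "Lp_norm \<Omega> r u \<le> c * Lp_norm \<Omega> q u"
      unfolding c_def using r by (intro Lp_norm_mono_exponent Lq u) auto
    then show ?thesis using ab(2)[OF u] c by (simp add: \<tau>_def divide_le_eq mult.commute)
  qed
  obtain C1 where C1: "C1 \<ge> 0" "\<And>u. u \<in> W01 \<Omega> q \<Longrightarrow> Lp_norm \<Omega> q u \<le> 1 / (2 * (\<mu> + 1)) * grad_norm q u + C1 * Lp_norm \<Omega> r u"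
    using Ehrling[OF r, of "1 / (2 * (\<mu> + 1))"] mu(1) by (auto simp: field_simps)
  define \<kappa> where "\<kappa> = 2 * C1 * b"
  \<comment> \<open>The gradient term of Ehrling's inequality is absorbed: \<open>\<mu> / (2 (\<mu> + 1)) \<le> 1/2\<close>.\<close>
  have kappa: "Lp_norm \<Omega> q u \<le> \<kappa>" if u: "u \<in> A" for u
  proof -
    have "Lp_norm \<Omega> q u \<le> 1 / (2 * (\<mu> + 1)) * grad_norm q u + C1 * Lp_norm \<Omega> r u"
      using C1(2) sub u by blast
    also have "\<dots> \<le> 1 / (2 * (\<mu> + 1)) * (\<mu> * Lp_norm \<Omega> q u) + C1 * b"
      using mu C1 ab(3)[OF u] u by (intro add_mono mult_left_mono) auto
    also have "1 / (2 * (\<mu> + 1)) * (\<mu> * Lp_norm \<Omega> q u) = \<mu> / (\<mu> + 1) * (Lp_norm \<Omega> q u / 2)"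
      using mu by simp
    also have "\<dots> \<le> 1 * (Lp_norm \<Omega> q u / 2)"
      using mu Lp_norm_nonneg[of q u] by (intro mult_right_mono) auto
    finally show ?thesis by (simp add: \<kappa>_def)
  qed
  have kappa0: "\<kappa> \<ge> 0" using kappa Lp_norm_nonneg A(2) by (meson ex_in_conv order_trans)
  define \<delta> where "\<delta> = \<theta> * \<tau>"
  have delta: "\<delta> > 0" using tau th by (simp add: \<delta>_def)
  define \<epsilon> where "\<epsilon> = \<delta> / (4 * (\<mu> * \<kappa> + 1))"
  have mk: "\<mu> * \<kappa> + 1 > 0" using mu kappa0 by (intro add_nonneg_pos mult_nonneg_nonneg) auto
  have eps: "\<epsilon> > 0" using mk delta by (simp add: \<epsilon>_def)
  obtain C2 where C2: "C2 \<ge> 0" "\<And>u. u \<in> W01 \<Omega> q \<Longrightarrow> Lp_norm \<Omega> q u \<le> \<epsilon> * grad_norm q u + C2 * Lp_norm \<Omega> r u"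
    using Ehrling[OF r eps] by blast
  obtain Cp where Cp: "Cp \<ge> 0" "\<And>u. u \<in> W01 \<Omega> r \<Longrightarrow> Lp_norm \<Omega> r u \<le> Cp * grad_norm r u"
    using Poincare[OF r(1)] by blast
  define \<rho> where "\<rho> = \<delta> / (2 * (C2 * Cp + 1))"
  have cc: "C2 * Cp + 1 > 0" using C2 Cp by (intro add_nonneg_pos mult_nonneg_nonneg) auto
  have rho: "\<rho> > 0" using cc delta by (simp add: \<rho>_def)
  have close: "Lp_norm \<Omega> q (u - v) \<le> \<delta>" if u: "u \<in> A" and v: "v \<in> A" and d: "grad_norm r (u - v) < \<rho>" for u v
  proof -
    have g: "grad_norm q w \<le> \<mu> * \<kappa>" if "w \<in> A" for w
      using mu(2)[OF that] kappa[OF that] mu(1) by (meson mult_left_mono order_trans)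
    have "- v \<in> A" using sym v by blast
    then have "grad_norm q (u - v) \<le> grad_norm q u + grad_norm q (- v)"
      using grad_norm_add[OF q Lq(2)[OF u] Lq(2)[OF \<open>- v \<in> A\<close>]] by simp
    then have "grad_norm q (u - v) \<le> \<mu> * \<kappa> + \<mu> * \<kappa>"
      using g[OF u] g[OF \<open>- v \<in> A\<close>] by linarith
    then have 1: "\<epsilon> * grad_norm q (u - v) \<le> \<epsilon> * (2 * (\<mu> * \<kappa>))"
      using eps by (intro mult_left_mono) linarith+
    have "\<epsilon> * (2 * (\<mu> * \<kappa>)) \<le> \<epsilon> * (2 * (\<mu> * \<kappa> + 1))" using eps by (intro mult_left_mono) auto
    also have "\<dots> = \<delta> / 2" using mk by (simp add: \<epsilon>_def field_simps)
    finally have 2: "\<epsilon> * (2 * (\<mu> * \<kappa>)) \<le> \<delta> / 2" .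
    have "Lp_norm \<Omega> r (u - v) \<le> Cp * grad_norm r (u - v)" using Cp(2) W01_diff[OF r(1)] subr u v by blast
    also have "\<dots> \<le> Cp * \<rho>" using d Cp(1) by (intro mult_left_mono) auto
    finally have "C2 * Lp_norm \<Omega> r (u - v) \<le> C2 * (Cp * \<rho>)" using C2(1) by (rule mult_left_mono)
    also have "\<dots> \<le> (C2 * Cp + 1) * \<rho>" using rho by (simp add: algebra_simps)
    also have "\<dots> = \<delta> / 2"
    proof -
      have "k * (\<delta> / (2 * k)) = \<delta> / 2" if "k > 0" for k :: real using that by simp
      from this[OF cc] show ?thesis unfolding \<rho>_def .
    qed
    finally have 3: "C2 * Lp_norm \<Omega> r (u - v) \<le> \<delta> / 2" .
    have "u - v \<in> W01 \<Omega> q" using sub u v by (intro W01_diff q) auto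
    from C2(2)[OF this] show ?thesis using 1 2 3 by linarith
  qed
  obtain F0 where F0: "finite F0" "F0 \<subseteq> A" "A \<subseteq> (\<Union>x\<in>F0. R.mball x \<rho>)"
    using R.compactin_imp_mtotally_bounded[OF cA, unfolded R.mtotally_bounded_def, rule_format, OF rho]
    by (elim exE conjE)
  \<comment> \<open>The net is symmetrised, so that the weights satisfy \<open>\<phi> (- v) (- u) = \<phi> v u\<close> and \<open>P\<close> is odd.\<close>
  define F where "F = F0 \<union> uminus ` F0"
  have F: "finite F" "F \<subseteq> A" "F \<noteq> {}" "uminus ` F = F"
    using F0 sym A(2) by (auto simp: F_def image_Un image_image)
  define \<phi> where "\<phi> = (\<lambda>v u. max 0 (\<rho> - grad_norm r (u - v)))"
  define S where "S = (\<lambda>u. \<Sum>v\<in>F. \<phi> v u)"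
  define P where "P = (\<lambda>u. \<Sum>v\<in>F. (\<phi> v u / S u) *\<^sub>R v)"
  have phi0: "\<phi> v u \<ge> 0" for u v by (simp add: \<phi>_def)
  have S: "S u > 0" if u: "u \<in> A" for u
  proof -
    obtain v where v: "v \<in> F0" "grad_norm r (v - u) < \<rho>" using F0(3) u by auto
    have "0 < \<phi> v u" using v R.commute[of v u] by (simp add: \<phi>_def)
    also have "\<dots> \<le> S u" unfolding S_def using v F(1) phi0 by (intro member_le_sum) (auto simp: F_def)
    finally show ?thesis .
  qed
  have coeff: "0 \<le> \<phi> v u / S u" if "u \<in> A" for u v using S[OF that] phi0 by simp
  have coeff_sum: "(\<Sum>v\<in>F. \<phi> v u / S u) = 1" if "u \<in> A" for u
    using S[OF that] by (simp add: S_def flip: sum_divide_distrib)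
  have near: "Lp_norm \<Omega> q (u - v) \<le> \<delta>" if "u \<in> A" "v \<in> F" "\<phi> v u \<noteq> 0" for u v
    using that F(2) by (intro close) (auto simp: \<phi>_def split: if_splits)
  have weighted: "(\<Sum>v\<in>F. \<phi> v u / S u * f v) \<le> y" if u: "u \<in> A" and f: "\<And>v. v \<in> F \<Longrightarrow> \<phi> v u \<noteq> 0 \<Longrightarrow> f v \<le> y" for u f y
  proof -
    have "(\<Sum>v\<in>F. \<phi> v u / S u * f v) \<le> (\<Sum>v\<in>F. \<phi> v u / S u * y)"
    proof (rule sum_mono)
      show "\<phi> v u / S u * f v \<le> \<phi> v u / S u * y" if "v \<in> F" for v
        using mult_left_mono[OF f[OF that] coeff[OF u, of v]] by (cases "\<phi> v u = 0") auto
    qed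
    also have "\<dots> = y" using coeff_sum[OF u] by (simp only: sum_distrib_right[symmetric] mult_1)
    finally show ?thesis .
  qed
  have d_le: "\<delta> \<le> \<theta> * Lp_norm \<Omega> q u" if "u \<in> A" for u
    unfolding \<delta>_def using tau_le[OF that] th by (intro mult_left_mono) auto
  have FW: "v \<in> W01 \<Omega> q" "v \<in> W1 \<Omega> q" "v \<in> Lp \<Omega> q" if "v \<in> F" for v using that F(2) sub Lq by blast+
  have PW: "P u \<in> W01 \<Omega> q" for u
    unfolding P_def using FW q by (intro W01_sum W01_scaleR)
  have lo: "(1 - \<theta>) * Lp_norm \<Omega> q u \<le> Lp_norm \<Omega> q (P u)" if u: "u \<in> A" for u
  proof -
    have "u = (\<Sum>v\<in>F. (\<phi> v u / S u) *\<^sub>R u)"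
      using coeff_sum[OF u] by (simp flip: scaleR_sum_left)
    then have eq: "u - P u = (\<Sum>v\<in>F. (\<phi> v u / S u) *\<^sub>R (u - v))"
      by (simp add: P_def scaleR_diff_right sum_subtractf)
    have "Lp_norm \<Omega> q (u - P u) \<le> (\<Sum>v\<in>F. \<phi> v u / S u * Lp_norm \<Omega> q (u - v))"
      unfolding eq using Lp_norm_sum_le[OF q F(1), where w="\<lambda>v. u - v" and c="\<lambda>v. \<phi> v u / S u"] coeff[OF u]
        W1D(1)[OF W1_diff[OF q Lq(2)[OF u] FW(2)]] by blast
    also have "\<dots> \<le> \<delta>" using near[OF u] by (intro weighted u)
    also have "\<dots> \<le> \<theta> * Lp_norm \<Omega> q u" by (rule d_le[OF u])
    finally have "Lp_norm \<Omega> q (u - P u) \<le> \<theta> * Lp_norm \<Omega> q u" .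
    moreover have "Lp_norm \<Omega> q u \<le> Lp_norm \<Omega> q (u - P u) + Lp_norm \<Omega> q (P u)"
      using Lp_norm_add[OF q W1D(1)[OF W1_diff[OF q Lq(2)[OF u] W01D[OF PW]]] W1D(1)[OF W01D[OF PW]], of u u] by simp
    ultimately show ?thesis by (simp add: left_diff_distrib)
  qed
  have hi: "grad_norm q (P u) \<le> \<mu> * ((1 + \<theta>) * Lp_norm \<Omega> q u)" if u: "u \<in> A" for u
  proof -
    have "grad_norm q (P u) \<le> (\<Sum>v\<in>F. \<phi> v u / S u * grad_norm q v)"
      unfolding P_def using F FW coeff[OF u] by (intro grad_norm_sum_le q) auto
    also have "\<dots> \<le> \<mu> * ((1 + \<theta>) * Lp_norm \<Omega> q u)"
    proof (rule weighted[OF u])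
      fix v assume v: "v \<in> F" "\<phi> v u \<noteq> 0"
      have vA: "v \<in> A" using v F(2) by blast
      have "- (u - v) = v - u" by simp
      then have "Lp_norm \<Omega> q (v - u) = Lp_norm \<Omega> q (u - v)"
        using Lp_norm_scaleR[of q "-1" "u - v"] q by simp
      then have "Lp_norm \<Omega> q v \<le> \<delta> + Lp_norm \<Omega> q u"
        using Lp_norm_add[OF q W1D(1)[OF W1_diff[OF q Lq(2)[OF vA] Lq(2)[OF u]]] Lq(1)[OF u]] near[OF u v] by simp
      also have "\<dots> \<le> (1 + \<theta>) * Lp_norm \<Omega> q u" using d_le[OF u] by (simp add: distrib_right)
      finally have "\<mu> * Lp_norm \<Omega> q v \<le> \<mu> * ((1 + \<theta>) * Lp_norm \<Omega> q u)" using mu(1) by (rule mult_left_mono)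
      then show "grad_norm q v \<le> \<mu> * ((1 + \<theta>) * Lp_norm \<Omega> q u)" using mu(2)[OF vA] by linarith
    qed
    finally show ?thesis .
  qed
  have phi_neg: "\<phi> (- v) (- u) = \<phi> v u" for u v
    using grad_norm_uminus[of r "u - v"] r by (simp add: \<phi>_def)
  have reindex: "(\<Sum>v\<in>F. h v) = (\<Sum>v\<in>F. h (- v))" for h :: "('a, real) aefun \<Rightarrow> 'b::comm_monoid_add"
  proof -
    have "(\<Sum>v\<in>uminus ` F. h v) = (\<Sum>v\<in>F. h (- v))" by (subst sum.reindex) (auto simp: inj_on_def)
    then show ?thesis using F(4) by simp
  qed
  have S_neg: "S (- u) = S u" for u
    unfolding S_def by (subst reindex) (simp add: phi_neg)
  have odd: "P (- u) = - P u" for u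
    unfolding P_def by (subst reindex) (simp add: phi_neg S_neg sum_negf)
  have cont_phi: "continuous_map (subtopology R.mtopology A) euclideanreal (\<phi> v)" if v: "v \<in> F" for v
  proof -
    have "continuous_map R.mtopology euclideanreal (\<lambda>u. grad_norm r (u - v))"
    proof (rule R.continuous_map_real_if_Lipschitz[where L=1])
      fix x y assume "x \<in> W01 \<Omega> r" "y \<in> W01 \<Omega> r"
      then show "\<bar>grad_norm r (x - v) - grad_norm r (y - v)\<bar> \<le> 1 * grad_norm r (x - y)"
        using R.mdist_reverse_triangle[of x v y] R.commute[of v y] v F(2) subr by auto
    qed
    then have "continuous_map R.mtopology euclideanreal (\<phi> v)"
      unfolding \<phi>_def by (intro continuous_intros) auto
    then show ?thesis by (rule continuous_map_from_subtopology)
  qed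
  have topA: "topspace (subtopology R.mtopology A) = A" using subr by auto
  have cont_S: "continuous_map (subtopology R.mtopology A) euclideanreal S"
    unfolding S_def by (intro continuous_map_sum F(1) cont_phi)
  have cont_coeff: "continuous_map (subtopology R.mtopology A) euclideanreal (\<lambda>u. \<phi> v u / S u)" if v: "v \<in> F" for v
    using cont_phi[OF v] cont_S S topA by (intro continuous_map_real_divide) force+
  have cont: "continuous_map (subtopology R.mtopology A) Q.mtopology P"
    unfolding Q.continuous_map_to_metric topA
  proof (intro ballI allI impI)
    fix x and e :: real assume x: "x \<in> A" and e: "e > 0"
    \<comment> \<open>\<open>D\<close> is continuous, vanishes at \<open>x\<close> and dominates the distance of \<open>P x\<close> from the value of \<open>P\<close>.\<close>
    define D where "D = (\<lambda>u. \<Sum>v\<in>F. \<bar>\<phi> v x / S x - \<phi> v u / S u\<bar> * grad_norm q v)"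
    have cD: "continuous_map (subtopology R.mtopology A) euclideanreal D"
      unfolding D_def
      by (intro continuous_map_sum F(1) continuous_map_real_mult continuous_map_real_abs continuous_map_diff cont_coeff) auto
    let ?U = "{u \<in> topspace (subtopology R.mtopology A). D u \<in> {..<e}}"
    have "openin (subtopology R.mtopology A) ?U"
      by (rule openin_continuous_map_preimage[OF cD]) simp
    moreover have "x \<in> ?U" using x e topA by (simp add: D_def)
    moreover have "P y \<in> Q.mball (P x) e" if "y \<in> ?U" for y
    proof -
      have eq: "P x - P y = (\<Sum>v\<in>F. \<bar>\<phi> v x / S x - \<phi> v y / S y\<bar> *\<^sub>R (sgn (\<phi> v x / S x - \<phi> v y / S y) *\<^sub>R v))"
        unfolding P_def by (simp add: abs_mult_sgn scaleR_diff_left sum_subtractf)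
      have sg: "grad_norm q (sgn t *\<^sub>R v) \<le> grad_norm q v" if "v \<in> F" for t v
        using grad_norm_scaleR[of q v "sgn t"] FW[OF that] q grad_norm_nonneg[of q v] by (auto simp: sgn_if)
      have "grad_norm q (P x - P y) \<le> (\<Sum>v\<in>F. \<bar>\<phi> v x / S x - \<phi> v y / S y\<bar> * grad_norm q (sgn (\<phi> v x / S x - \<phi> v y / S y) *\<^sub>R v))"
        unfolding eq using FW q by (intro grad_norm_sum_le F) (auto intro: W1_scaleR)
      also have "\<dots> \<le> D y" unfolding D_def by (intro sum_mono mult_left_mono sg) auto
      also have "\<dots> < e" using that by simp
      finally show ?thesis using PW by simp
    qed
    ultimately show "\<exists>U. openin (subtopology R.mtopology A) U \<and> x \<in> U \<and> (\<forall>y\<in>U. P y \<in> Q.mball (P x) e)"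
      by blast
  qed
  show thesis
  proof (rule that)
    show "continuous_map (subtopology (W01_topology \<Omega> r) A) (W01_topology \<Omega> q) P"
      using cont by (simp add: W01_topology_eq)
    show "0 < Lp_norm \<Omega> q u" if "u \<in> A" for u using tau_le[OF that] tau by linarith
    show "P (- u) = - P u" for u by (rule odd)
    show "grad_norm q (P u) \<le> \<mu> * ((1 + \<theta>) * Lp_norm \<Omega> q u)" if "u \<in> A" for u by (rule hi[OF that])
    show "(1 - \<theta>) * Lp_norm \<Omega> q u \<le> Lp_norm \<Omega> q (P u)" if "u \<in> A" for u by (rule lo[OF that])
  qed
qed

section \<open>Comparison of the eigenvalues\<close>

lemma continuous_map_W01_topology_inclusion:
  assumes r: "1 \<le> r" "r \<le> q" and sub: "W01 \<Omega> q \<subseteq> W01 \<Omega> r"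
  shows "continuous_map (W01_topology \<Omega> q) (W01_topology \<Omega> r) id"
  unfolding W01_topology_eq
proof (rule Metric_space.continuous_map_if_Lipschitz)
  show "Metric_space (W01 \<Omega> q) (\<lambda>u v. grad_norm q (u - v))" "Metric_space (W01 \<Omega> r) (\<lambda>u v. grad_norm r (u - v))"
    using r by (auto intro: Metric_space_W01)
  show "id u \<in> W01 \<Omega> r" if "u \<in> W01 \<Omega> q" for u using that sub by auto
  show "grad_norm r (id u - id v) \<le> (measure lebesgue \<Omega> + 1) powr (1 / r) * grad_norm q (u - v)"
    if "u \<in> W01 \<Omega> q" "v \<in> W01 \<Omega> q" for u v
    using grad_norm_mono_exponent[OF _ r(2) W01D[OF W01_diff[OF _ that]]] r by simp
qed

lemma mixed_eigenvalue_le_eigenvalue: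
  assumes r: "1 \<le> r" "r \<le> q" and sub: "W01 \<Omega> q \<subseteq> W01 \<Omega> r"
  shows "mixed_eigenvalue \<Omega> k q r \<le> eigenvalue \<Omega> k q"
  unfolding mixed_eigenvalue_def eigenvalue_def
proof (rule INF_superset_mono[OF _ order_refl], rule subsetI)
  fix A assume "A \<in> Sigma_k \<Omega> k q"
  then have A: "A \<subseteq> W01 \<Omega> q - {0}" "uminus ` A = A" "compactin (W01_topology \<Omega> q) A" "enat k \<le> genus (W01_topology \<Omega> q) A"
    by (auto simp: Sigma_k_def)
  note id = continuous_map_W01_topology_inclusion[OF assms]
  have "compactin (W01_topology \<Omega> r) A" using image_compactin[OF A(3) id] by simp
  moreover have "genus (W01_topology \<Omega> q) A \<le> genus (W01_topology \<Omega> r) A"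
  proof (rule genus_le_genus_of_odd_map[where f=id])
    show "continuous_map (subtopology (W01_topology \<Omega> q) A) (subtopology (W01_topology \<Omega> r) A) id"
      by (intro continuous_map_into_subtopology continuous_map_from_subtopology id) auto
  qed auto
  ultimately show "A \<in> {A \<in> Sigma_k \<Omega> k r. A \<subseteq> W1 \<Omega> q}"
    using A sub W01D by (auto simp: Sigma_k_def intro: order_trans)
qed

text \<open>
  For a finite supremum \<open>m\<close> the images of \<open>A\<close> under the approximating maps are admissible for
  \<open>\<lambda>\<^sub>k(q)\<close>, with Rayleigh quotients at most \<open>m ((1 + \<theta>) / (1 - \<theta>))\<^sup>q\<close>; let \<open>\<theta>\<close> tend to \<open>0\<close>.
\<close>

lemma eigenvalue_le_SUP_rayleigh:
  assumes r: "1 \<le> r" "r \<le> q" and A: "A \<in> Sigma_k \<Omega> k r" and sub: "A \<subseteq> W01 \<Omega> q"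
  shows "eigenvalue \<Omega> k q \<le> (SUP u\<in>A. ereal (rayleigh \<Omega> q u))"
proof (cases "A = {}")
  case True
  have "topspace (W01_topology \<Omega> q) = W01 \<Omega> q"
    using Metric_space.topspace_mtopology[OF Metric_space_W01, of q] r by (simp add: W01_topology_eq)
  with A True have "A \<in> Sigma_k \<Omega> k q" by (auto simp: Sigma_k_def genus_def)
  then show ?thesis unfolding eigenvalue_def by (rule INF_lower)
next
  case False
  have q: "q \<ge> 1" using r by simp
  note A' = A[unfolded Sigma_k_def, simplified]
  have A0: "0 \<notin> A" using A' by blast
  define M where "M = (SUP u\<in>A. ereal (rayleigh \<Omega> q u))"
  have rM: "ereal (rayleigh \<Omega> q u) \<le> M" if "u \<in> A" for u unfolding M_def using that by (rule SUP_upper)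
  obtain u0 where "u0 \<in> A" using False by blast
  have "0 \<le> ereal (rayleigh \<Omega> q u0)" by (simp add: rayleigh_eq)
  then have M0: "0 \<le> M" using rM[OF \<open>u0 \<in> A\<close>] by (rule order_trans)
  show ?thesis
  proof (cases "M = \<infinity>")
    case True
    then show ?thesis by (simp add: M_def[symmetric])
  next
    case False
    then obtain m where m: "M = ereal m" "0 \<le> m" using M0 by (cases M) auto
    define \<mu> where "\<mu> = m powr (1 / q)"
    have muq: "\<mu> powr q = m" using q m by (simp add: \<mu>_def powr_powr)
    have mu: "grad_norm q u \<le> \<mu> * Lp_norm \<Omega> q u" if u: "u \<in> A" for u
    proof -
      have "u \<in> Lp \<Omega> q" using sub u W01D W1D(1) by blast
      then have "Lp_norm \<Omega> q u \<noteq> 0" using Lp_norm_eq_0 u A0 by blast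
      then have pos: "Lp_norm \<Omega> q u > 0" using Lp_norm_nonneg[of q u] by simp
      have "rayleigh \<Omega> q u \<le> m" using rM[OF u] m by simp
      then have "grad_norm q u powr q \<le> m * Lp_norm \<Omega> q u powr q"
        using pos by (simp add: rayleigh_eq divide_le_eq)
      also have "\<dots> = (\<mu> * Lp_norm \<Omega> q u) powr q" by (simp add: powr_mult muq)
      finally show ?thesis
        using q pos by (elim powr_le_powr_imp_le) (auto simp: \<mu>_def)
    qed
    have bound: "eigenvalue \<Omega> k q \<le> ereal (m * ((1 + \<theta>) / (1 - \<theta>)) powr q)" if th: "0 < \<theta>" "\<theta> < 1" for \<theta>
    proof -
      obtain P where P: "continuous_map (subtopology (W01_topology \<Omega> r) A) (W01_topology \<Omega> q) P"
        "\<And>u. u \<in> A \<Longrightarrow> P (- u) = - P u"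
        "\<And>u. u \<in> A \<Longrightarrow> grad_norm q (P u) \<le> \<mu> * ((1 + \<theta>) * Lp_norm \<Omega> q u)"
        "\<And>u. u \<in> A \<Longrightarrow> (1 - \<theta>) * Lp_norm \<Omega> q u \<le> Lp_norm \<Omega> q (P u)"
        "\<And>u. u \<in> A \<Longrightarrow> 0 < Lp_norm \<Omega> q u"
        by (rule finite_dimensional_approximation[OF r sub _ _ \<open>A \<noteq> {}\<close> A0 _ mu th(1)])
          (use A' in \<open>auto simp: \<mu>_def\<close>)
      have Ppos: "Lp_norm \<Omega> q (P u) > 0" if "u \<in> A" for u
        using P(4)[OF that] P(5)[OF that] th by (meson diff_gt_0_iff_gt less_le_trans mult_pos_pos)
      have top: "topspace (W01_topology \<Omega> s) = W01 \<Omega> s" if "s \<ge> 1" for s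
        using Metric_space.topspace_mtopology[OF Metric_space_W01[OF that]] by (simp add: W01_topology_eq)
      have subr: "A \<subseteq> W01 \<Omega> r" using A' by blast
      have PW: "P u \<in> W01 \<Omega> q" if "u \<in> A" for u
        using continuous_map_image_subset_topspace[OF P(1)] that subr top[OF q] top[OF r(1)] by auto
      have P0: "P u \<noteq> 0" if "u \<in> A" for u
        using Ppos[OF that] Lp_norm_zero[of q, where 'b=real] q by auto
      have "P ` A \<in> Sigma_k \<Omega> k q"
        unfolding Sigma_k_def mem_Collect_eq
      proof (intro conjI)
        show "P ` A \<subseteq> W01 \<Omega> q - {0}" using PW P0 by auto
        have "uminus ` P ` A = P ` uminus ` A" using P(2) by (force simp: image_image)
        then show "uminus ` P ` A = P ` A" using A' by simp
        have "compactin (subtopology (W01_topology \<Omega> r) A) A" using A' by (simp add: compactin_subtopology)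
        then show "compactin (W01_topology \<Omega> q) (P ` A)" using P(1) by (rule image_compactin)
        have "genus (W01_topology \<Omega> r) A \<le> genus (W01_topology \<Omega> q) (P ` A)"
        proof (rule genus_le_genus_of_odd_map[where f=P])
          show "continuous_map (subtopology (W01_topology \<Omega> r) A) (subtopology (W01_topology \<Omega> q) (P ` A)) P"
            using P(1) by (rule continuous_map_into_subtopology) auto
        qed (use P(2) in auto)
        then show "enat k \<le> genus (W01_topology \<Omega> q) (P ` A)" using A' by (meson order_trans)
      qed
      then have "eigenvalue \<Omega> k q \<le> (SUP w\<in>P ` A. ereal (rayleigh \<Omega> q w))"
        unfolding eigenvalue_def by (rule INF_lower)
      also have "\<dots> \<le> ereal (m * ((1 + \<theta>) / (1 - \<theta>)) powr q)"
      proof (rule SUP_least, clarify)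
        fix u assume u: "u \<in> A"
        have "rayleigh \<Omega> q (P u) = (grad_norm q (P u) / Lp_norm \<Omega> q (P u)) powr q"
          by (simp add: rayleigh_eq powr_divide)
        also have "\<dots> \<le> (\<mu> * ((1 + \<theta>) * Lp_norm \<Omega> q u) / ((1 - \<theta>) * Lp_norm \<Omega> q u)) powr q"
          using P(3,4,5)[OF u] th q by (intro powr_mono2 frac_le) (auto simp: grad_norm_nonneg Lp_norm_nonneg \<mu>_def)
        also have "\<dots> = (\<mu> * ((1 + \<theta>) / (1 - \<theta>))) powr q" using P(5)[OF u] by simp
        also have "\<dots> = m * ((1 + \<theta>) / (1 - \<theta>)) powr q" by (simp only: powr_mult muq)
        finally show "ereal (rayleigh \<Omega> q (P u)) \<le> ereal (m * ((1 + \<theta>) / (1 - \<theta>)) powr q)" by simp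
      qed
      finally show ?thesis .
    qed
    define \<theta> where "\<theta> = (\<lambda>n. inverse (real (Suc (Suc n))))"
    have th: "0 < \<theta> n" "\<theta> n < 1" for n by (auto simp: \<theta>_def field_simps)
    have "\<theta> \<longlonglongrightarrow> 0" unfolding \<theta>_def using LIMSEQ_Suc[OF LIMSEQ_inverse_real_of_nat] .
    then have "(\<lambda>n. m * ((1 + \<theta> n) / (1 - \<theta> n)) powr q) \<longlonglongrightarrow> m * ((1 + 0) / (1 - 0)) powr q"
      by (intro tendsto_intros) auto
    then have lim: "(\<lambda>n. ereal (m * ((1 + \<theta> n) / (1 - \<theta> n)) powr q)) \<longlonglongrightarrow> ereal m" by simp
    have "eigenvalue \<Omega> k q \<le> ereal m"
      by (rule LIMSEQ_le_const[OF lim]) (use bound[OF th] in blast)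
    then show ?thesis using m(1) by (simp add: M_def[symmetric])
  qed
qed

end

theorem lemmaA8:
  fixes \<Omega> :: "'a::euclidean_space set" and q r :: real
  assumes "1 < r" and "r < q"
    and "open \<Omega>" and "connected \<Omega>" and "\<Omega> \<noteq> {}" and "bounded \<Omega>"
    and "W1 \<Omega> q \<inter> W01 \<Omega> r = W01 \<Omega> q"
  shows "\<forall>k::nat. eigenvalue \<Omega> k q = mixed_eigenvalue \<Omega> k q r"
proof (intro allI antisym)
  interpret bounded_open_set \<Omega> using assms(3,6) by unfold_locales
  fix k
  show "eigenvalue \<Omega> k q \<le> mixed_eigenvalue \<Omega> k q r"
    unfolding mixed_eigenvalue_def
  proof (rule INF_greatest)
    fix A assume A: "A \<in> {A \<in> Sigma_k \<Omega> k r. A \<subseteq> W1 \<Omega> q}"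
    then have "A \<subseteq> W01 \<Omega> q" using assms(7) by (auto simp: Sigma_k_def)
    with A show "eigenvalue \<Omega> k q \<le> (SUP u\<in>A. ereal (rayleigh \<Omega> q u))"
      using assms(1,2) by (intro eigenvalue_le_SUP_rayleigh[of r]) auto
  qed
  show "mixed_eigenvalue \<Omega> k q r \<le> eigenvalue \<Omega> k q"
    using assms(1,2,7) by (intro mixed_eigenvalue_le_eigenvalue) auto
qed

end
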